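(* Let $n\ge2$ and let $Q$ be the affine quiver of type $\widetilde{A}_{2n-1,1}$, with $X_?$, $X_\delta$ and $M_1(l)$ as in the context. Then: (1) $X_\delta X_{I_1[-1]}=q^{\frac12}X_{M_1(0)}+q^{-\frac12}X_{I_{2n}[-1]}$; (2) $X_\delta X_{M_1(0)}=q^{\frac12}X_{M_1(1)}+q^{-\frac12}X_{I_1[-1]}$; (3) $X_\delta X_{M_1(l)}=q^{\frac12}X_{M_1(l+1)}+q^{-\frac12}X_{M_1(l-1)}$ for $l\ge1$.
   Context: Fix $n\ge2$. $\Lambda$ is the skew-symmetric $2n\times 2n$ integer matrix with $\Lambda_{ij}=1$ for $i<j$ with $j-i$ odd and $\Lambda_{ij}=0$ for $i<j$ with $j-i$ even; write $\Lambda(\mathbf e,\mathbf f)=\mathbf e^{tr}\Lambda\mathbf f$. $B=(b_{ij})$ is the skew-symmetric $2n\times2n$ matrix with $b_{i,i+1}=1$ ($1\le i\le 2n-1$), $b_{1,2n}=1$, and all other entries above the diagonal $0$. $\mathbb F$ is a finite field with $q$ elements. The quantum torus is the $\mathbb Z[q^{\pm\frac12}]$-algebra with basis $\{X^{\mathbf e}:\mathbf e\in\mathbb Z^{2n}\}$ and product $X^{\mathbf e}X^{\mathbf f}=q^{\Lambda(\mathbf e,\mathbf f)/2}X^{\mathbf e+\mathbf f}$; put $X_i=X^{\mathbf e_i}$. The identities are identities in the torus. $Q$ is the quiver with vertices $1,\dots,2n$ and arrows $i\to i+1$ ($1\le i\le 2n-1$) and $1\to 2n$. Let $k$ be the degree-$2$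 extension of $\mathbb F$. Representations are finite-dimensional representations of $Q$ over $k$; $\mathbf{dim}$ is the dimension vector over $k$; $P_i,I_i$ are the projective and injective representations at vertex $i$. $R=(r_{ij})$ with $r_{ij}$ the number of arrows $j\to i$. The Euler form is $\langle \mathbf v,\mathbf w\rangle=2\mathbf v^{tr}(\mathbf I-R^{tr})\mathbf w$. In the cluster category $\mathcal C_Q$ of $Q$ over $k$ (shift $[1]$) each object is uniquely $V\oplus P[1]$ with $V$ a representation and $P$ a projective representation, and $I_i[-1]\cong P_i[1]$. For $V$ a representation with $\mathbf v=\mathbf{dim}\,V$ and $P$ projective, $$X_{V\oplus P[1]}=\sum_{\mathbf e}|\mathrm{Gr}_{\mathbf e}V|\,q^{-\frac12\langle\mathbf e,\mathbf v-\mathbf e\rangle}X^{-B\mathbf e-(\mathbf I-R^{tr})\mathbf v+\mathbf t_P},\qquad \mathbf t_P=\mathbf{dim}(P/\mathrm{rad}P),$$ where $\mathrm{Gr}_{\mathbf e}V$ is the set of subrepresentations of $V$ of dimension vector $\mathbf e$. In particular $X_{I_i[-1]}=X_{P_i[1]}=X_i$. $\delta=(1,\dots,1)$. For $\lambda\in k$, $E(\lambda)$ is the representation with $k$ at each vertex, identity maps on the arrows $i\to i+1$ and multiplication by $\lambda$ on $1\to 2n$; $X_\delta:=X_{E(\lambda)}$ (independent of $\lambda$). For $l\ge0$, $M_1(l)$ is the indecomposable preprojective representation with $\mathbf{dim}\,M_1(l)=\mathbf{dim}\,P_2+l\delta$. *)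

theory Defs
  imports
    "HOL-Library.Function_Algebras"
    "HOL-Library.Cardinality"
    "HOL-Library.FuncSet"
    "HOL-Algebra.Module"
    "Graph_Theory.Arc_Walk"
begin

section \<open>Degree two extensions\<close>

definition degree2_extension :: "('f::field \<Rightarrow> 'k::field) \<Rightarrow> bool" where
  "degree2_extension \<iota> \<longleftrightarrow>
     \<iota> 1 = 1 \<and> (\<forall>a b. \<iota> (a + b) = \<iota> a + \<iota> b) \<and> (\<forall>a b. \<iota> (a * b) = \<iota> a * \<iota> b) \<and>
     vector_space.dim (\<lambda>a x. \<iota> a * x) (UNIV :: 'k set) = 2"


section \<open>Representations of a quiver\<close>

text \<open>
  A quiver is a multidigraph. All representations live in one fixed infinite-dimensional
  space, which contains a copy of every finite-dimensional space. Its elements are the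
  functions from arc sequences to the field, so that the path basis of a projective
  representation is available without a choice of enumeration.
\<close>

type_synonym quiver = "(nat, nat) pre_digraph"

type_synonym 'k pvec = "nat list \<Rightarrow> 'k"

definition pscale :: "'k::field \<Rightarrow> 'k pvec \<Rightarrow> 'k pvec" where
  "pscale c v = (\<lambda>p. c * v p)"

global_interpretation pv: vector_space "pscale :: 'k::field \<Rightarrow> 'k pvec \<Rightarrow> 'k pvec"
  by unfold_locales (auto simp: pscale_def algebra_simps fun_eq_iff)

definition linear_into :: "'k::field pvec set \<Rightarrow> 'k pvec set \<Rightarrow> ('k pvec \<Rightarrow> 'k pvec) \<Rightarrow> bool" where
  "linear_into U W f \<longleftrightarrow>
     (\<forall>x\<in>U. f x \<in> W) \<and> (\<forall>x\<in>U. \<forall>y\<in>U. f (x + y) = f x + f y) \<and>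
     (\<forall>c. \<forall>x\<in>U. f (pscale c x) = pscale c (f x))"

text \<open>Only the values of \<open>sp\<close> on vertices, and those of \<open>act\<close> on arcs \<open>a\<close> and on vectors of the
  space at the tail of \<open>a\<close>, carry information.\<close>

record 'k rep =
  sp :: "nat \<Rightarrow> 'k pvec set"
  act :: "nat \<Rightarrow> 'k pvec \<Rightarrow> 'k pvec"

definition is_rep :: "quiver \<Rightarrow> 'k::field rep \<Rightarrow> bool" where
  "is_rep Q V \<longleftrightarrow>
     (\<forall>i\<in>verts Q. pv.subspace (sp V i) \<and> (\<exists>S. finite S \<and> pv.span S = sp V i)) \<and>
     (\<forall>a\<in>arcs Q. linear_into (sp V (tail Q a)) (sp V (head Q a)) (act V a))"

text \<open>Vectors indexed by the vertices are functions that vanish elsewhere.\<close>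

definition dimv :: "quiver \<Rightarrow> 'k::field rep \<Rightarrow> nat \<Rightarrow> nat" where
  "dimv Q V = (\<lambda>i. if i \<in> verts Q then pv.dim (sp V i) else 0)"

definition zero_rep :: "'k::field rep" where
  "zero_rep = \<lparr>sp = (\<lambda>i. {0}), act = (\<lambda>a x. 0)\<rparr>"

text \<open>Extensionality makes a subrepresentation determine its family of subspaces uniquely, so that
  counting such families counts subrepresentations.\<close>

definition subreps :: "quiver \<Rightarrow> 'k::field rep \<Rightarrow> (nat \<Rightarrow> 'k pvec set) set" where
  "subreps Q V = {U \<in> extensional (verts Q).
     (\<forall>i\<in>verts Q. pv.subspace (U i) \<and> U i \<subseteq> sp V i) \<and>
     (\<forall>a\<in>arcs Q. act V a ` U (tail Q a) \<subseteq> U (head Q a))}"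

definition quiver_grass :: "quiver \<Rightarrow> (nat \<Rightarrow> nat) \<Rightarrow> 'k::field rep \<Rightarrow> (nat \<Rightarrow> 'k pvec set) set" where
  "quiver_grass Q e V = {U \<in> subreps Q V. \<forall>i\<in>verts Q. pv.dim (U i) = e i}"

definition indecomposable :: "quiver \<Rightarrow> 'k::field rep \<Rightarrow> bool" where
  "indecomposable Q V \<longleftrightarrow>
     (\<exists>i\<in>verts Q. sp V i \<noteq> {0}) \<and>
     \<not> (\<exists>U\<in>subreps Q V. \<exists>W\<in>subreps Q V.
          (\<exists>i\<in>verts Q. U i \<noteq> {0}) \<and> (\<exists>i\<in>verts Q. W i \<noteq> {0}) \<and>
          (\<forall>i\<in>verts Q. U i \<inter> W i = {0} \<and> {x + y | x y. x \<in> U i \<and> y \<in> W i} = sp V i))"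

definition maximal_subreps :: "quiver \<Rightarrow> 'k::field rep \<Rightarrow> (nat \<Rightarrow> 'k pvec set) set" where
  "maximal_subreps Q V = {U \<in> subreps Q V.
     (\<exists>i\<in>verts Q. U i \<noteq> sp V i) \<and>
     (\<forall>W\<in>subreps Q V. (\<forall>i\<in>verts Q. U i \<subseteq> W i) \<longrightarrow>
        (\<forall>i\<in>verts Q. W i = U i) \<or> (\<forall>i\<in>verts Q. W i = sp V i))}"

definition rad :: "quiver \<Rightarrow> 'k::field rep \<Rightarrow> nat \<Rightarrow> 'k pvec set" where
  "rad Q V i = sp V i \<inter> (\<Inter>U\<in>maximal_subreps Q V. U i)"

definition top_dimv :: "quiver \<Rightarrow> 'k::field rep \<Rightarrow> nat \<Rightarrow> int" where
  "top_dimv Q V = (\<lambda>i. if i \<in> verts Q then int (pv.dim (sp V i)) - int (pv.dim (rad Q V i)) else 0)"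

text \<open>The projective at \<open>i\<close> has as basis at \<open>j\<close> the paths from \<open>i\<close> to \<open>j\<close>,
  and an arc \<open>a\<close> sends a path \<open>p\<close> to \<open>p @ [a]\<close>.\<close>

definition proj :: "quiver \<Rightarrow> nat \<Rightarrow> 'k::field rep" where
  "proj Q i =
     \<lparr>sp = (\<lambda>j. {v. (\<forall>p. v p \<noteq> 0 \<longrightarrow> pre_digraph.awalk Q i p j)}),
      act = (\<lambda>a v p. if p \<noteq> [] \<and> last p = a then v (butlast p) else 0)\<rparr>"


section \<open>Almost split sequences and preprojectives\<close>

definition rep_hom :: "quiver \<Rightarrow> 'k::field rep \<Rightarrow> 'k rep \<Rightarrow> (nat \<Rightarrow> 'k pvec \<Rightarrow> 'k pvec) \<Rightarrow> bool" where
  "rep_hom Q V W f \<longleftrightarrow>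
     (\<forall>i\<in>verts Q. linear_into (sp V i) (sp W i) (f i)) \<and>
     (\<forall>a\<in>arcs Q. \<forall>x\<in>sp V (tail Q a). f (head Q a) (act V a x) = act W a (f (tail Q a) x))"

definition rep_iso :: "quiver \<Rightarrow> 'k::field rep \<Rightarrow> 'k rep \<Rightarrow> bool" where
  "rep_iso Q V W \<longleftrightarrow> (\<exists>f. rep_hom Q V W f \<and> (\<forall>i\<in>verts Q. bij_betw (f i) (sp V i) (sp W i)))"

definition hom_eq :: "quiver \<Rightarrow> 'k::field rep \<Rightarrow> (nat \<Rightarrow> 'k pvec \<Rightarrow> 'k pvec) \<Rightarrow>
    (nat \<Rightarrow> 'k pvec \<Rightarrow> 'k pvec) \<Rightarrow> bool" where
  "hom_eq Q V f g \<longleftrightarrow> (\<forall>i\<in>verts Q. \<forall>x\<in>sp V i. f i x = g i x)"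

definition split_mono :: "quiver \<Rightarrow> 'k::field rep \<Rightarrow> 'k rep \<Rightarrow> (nat \<Rightarrow> 'k pvec \<Rightarrow> 'k pvec) \<Rightarrow> bool" where
  "split_mono Q V W f \<longleftrightarrow> (\<exists>r. rep_hom Q W V r \<and> hom_eq Q V (\<lambda>i x. r i (f i x)) (\<lambda>i x. x))"

definition split_epi :: "quiver \<Rightarrow> 'k::field rep \<Rightarrow> 'k rep \<Rightarrow> (nat \<Rightarrow> 'k pvec \<Rightarrow> 'k pvec) \<Rightarrow> bool" where
  "split_epi Q V W g \<longleftrightarrow> (\<exists>s. rep_hom Q W V s \<and> hom_eq Q W (\<lambda>i x. g i (s i x)) (\<lambda>i x. x))"

definition short_exact :: "quiver \<Rightarrow> 'k::field rep \<Rightarrow> (nat \<Rightarrow> 'k pvec \<Rightarrow> 'k pvec) \<Rightarrow> 'k rep \<Rightarrow>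
    (nat \<Rightarrow> 'k pvec \<Rightarrow> 'k pvec) \<Rightarrow> 'k rep \<Rightarrow> bool" where
  "short_exact Q U f E g W \<longleftrightarrow>
     is_rep Q U \<and> is_rep Q E \<and> is_rep Q W \<and> rep_hom Q U E f \<and> rep_hom Q E W g \<and>
     (\<forall>i\<in>verts Q. inj_on (f i) (sp U i) \<and> g i ` sp E i = sp W i \<and>
        f i ` sp U i = {x \<in> sp E i. g i x = 0})"

definition left_almost_split ::
    "quiver \<Rightarrow> 'k::field rep \<Rightarrow> 'k rep \<Rightarrow> (nat \<Rightarrow> 'k pvec \<Rightarrow> 'k pvec) \<Rightarrow> bool" where
  "left_almost_split Q U E f \<longleftrightarrow> \<not> split_mono Q U E f \<and>
     (\<forall>Y h. is_rep Q Y \<and> rep_hom Q U Y h \<and> \<not> split_mono Q U Y h \<longrightarrow>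
        (\<exists>h'. rep_hom Q E Y h' \<and> hom_eq Q U (\<lambda>i x. h' i (f i x)) h))"

definition right_almost_split ::
    "quiver \<Rightarrow> 'k::field rep \<Rightarrow> 'k rep \<Rightarrow> (nat \<Rightarrow> 'k pvec \<Rightarrow> 'k pvec) \<Rightarrow> bool" where
  "right_almost_split Q E W g \<longleftrightarrow> \<not> split_epi Q E W g \<and>
     (\<forall>Y h. is_rep Q Y \<and> rep_hom Q Y W h \<and> \<not> split_epi Q Y W h \<longrightarrow>
        (\<exists>h'. rep_hom Q Y E h' \<and> hom_eq Q Y (\<lambda>i x. g i (h' i x)) h))"

definition almost_split :: "quiver \<Rightarrow> 'k::field rep \<Rightarrow> (nat \<Rightarrow> 'k pvec \<Rightarrow> 'k pvec) \<Rightarrow> 'k rep \<Rightarrow>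
    (nat \<Rightarrow> 'k pvec \<Rightarrow> 'k pvec) \<Rightarrow> 'k rep \<Rightarrow> bool" where
  "almost_split Q U f E g W \<longleftrightarrow>
     short_exact Q U f E g W \<and> left_almost_split Q U E f \<and> right_almost_split Q E W g"

text \<open>
  The indecomposable preprojectives are the inverse Auslander--Reiten translates \<open>\<tau>\<^sup>-\<^sup>m P\<^sub>i\<close>,
  where \<open>W\<close> is the inverse translate of \<open>U\<close> if there is an almost split sequence from \<open>U\<close> to \<open>W\<close>.
\<close>

inductive indec_preprojective :: "quiver \<Rightarrow> 'k::field rep \<Rightarrow> bool" for Q where
  proj: "i \<in> verts Q \<Longrightarrow> is_rep Q V \<Longrightarrow> rep_iso Q V (proj Q i) \<Longrightarrow> indec_preprojective Q V"
| translate: "indec_preprojective Q U \<Longrightarrow> almost_split Q U f E g W \<Longrightarrow> indec_preprojective Q W"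


section \<open>Matrices and the quantum torus\<close>

definition mat_vec :: "nat set \<Rightarrow> (nat \<Rightarrow> nat \<Rightarrow> int) \<Rightarrow> (nat \<Rightarrow> int) \<Rightarrow> nat \<Rightarrow> int" where
  "mat_vec S A v = (\<lambda>i. if i \<in> S then \<Sum>j\<in>S. A i j * v j else 0)"

definition bilin :: "nat set \<Rightarrow> (nat \<Rightarrow> nat \<Rightarrow> int) \<Rightarrow> (nat \<Rightarrow> int) \<Rightarrow> (nat \<Rightarrow> int) \<Rightarrow> int" where
  "bilin S A v w = (\<Sum>i\<in>S. v i * mat_vec S A w i)"

definition Lam :: "nat \<Rightarrow> nat \<Rightarrow> int" where
  "Lam i j = (if i < j \<and> odd (j - i) then 1 else if j < i \<and> odd (i - j) then - 1 else 0)"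

definition Bmat :: "nat \<Rightarrow> nat \<Rightarrow> nat \<Rightarrow> int" where
  "Bmat n i j =
     (if j = i + 1 \<or> (i = 1 \<and> j = 2 * n) then 1
      else if i = j + 1 \<or> (j = 1 \<and> i = 2 * n) then - 1 else 0)"

definition Rmat :: "quiver \<Rightarrow> nat \<Rightarrow> nat \<Rightarrow> int" where
  "Rmat Q i j = int (card {a \<in> arcs Q. tail Q a = j \<and> head Q a = i})"

definition id_minus_Rtr :: "quiver \<Rightarrow> nat \<Rightarrow> nat \<Rightarrow> int" where
  "id_minus_Rtr Q i j = (if i = j then 1 else 0) - Rmat Q j i"

definition euler_form :: "quiver \<Rightarrow> (nat \<Rightarrow> int) \<Rightarrow> (nat \<Rightarrow> int) \<Rightarrow> int" where
  "euler_form Q v w = 2 * bilin (verts Q) (id_minus_Rtr Q) v w"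

text \<open>The ring \<open>\<int>[q\<^sup>1\<^sup>/\<^sup>2, q\<^sup>-\<^sup>1\<^sup>/\<^sup>2]\<close> as a subring of the reals.\<close>

inductive_set Z_half :: "nat \<Rightarrow> real set" for q where
  of_int: "of_int m \<in> Z_half q"
| root: "real q powr (1/2) \<in> Z_half q"
| inverse_root: "real q powr (- 1/2) \<in> Z_half q"
| plus: "x \<in> Z_half q \<Longrightarrow> y \<in> Z_half q \<Longrightarrow> x + y \<in> Z_half q"
| times: "x \<in> Z_half q \<Longrightarrow> y \<in> Z_half q \<Longrightarrow> x * y \<in> Z_half q"

text \<open>An element of the torus is its coefficient function in the basis \<open>X\<^sup>e\<close>, where \<open>e\<close> is an
  integer vector supported on \<open>{1..2n}\<close>.\<close>

definition monom :: "(nat \<Rightarrow> int) \<Rightarrow> (nat \<Rightarrow> int) \<Rightarrow> real" where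
  "monom e = (\<lambda>g. if g = e then 1 else 0)"

definition qtorus :: "nat \<Rightarrow> nat \<Rightarrow> (real, (nat \<Rightarrow> int) \<Rightarrow> real) module" where
  "qtorus q n =
     \<lparr>carrier = {x. finite {e. x e \<noteq> 0} \<and> range x \<subseteq> Z_half q \<and>
                    (\<forall>e. x e \<noteq> 0 \<longrightarrow> (\<forall>i. i \<notin> {1..2*n} \<longrightarrow> e i = 0))},
      mult = (\<lambda>x y g. \<Sum>(e, f) \<in> {(e, f). x e \<noteq> 0 \<and> y f \<noteq> 0 \<and> e + f = g}.
                 x e * y f * real q powr (of_int (bilin {1..2*n} Lam e f) / 2)),
      one = monom 0,
      zero = 0,
      add = (+),
      smult = (\<lambda>c x g. c * x g)\<rparr>"


section \<open>The affine quiver and the quantum cluster character\<close>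

text \<open>The arc \<open>a < 2n\<close> goes from \<open>a\<close> to \<open>a + 1\<close>, and the arc \<open>2n\<close> goes from \<open>1\<close> to \<open>2n\<close>.\<close>

definition Qaff :: "nat \<Rightarrow> quiver" where
  "Qaff n = \<lparr>verts = {1..2*n}, arcs = {1..2*n},
             tail = (\<lambda>a. if a = 2*n then 1 else a),
             head = (\<lambda>a. if a = 2*n then 2*n else a + 1)\<rparr>"

text \<open>The one-dimensional space at every vertex is the span of the basis vector at the empty list.\<close>

definition Erep :: "nat \<Rightarrow> 'k::field \<Rightarrow> 'k rep" where
  "Erep n c = \<lparr>sp = (\<lambda>i. {v. \<forall>p. p \<noteq> [] \<longrightarrow> v p = 0}),
                act = (\<lambda>a v. if a = 2*n then pscale c v else v)\<rparr>"

text \<open>The object \<open>V \<oplus> P[1]\<close> of the cluster category is the pair \<open>(V, P)\<close>, for a representation \<open>V\<close>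
  and a projective representation \<open>P\<close>. The object \<open>I\<^sub>i[-1]\<close> is given through
  its isomorphism with \<open>P\<^sub>i[1]\<close>.\<close>

type_synonym 'k cluster_object = "'k rep \<times> 'k rep"

definition rep_object :: "'k::field rep \<Rightarrow> 'k cluster_object" where
  "rep_object V = (V, zero_rep)"

definition inj_unshift :: "quiver \<Rightarrow> nat \<Rightarrow> 'k::field cluster_object" where
  "inj_unshift Q i = (zero_rep, proj Q i)"

text \<open>The sum is over \<open>e \<le> v\<close>, outside of which the Grassmannians are empty;
  it is the pointwise sum of coefficient functions.\<close>

definition qchar :: "nat \<Rightarrow> nat \<Rightarrow> 'k::field cluster_object \<Rightarrow> (nat \<Rightarrow> int) \<Rightarrow> real" where
  "qchar q n = (\<lambda>(V, P).
     let Q = Qaff n; v = (\<lambda>i. int (dimv Q V i)) in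
     \<Sum>e \<in> {e. \<forall>i. e i \<le> dimv Q V i}.
       (real (card (quiver_grass Q e V)) *
          real q powr (- 1/2 * of_int (euler_form Q (int \<circ> e) (v - (int \<circ> e)))))
       \<odot>\<^bsub>qtorus q n\<^esub>
       monom (- mat_vec (verts Q) (Bmat n) (int \<circ> e)
              - mat_vec (verts Q) (id_minus_Rtr Q) v + top_dimv Q P))"

end

(*
  X_delta is a sum of 2n + 1 monomials, and the formula is compared monomial by monomial: it becomes the
  recursion flag_count for the number of subrepresentations of M_1(l), up to powers of q that follow from
  B^tr Lambda = 2 I.

  An indecomposable V of dimension vector (l, l+1, ..., l+1) has negative defect dim V_1 - dim V_2n. A
  subrepresentation of V of maximal defect splits off, because its extension group by the quotient vanishes;
  by indecomposability it is zero, so that all nonzero subrepresentations of V have negative defect.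
  Therefore the arrows 2 -> 3 -> ... -> 2n act bijectively and 1 -> 2n acts injectively, and V is given by a
  hyperplane of V_2n and a linear map b from it to V_2n without invariant subspaces. Its subrepresentations
  are flags in V_2n. Intersecting them with the hyperplane reduces l to l - 1 and yields the recursion.
*)
theory Submission
  imports Defs "HOL-Library.Product_Plus"
begin

section \<open>Subspaces over a finite field\<close>

text \<open>The recursion and the product share an index set. The nonempty Grassmannians of
  E(\<lambda>) are single points, at the indicator vectors of {j..2n} for j = 1, ..., 2n + 1, and j
  is also the first vertex at which a flag leaves the hyperplane. So the monomial j of X_\<delta>
  meets the flags of type j. The match is imperfect for j = 1 alone: the new space at vertex 1 has
  to fit into the restricted space at 2n without lying in the smaller hyperplane, and the flags that
  leave no room for it must be subtracted. They are the flags of the configuration two steps lower,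
  and they account for the second summand of each identity. The vanishing of the extension group is
  not taken from Auslander-Reiten duality. A nonzero element of the dual of the extension group is
  instead produced by linear algebra, as a family of maps against the arrows. It plays the role of a
  homomorphism from X to the translate of M / X, and its kernel and image are compared through
  dimension counts. Since k is finite, dimension formulas are read off from cardinalities, and |k| =
  q^2 matches the factor 2 of the Euler form.\<close>

lemma card_additive_image:
  fixes f :: "'a::ab_group_add \<Rightarrow> 'b::ab_group_add"
  assumes "finite A" and diff: "\<And>x y. x \<in> A \<Longrightarrow> y \<in> A \<Longrightarrow> x - y \<in> A"
    and add: "\<And>x y. x \<in> A \<Longrightarrow> y \<in> A \<Longrightarrow> f (x - y) = f x - f y"
  shows "card A = card (f ` A) * card {x \<in> A. f x = 0}"
proof -
  \<comment> \<open>Translation by a preimage \<open>a\<close> of \<open>y\<close> carries the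
    kernel to the fibre over \<open>y\<close>.\<close>
  have "card {x \<in> A. f x = y} = card {x \<in> A. f x = 0}" if y: "y \<in> f ` A" for y
  proof -
    obtain a where a: "a \<in> A" "f a = y" using y by auto
    have "0 \<in> A" using diff[OF a(1) a(1)] by simp
    then have plus: "x + a \<in> A" if "x \<in> A" for x
      using diff[OF that diff[OF \<open>0 \<in> A\<close> a(1)]] by simp
    have fplus: "f (x + a) = f x + f a" if "x \<in> A" for x
      using add[OF plus[OF that] a(1)] by simp
    have "bij_betw (\<lambda>x. x + a) {x \<in> A. f x = 0} {x \<in> A. f x = y}"
    proof (rule bij_betw_byWitness[where f' = "\<lambda>x. x - a"])
      show "(\<lambda>x. x + a) ` {x \<in> A. f x = 0} \<subseteq> {x \<in> A. f x = y}"
        using plus fplus a by auto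
      show "(\<lambda>x. x - a) ` {x \<in> A. f x = y} \<subseteq> {x \<in> A. f x = 0}"
        using diff add a by auto
    qed auto
    then show ?thesis by (simp add: bij_betw_same_card)
  qed
  then have "(\<Sum>y\<in>f ` A. card {x \<in> A. f x = y}) = card (f ` A) * card {x \<in> A. f x = 0}"
    by simp
  moreover have "(\<Sum>y\<in>f ` A. card {x \<in> A. f x = y}) = card A"
    using sum.group[OF \<open>finite A\<close> _ order_refl, of f "\<lambda>_. 1::nat"] \<open>finite A\<close> by simp
  ultimately show ?thesis by simp
qed

section \<open>Dimensions of finite subspaces through their cardinalities\<close>

context vector_space begin

text \<open>Adjoining a basis vector multiplies the size by that of the field: an element of the new
  span is the same as a coefficient together with an element of the old span. Besides subspaces of
  representations this counts the extension field itself, as a space over the small field.\<close>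

lemma finite_card_span_independent:
  assumes fin: "finite (UNIV :: 'a set)" and "finite B" "independent B"
  shows "finite (span B) \<and> card (span B) = CARD('a) ^ card B"
  using assms(2,3)
proof (induction B rule: finite_induct)
  case (insert b B)
  then have b: "b \<notin> span B" and B: "independent B"
    by (auto simp: independent_insert)
  let ?f = "\<lambda>(k, x). k *s b + x"
  have inj: "inj_on ?f (UNIV \<times> span B)"
  proof (rule inj_onI, clarify)
    fix k x l y assume *: "x \<in> span B" "y \<in> span B" "k *s b + x = l *s b + y"
    have "(k - l) *s b = y - x" using *(3) by (simp add: algebra_simps)
    then have mem: "(k - l) *s b \<in> span B" using * span_diff by simp
    have "k = l"
    proof (rule ccontr)
      assume "k \<noteq> l"
      then have "b = inverse (k - l) *s ((k - l) *s b)" by simp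
      then show False using b span_scale[OF mem] by metis
    qed
    then show "k = l \<and> x = y" using *(3) by simp
  qed
  have "span (insert b B) = ?f ` (UNIV \<times> span B)"
  proof (intro equalityI subsetI)
    fix v assume "v \<in> span (insert b B)"
    then obtain k where "v - k *s b \<in> span B" by (auto simp: span_insert)
    then show "v \<in> ?f ` (UNIV \<times> span B)"
      by (intro image_eqI[of _ _ "(k, v - k *s b)"]) auto
  next
    fix v assume "v \<in> ?f ` (UNIV \<times> span B)"
    then obtain k x where "v = k *s b + x" "x \<in> span B" by auto
    then have "v - k *s b \<in> span B" by simp
    then show "v \<in> span (insert b B)" by (auto simp: span_insert)
  qed
  then show ?case
    using insert.IH[OF B] insert.hyps fin
    by (simp add: card_image[OF inj] card_cartesian_product)
qed simp

lemma finite_span: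
  assumes fin: "finite (UNIV :: 'a set)" and "finite S"
  shows "finite (span S)"
proof -
  obtain B where B: "B \<subseteq> S" "independent B" "S \<subseteq> span B"
    using maximal_independent_subset by blast
  then have "span S \<subseteq> span B" by (simp add: span_minimal)
  moreover have "finite (span B)"
    using finite_card_span_independent[OF fin] B assms(2) finite_subset by blast
  ultimately show ?thesis by (rule finite_subset)
qed

text \<open>As the field has at least two elements, dimension and cardinality determine each other.
  The rank formulas below are proved by counting and read off as exponents.\<close>

lemma card_subspace:
  assumes fin: "finite (UNIV :: 'a set)" and "finite V" "subspace V"
  shows "card V = CARD('a) ^ dim V"
proof -
  obtain B where B: "B \<subseteq> V" "independent B" "V \<subseteq> span B" "card B = dim V"
    using basis_exists by blast
  then have "span B = V" using assms(3) span_minimal by blast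
  then show ?thesis
    using finite_card_span_independent[OF fin _ B(2)] B assms(2) finite_subset by metis
qed

lemma CARD_ge_2: "finite (UNIV :: 'a set) \<Longrightarrow> CARD('a) \<ge> 2"
proof -
  assume "finite (UNIV :: 'a set)"
  then have "card {0::'a, 1} \<le> CARD('a)" by (rule card_mono) simp
  then show ?thesis by simp
qed

text \<open>The ambient space may be infinite-dimensional, and \<open>dim\<close> is 0 on
  infinite-dimensional subspaces; finiteness of \<open>W\<close> is what makes it monotone.\<close>

lemma dim_mono_finite:
  assumes fin: "finite (UNIV :: 'a set)" and "finite W" "subspace V" "subspace W" "V \<subseteq> W"
  shows "dim V \<le> dim W"
proof -
  have "CARD('a) ^ dim V \<le> CARD('a) ^ dim W"
    using assms card_subspace[OF fin] card_mono finite_subset by metis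
  then show ?thesis using CARD_ge_2[OF fin] by simp
qed

lemma subspace_eq_if_dim:
  assumes fin: "finite (UNIV :: 'a set)" and "finite W" "subspace V" "subspace W" "V \<subseteq> W" "dim W \<le> dim V"
  shows "V = W"
proof -
  have "dim V = dim W" using dim_mono_finite[OF assms(1-5)] assms(6) by simp
  then have "card V = card W"
    using assms card_subspace[OF fin] finite_subset by metis
  then show ?thesis using assms card_subset_eq by blast
qed

lemma dim_zero [simp]: "dim {0} = 0"
proof -
  have "dim {0} = card ({} :: 'b set)" by (rule dim_eq_card) (simp_all add: independent_empty)
  then show ?thesis by simp
qed

lemma dim_zero_iff:
  assumes fin: "finite (UNIV :: 'a set)" and "finite V" "subspace V"
  shows "dim V = 0 \<longleftrightarrow> V = {0}"
proof
  assume "dim V = 0"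
  then show "V = {0}" using subspace_eq_if_dim[OF assms(1,2) subspace_single_0 assms(3)] subspace_0[OF assms(3)] by auto
qed simp

lemma dim_image_kernel:
  assumes fin: "finite (UNIV :: 'a set)" and "finite V" "subspace V"
    and "Vector_Spaces.linear scale scale f"
  shows "dim V = dim (f ` V) + dim {x \<in> V. f x = 0}"
proof -
  interpret f: Vector_Spaces.linear scale scale f by fact
  have s: "subspace (f ` V)" "subspace {x \<in> V. f x = 0}"
    using f.subspace_image[OF assms(3)] subspace_inter[OF assms(3) f.subspace_kernel]
    by (auto simp: Collect_conj_eq)
  have "card V = card (f ` V) * card {x \<in> V. f x = 0}"
    by (rule card_additive_image[OF assms(2)]) (auto simp: f.diff subspace_diff[OF assms(3)])
  then have "CARD('a) ^ dim V = CARD('a) ^ (dim (f ` V) + dim {x \<in> V. f x = 0})"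
    using card_subspace[OF fin] s assms(2,3) by (simp add: power_add)
  then show ?thesis using CARD_ge_2[OF fin] by (simp add: power_inject_exp)
qed

lemma dim_inj_image:
  assumes fin: "finite (UNIV :: 'a set)" and "finite V" "subspace V"
    and "Vector_Spaces.linear scale scale f" "inj_on f V"
  shows "dim (f ` V) = dim V"
proof -
  interpret f: Vector_Spaces.linear scale scale f by fact
  have "{x \<in> V. f x = 0} = {0}"
    using assms(5) subspace_0[OF assms(3)] f.zero by (auto simp: inj_on_def)
  then have "dim {x \<in> V. f x = 0} = 0"
    by simp
  then show ?thesis using dim_image_kernel[OF assms(1-4)] by simp
qed

text \<open>Every vector of \<open>A\<close> outside \<open>H\<close> lies in exactly one such
  \<open>T\<close>, so the sets \<open>T - H\<close> partition \<open>A - H\<close>. All parts have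
  \<open>(Q - 1) * card S\<close> elements, while \<open>A - H\<close> has
  \<open>(Q - 1) * card H\<close>; the quotient is the power. This count is the source of all powers
  of \<open>CARD('a)\<close> in the flag recursion.\<close>

lemma card_hyperplane_complements:
  assumes fin: "finite (UNIV :: 'a set)" and A: "finite A" "subspace A" and H: "subspace H" "H \<subseteq> A"
    and dim: "dim A = Suc (dim H)" and S: "subspace S" "S \<subseteq> H"
  shows "card {T. subspace T \<and> T \<subseteq> A \<and> T \<inter> H = S \<and> T \<noteq> S} = CARD('a) ^ (dim H - dim S)"
    and "\<And>T. subspace T \<Longrightarrow> T \<subseteq> A \<Longrightarrow> T \<inter> H = S \<Longrightarrow> T \<noteq> S \<Longrightarrow> dim T = Suc (dim S)"
proof -
  define Q where "Q = CARD('a)"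
  have Q: "Q \<ge> 2" using CARD_ge_2[OF fin] by (simp add: Q_def)
  let ?C = "{T. subspace T \<and> T \<subseteq> A \<and> T \<inter> H = S \<and> T \<noteq> S}"
  have finH: "finite H" "finite S" using A H S finite_subset by metis+
  have cA: "card A = Q * card H"
    using card_subspace[OF fin] A H finH dim by (simp add: Q_def)
  have dimT: "dim T = Suc (dim S)" and exT: "\<exists>u\<in>T. u \<notin> H \<and> T = span (insert u S)"
    if T: "subspace T" "T \<subseteq> A" "T \<inter> H = S" "T \<noteq> S" for T
  proof -
    obtain u where u: "u \<in> T" "u \<notin> H" using T by blast
    have finT: "finite T" using A T finite_subset by metis
    \<comment> \<open>Dimension formula for \<open>T\<close> and \<open>H\<close>: the kernel of
      addition on \<open>T \<times> H\<close> is a copy of \<open>T \<inter> H = S\<close>.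
      \<open>card_additive_image\<close> asks only for closure under differences, so it applies to
      the product without a scalar action on it.\<close>
    have "card T * card H \<le> card A * card S"
    proof -
      let ?f = "\<lambda>(t, h). t + h"
      have k: "{x \<in> T \<times> H. ?f x = 0} = (\<lambda>s. (s, - s)) ` S"
      proof (intro equalityI subsetI)
        fix x assume x: "x \<in> {x \<in> T \<times> H. ?f x = 0}"
        obtain t h where th: "x = (t, h)" by force
        with x have "t = - h" "t \<in> T" "h \<in> H" by (auto simp: eq_neg_iff_add_eq_0)
        then have "t \<in> S" using T(3) subspace_neg[OF H(1)] by blast
        with \<open>t = - h\<close> th show "x \<in> (\<lambda>s. (s, - s)) ` S" by auto
      next
        fix x assume "x \<in> (\<lambda>s. (s, - s)) ` S"
        then show "x \<in> {x \<in> T \<times> H. ?f x = 0}"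
          using T(3) subspace_neg[OF S(1)] S(2) by auto
      qed
      have "card (T \<times> H) = card (?f ` (T \<times> H)) * card {x \<in> T \<times> H. ?f x = 0}"
        using finT finH subspace_diff[OF T(1)] subspace_diff[OF H(1)]
        by (intro card_additive_image) (auto simp: algebra_simps)
      also have "card {x \<in> T \<times> H. ?f x = 0} = card S"
        unfolding k by (rule card_image) (auto simp: inj_on_def)
      also have "card (?f ` (T \<times> H)) \<le> card A"
      proof (rule card_mono[OF A(1)], clarify)
        fix t h assume "t \<in> T" "h \<in> H"
        then show "t + h \<in> A" using T H subspace_add[OF A(2), of t h] by blast
      qed
      finally show ?thesis by (simp add: card_cartesian_product)
    qed
    then have "card T * card H \<le> Q * card S * card H" using cA by (simp add: mult_ac)
    moreover have "card H > 0" using finH subspace_0[OF H(1)] card_gt_0_iff by blast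
    ultimately have "card T \<le> Q * card S" by simp
    then have "Q ^ dim T \<le> Q ^ Suc (dim S)"
      using card_subspace[OF fin] finT T finH S by (simp add: Q_def)
    then have le: "dim T \<le> Suc (dim S)" by (rule power_le_imp_le_exp[rotated]) (use Q in simp)
    let ?S' = "span (insert u S)"
    have sub: "?S' \<subseteq> T" using u T by (intro span_minimal) auto
    then have fS': "finite ?S'" using finT finite_subset by metis
    have "S \<noteq> ?S'" using u span_base[of u "insert u S"] S by blast
    moreover have SS': "S \<subseteq> ?S'" by (meson insertCI span_base subsetI)
    ultimately have "\<not> dim ?S' \<le> dim S"
      using subspace_eq_if_dim[OF fin fS' S(1) subspace_span] by blast
    moreover have "dim ?S' \<le> dim T" using dim_mono_finite[OF fin finT subspace_span T(1) sub] .
    ultimately show "dim T = Suc (dim S)" using le by linarith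
    then have "T = ?S'" using subspace_eq_if_dim[OF fin finT subspace_span T(1) sub]
      using \<open>\<not> dim ?S' \<le> dim S\<close> by simp
    then show "\<exists>u\<in>T. u \<notin> H \<and> T = span (insert u S)" using u by blast
  qed
  then show "\<And>T. subspace T \<Longrightarrow> T \<subseteq> A \<Longrightarrow> T \<inter> H = S \<Longrightarrow> T \<noteq> S \<Longrightarrow> dim T = Suc (dim S)" by blast
  \<comment> \<open>The one space through a given \<open>u\<close> outside the hyperplane is
    \<open>span (insert u S)\<close>; existence and uniqueness are proved together.\<close>
  have spanC: "span (insert u S) \<in> ?C" and spanH: "T = span (insert u S)"
    if u: "u \<in> A" "u \<notin> H" and T: "T = span (insert u S) \<or> T \<in> ?C \<and> u \<in> T" for u T
  proof -
    have "x \<in> S" if x: "x \<in> span (insert u S)" "x \<in> H" for x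
    proof -
      obtain k where k: "x - k *s u \<in> span S" using x by (auto simp: span_insert)
      then have k': "x - k *s u \<in> S" using S(1) span_eq_iff by metis
      then have ku: "k *s u \<in> H"
        using subspace_diff[OF H(1) x(2), of "x - k *s u"] S by auto
      have "k = 0"
      proof (rule ccontr)
        assume "k \<noteq> 0"
        then have "u = inverse k *s (k *s u)" by simp
        then show False using u subspace_scale[OF H(1) ku] by metis
      qed
      then show ?thesis using k' by simp
    qed
    moreover have "S \<subseteq> span (insert u S)" by (meson insertCI span_base subsetI)
    moreover have "span (insert u S) \<subseteq> A" using u S H A by (intro span_minimal) auto
    moreover have "span (insert u S) \<noteq> S" using u S H span_base[of u "insert u S"] by blast
    ultimately show C: "span (insert u S) \<in> ?C" using S by auto
    show "T = span (insert u S)"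
    proof (rule disjE[OF T])
      assume T: "T \<in> ?C \<and> u \<in> T"
      then have "span (insert u S) \<subseteq> T" by (intro span_minimal) auto
      moreover have "finite T" using A T finite_subset by auto
      ultimately have "span (insert u S) = T"
        using T C dimT[of T] dimT[of "span (insert u S)"]
        by (intro subspace_eq_if_dim[OF fin]) auto
      then show ?thesis by simp
    qed
  qed
  let ?D = "(\<lambda>T. T - H) ` ?C"
  have inj: "inj_on (\<lambda>T. T - H) ?C"
  proof (rule inj_onI)
    fix T T' assume T: "T \<in> ?C" "T' \<in> ?C" "T - H = T' - H"
    have "T = (T - H) \<union> (T \<inter> H)" by blast
    also have "\<dots> = (T' - H) \<union> (T' \<inter> H)" using T by simp
    also have "\<dots> = T'" by blast
    finally show "T = T'" .
  qed
  have U: "\<Union>?D = A - H"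
  proof (intro equalityI subsetI)
    fix u assume u: "u \<in> A - H"
    then have "span (insert u S) \<in> ?C" "u \<in> span (insert u S)" using spanC span_base by auto
    then show "u \<in> \<Union>?D" using u by blast
  qed auto
  have finC: "finite ?C" by (rule finite_subset[of _ "Pow A"]) (use A in auto)
  \<comment> \<open>Removing \<open>H\<close> from \<open>T\<close> removes exactly
    \<open>S\<close>, and \<open>T\<close> is \<open>Q\<close> times as large as
    \<open>S\<close>.\<close>
  have cT: "card c = (Q - 1) * card S" if cin: "c \<in> ?D" for c
  proof -
    obtain T where T: "T \<in> ?C" "c = T - H" using cin by auto
    have "c = T - S" using T by auto
    moreover have "card (T - S) = card T - card S"
      using T finH by (intro card_Diff_subset) auto
    moreover have "card T = Q * card S"
    proof -
      have "finite T" using T A finite_subset by auto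
      then show ?thesis using T dimT[of T] card_subspace[OF fin, of T] card_subspace[OF fin, of S] finH S by (simp add: Q_def)
    qed
    ultimately show ?thesis by (simp add: diff_mult_distrib)
  qed
  have "(Q - 1) * card S * card ?D = card (\<Union>?D)"
  proof (rule card_partition)
    fix c d assume cd: "c \<in> ?D" "d \<in> ?D" "c \<noteq> d"
    obtain T T' where T: "T \<in> ?C" "c = T - H" "T' \<in> ?C" "d = T' - H" using cd by auto
    show "c \<inter> d = {}"
    proof (rule ccontr)
      assume "c \<inter> d \<noteq> {}"
      then obtain u where "u \<in> A" "u \<notin> H" "u \<in> T" "u \<in> T'" using T by auto
      then have "T = T'" using spanH[of u T] spanH[of u T'] T by simp
      then show False using cd T by simp
    qed
  qed (use finC A U cT in auto)
  also have "\<dots> = card A - card H"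
    unfolding U using finH H by (intro card_Diff_subset) auto
  also have "\<dots> = (Q - 1) * card H" by (simp add: cA diff_mult_distrib)
  finally have "card S * card ?C = card H"
    using Q by (simp add: card_image[OF inj] mult.assoc)
  moreover have "card H = card S * Q ^ (dim H - dim S)"
  proof -
    have "dim S \<le> dim H" using dim_mono_finite[OF fin finH(1) S(1) H(1) S(2)] .
    then show ?thesis using card_subspace[OF fin] finH S H
      by (simp add: Q_def flip: power_add)
  qed
  moreover have "card S > 0" using finH subspace_0[OF S(1)] card_gt_0_iff by blast
  ultimately show "card ?C = CARD('a) ^ (dim H - dim S)" by (simp add: Q_def)
qed

text \<open>Inside the kernel of the map from \<open>A \<times> B\<close> to the quotient by \<open>X\<close> there is the image of
  \<open>P \<times> KA \<times> KB\<close>.\<close>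

lemma dim_pushout_le:
  assumes fin: "finite (UNIV :: 'a set)"
    and "finite A" "finite B" "finite P" "finite X"
    and "subspace A" "subspace B" "subspace P" "subspace X"
    and KA: "subspace KA" "KA \<subseteq> A" and KB: "subspace KB" "KB \<subseteq> B"
    and lf: "Vector_Spaces.linear scale scale f" "Vector_Spaces.linear scale scale g"
    and l: "Vector_Spaces.linear scale scale \<alpha>" "Vector_Spaces.linear scale scale \<beta>"
    and fKA: "\<And>x. x \<in> KA \<Longrightarrow> f x \<in> X" and gKB: "\<And>x. x \<in> KB \<Longrightarrow> g x \<in> X"
    and PA: "\<And>p. p \<in> P \<Longrightarrow> \<alpha> p \<in> A" and PB: "\<And>p. p \<in> P \<Longrightarrow> \<beta> p \<in> B"
    and rel: "\<And>p. p \<in> P \<Longrightarrow> f (\<alpha> p) + g (\<beta> p) \<in> X"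
  defines "Z \<equiv> {f a + g b + w |a b w. a \<in> A \<and> b \<in> B \<and> w \<in> X}"
    and "KP \<equiv> {p \<in> P. \<alpha> p \<in> KA \<and> \<beta> p \<in> KB}"
  shows "subspace Z" "finite Z"
    and "dim Z + dim KA + dim KB + dim P \<le> dim KP + dim A + dim B + dim X"
proof -
  interpret f: Vector_Spaces.linear scale scale f by fact
  interpret g: Vector_Spaces.linear scale scale g by fact
  interpret \<alpha>: Vector_Spaces.linear scale scale \<alpha> by fact
  interpret \<beta>: Vector_Spaces.linear scale scale \<beta> by fact
  note sub = \<open>subspace A\<close> \<open>subspace B\<close> \<open>subspace P\<close> \<open>subspace X\<close>
  note fins = \<open>finite A\<close> \<open>finite B\<close> \<open>finite P\<close> \<open>finite X\<close>
  let ?h = "\<lambda>(a, b, w). f a + g b + w"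
  have Zim: "Z = ?h ` (A \<times> B \<times> X)" unfolding Z_def by force
  have "Z = {x + y |x y. x \<in> {x + y |x y. x \<in> f ` A \<and> y \<in> g ` B} \<and> y \<in> X}"
    unfolding Z_def by blast
  then show sZ: "subspace Z"
    using subspace_sums[OF subspace_sums[OF f.subspace_image[OF sub(1)] g.subspace_image[OF sub(2)]] sub(4)] by simp
  show finZ: "finite Z" unfolding Zim using fins by auto
  have finK: "finite KA" "finite KB" "finite KP" using fins KA KB finite_subset unfolding KP_def by auto
  have sKP: "subspace KP"
  proof -
    have "KP = P \<inter> {p. \<alpha> p \<in> KA} \<inter> {p. \<beta> p \<in> KB}" unfolding KP_def by auto
    then show ?thesis
      using subspace_inter[OF subspace_inter[OF sub(3) \<alpha>.subspace_linear_preimage[OF KA(1)]]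
          \<beta>.subspace_linear_preimage[OF KB(1)]] by simp
  qed
  \<comment> \<open>\<open>N\<close> is the kernel of the map from \<open>A \<times> B\<close> to
    the quotient by \<open>X\<close>. Its size is known exactly from the kernel of \<open>?h\<close>
    and bounded below by the image of \<open>?k\<close>; eliminating it gives the
    inequality.\<close>
  define N where "N = {(a, b) \<in> A \<times> B. f a + g b \<in> X}"
  have finN: "finite N" by (rule finite_subset[of _ "A \<times> B"]) (use fins in \<open>auto simp: N_def\<close>)
  have "card (A \<times> B \<times> X) = card (?h ` (A \<times> B \<times> X)) * card {x \<in> A \<times> B \<times> X. ?h x = 0}"
    using fins sub by (intro card_additive_image) (auto simp: subspace_diff f.diff g.diff algebra_simps)
  also have "{x \<in> A \<times> B \<times> X. ?h x = 0} = (\<lambda>(a, b). (a, b, - (f a + g b))) ` N"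
  proof (intro equalityI subsetI)
    fix x assume x: "x \<in> {x \<in> A \<times> B \<times> X. ?h x = 0}"
    obtain a b w where abw: "x = (a, b, w)" by (cases x) auto
    with x have "w = - (f a + g b)" by (simp only: eq_neg_iff_add_eq_0) (simp add: add.commute)
    moreover have "f a + g b \<in> X"
      using x abw subspace_neg[OF sub(4), of w] calculation by (metis (no_types, lifting) mem_Collect_eq mem_Sigma_iff minus_minus)
    then have "(a, b) \<in> N" using x abw unfolding N_def by simp
    ultimately show "x \<in> (\<lambda>(a, b). (a, b, - (f a + g b))) ` N" using abw by force
  next
    fix x assume "x \<in> (\<lambda>(a, b). (a, b, - (f a + g b))) ` N"
    then obtain a b where "(a, b) \<in> N" "x = (a, b, - (f a + g b))" by auto
    then show "x \<in> {x \<in> A \<times> B \<times> X. ?h x = 0}"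
      using subspace_neg[OF sub(4), of "f a + g b"] unfolding N_def by auto
  qed
  also have "card ((\<lambda>(a, b). (a, b, - (f a + g b))) ` N) = card N"
    by (rule card_image) (auto simp: inj_on_def)
  finally have 1: "card A * card B * card X = card Z * card N"
    by (simp add: Zim card_cartesian_product mult_ac)
  \<comment> \<open>The image of \<open>?k\<close> is the part of \<open>N\<close> that
    \<open>rel\<close>, \<open>fKA\<close> and \<open>gKB\<close> provide. An element of the kernel
    of \<open>?k\<close> is determined by its first component, which runs through
    \<open>KP\<close>.\<close>
  let ?k = "\<lambda>(p, k, k'). (\<alpha> p + k, \<beta> p + k')"
  have "card (P \<times> KA \<times> KB) = card (?k ` (P \<times> KA \<times> KB)) * card {x \<in> P \<times> KA \<times> KB. ?k x = 0}"
    using fins finK sub KA KB by (intro card_additive_image) (auto simp: subspace_diff \<alpha>.diff \<beta>.diff algebra_simps)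
  also have "{x \<in> P \<times> KA \<times> KB. ?k x = 0} = (\<lambda>p. (p, - \<alpha> p, - \<beta> p)) ` KP"
  proof (intro equalityI subsetI)
    fix x assume x: "x \<in> {x \<in> P \<times> KA \<times> KB. ?k x = 0}"
    obtain p k k' where pk: "x = (p, k, k')" by (cases x) auto
    with x have eq: "k = - \<alpha> p" "k' = - \<beta> p" by (simp_all add: eq_neg_iff_add_eq_0 add.commute zero_prod_def)
    then have "p \<in> KP" using x pk subspace_neg[OF KA(1), of k] subspace_neg[OF KB(1), of k'] by (auto simp: KP_def)
    then show "x \<in> (\<lambda>p. (p, - \<alpha> p, - \<beta> p)) ` KP" using eq pk by auto
  next
    fix x assume "x \<in> (\<lambda>p. (p, - \<alpha> p, - \<beta> p)) ` KP"
    then show "x \<in> {x \<in> P \<times> KA \<times> KB. ?k x = 0}"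
      using subspace_neg[OF KA(1)] subspace_neg[OF KB(1)] by (auto simp: KP_def zero_prod_def)
  qed
  also have "card ((\<lambda>p. (p, - \<alpha> p, - \<beta> p)) ` KP) = card KP"
    by (rule card_image) (auto simp: inj_on_def)
  also have "card (?k ` (P \<times> KA \<times> KB)) \<le> card N"
  proof (rule card_mono[OF finN], clarify)
    fix p k k' assume pk: "p \<in> P" "k \<in> KA" "k' \<in> KB"
    have "f (\<alpha> p) + g (\<beta> p) + f k + g k' \<in> X"
      using rel[OF pk(1)] fKA[OF pk(2)] gKB[OF pk(3)] subspace_add[OF sub(4)] by blast
    then have "f (\<alpha> p + k) + g (\<beta> p + k') \<in> X" by (simp add: f.add g.add algebra_simps)
    then show "(\<alpha> p + k, \<beta> p + k') \<in> N"
      using pk PA PB KA KB subspace_add[OF sub(1)] subspace_add[OF sub(2)] unfolding N_def by blast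
  qed
  finally have "card P * card KA * card KB \<le> card N * card KP"
    by (simp add: card_cartesian_product mult_ac)
  then have "card Z * (card P * card KA * card KB) \<le> card Z * (card N * card KP)"
    by (rule mult_left_mono) simp
  also have "\<dots> = card A * card B * card X * card KP" using 1 by (simp add: mult_ac)
  finally have "CARD('a) ^ (dim Z + dim KA + dim KB + dim P) \<le> CARD('a) ^ (dim KP + dim A + dim B + dim X)"
    using card_subspace[OF fin] fins finK sub KA KB sKP sZ finZ by (simp add: power_add mult_ac)
  then show "dim Z + dim KA + dim KB + dim P \<le> dim KP + dim A + dim B + dim X"
    using CARD_ge_2[OF fin] by simp
qed

end

section \<open>Split extensions and their duals\<close>

lemma sum_apply: "(\<Sum>i\<in>I. f i) x = (\<Sum>i\<in>I. f i x)" for f :: "'i \<Rightarrow> 'x \<Rightarrow> 'y::comm_monoid_add"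
  by (induction I rule: infinite_finite_induct) auto

context vector_space begin

context notes [[coercion_enabled = false]] begin

lemma vector_space_scalars: "vector_space ((*) :: 'a \<Rightarrow> 'a \<Rightarrow> 'a)"
  by unfold_locales (auto simp: algebra_simps)

text \<open>The action of an arrow is linear only on the space at its tail. Replacing it by a map
  that is linear everywhere and agrees with it there makes composition, images and preimages of
  linear maps available.\<close>

lemma linear_extend_from_subspace:
  assumes U: "subspace U"
    and add: "\<And>x y. x \<in> U \<Longrightarrow> y \<in> U \<Longrightarrow> f (x + y) = f x + f y"
    and scl: "\<And>c x. x \<in> U \<Longrightarrow> f (c *s x) = c *s f x"
  obtains g where "Vector_Spaces.linear scale scale g" "\<And>x. x \<in> U \<Longrightarrow> g x = f x"
proof -
  interpret p: vector_space_pair scale scale by unfold_locales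
  obtain B where B: "B \<subseteq> U" "independent B" "U \<subseteq> span B"
    using maximal_independent_subset by blast
  obtain g where g: "Vector_Spaces.linear scale scale g" "\<And>x. x \<in> B \<Longrightarrow> g x = f x"
    using p.linear_independent_extend[OF B(2)] by blast
  interpret g: Vector_Spaces.linear scale scale g by fact
  have f0: "f 0 = 0" using scl[OF subspace_0[OF U], of 0] by simp
  have "x \<in> U \<and> g x = f x" if "x \<in> span B" for x
    using that
  proof (induction rule: span_induct_alt)
    case base
    then show ?case using subspace_0[OF U] f0 by simp
  next
    case (step c b x)
    then show ?case
      using B(1) U subspace_add subspace_scale by (auto simp: g.add g.scale add scl g(2))
  qed
  then show ?thesis using that[OF g(1)] B(3) by blast
qed

lemma exists_separating_functional:
  assumes S: "subspace S" and v: "v \<notin> S"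
  obtains L where "Vector_Spaces.linear scale (*) L" "\<And>x. x \<in> S \<Longrightarrow> L x = 0" "L v = 1"
proof -
  interpret s: vector_space "(*) :: 'a \<Rightarrow> 'a \<Rightarrow> 'a" by (rule vector_space_scalars)
  interpret p: vector_space_pair scale "(*) :: 'a \<Rightarrow> 'a \<Rightarrow> 'a" by unfold_locales
  obtain B where B: "B \<subseteq> S" "independent B" "S \<subseteq> span B"
    using maximal_independent_subset by blast
  have "v \<notin> span B" using v span_minimal[OF B(1) S] by blast
  then have "independent (insert v B)" "v \<notin> B"
    using B(2) span_base by (auto simp: independent_insert)
  then obtain L where L: "Vector_Spaces.linear scale (*) L"
      "\<And>x. x \<in> insert v B \<Longrightarrow> L x = (if x = v then 1 else 0)"
    using p.linear_independent_extend[of "insert v B" "\<lambda>x. if x = v then 1 else 0"] by blast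
  interpret L: Vector_Spaces.linear scale "(*)" L by fact
  have LB: "L y = 0" if "y \<in> B" for y using L(2)[of y] that \<open>v \<notin> B\<close> by auto
  have "L x = 0" if "x \<in> span B" for x
    using L.eq_0_on_span[OF LB that] by blast
  then show ?thesis using that[OF L(1)] L(2) B(3) by auto
qed

text \<open>\<open>B\<close> consists of representatives for a basis of the quotient
  \<open>M / X\<close>, and \<open>\<phi>\<close> of its coordinate functionals, extended to vanish
  on \<open>X\<close>. Subtracting from \<open>v\<close> its coordinate part is then a projection to
  \<open>X\<close>. Quotient spaces themselves are avoided in this way.\<close>

definition relative_basis :: "'b set \<Rightarrow> 'b set \<Rightarrow> 'b set \<Rightarrow> ('b \<Rightarrow> 'b \<Rightarrow> 'a) \<Rightarrow> bool" where
  "relative_basis X M B \<phi> \<longleftrightarrow> finite B \<and> B \<subseteq> M \<and> (\<forall>b\<in>B. Vector_Spaces.linear scale (*) (\<phi> b)) \<and>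
    (\<forall>b\<in>B. \<forall>x\<in>X. \<phi> b x = 0) \<and> (\<forall>b\<in>B. \<forall>b'\<in>B. \<phi> b b' = (if b = b' then 1 else 0)) \<and>
    (\<forall>v\<in>M. v - (\<Sum>b\<in>B. \<phi> b v *s b) \<in> X)"

text \<open>A basis of \<open>X\<close> is extended to one of \<open>M\<close>; the added vectors
  form \<open>B\<close>, and \<open>\<phi>\<close> is the corresponding part of the dual
  basis.\<close>

lemma exists_relative_basis:
  assumes X: "subspace X" "X \<subseteq> M" and M: "subspace M" "finite M"
  shows "\<exists>B \<phi>. relative_basis X M B \<phi>"
proof -
  interpret s: vector_space "(*) :: 'a \<Rightarrow> 'a \<Rightarrow> 'a" by (rule vector_space_scalars)
  interpret p: vector_space_pair scale "(*) :: 'a \<Rightarrow> 'a \<Rightarrow> 'a" by unfold_locales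
  obtain BX where BX: "BX \<subseteq> X" "independent BX" "X \<subseteq> span BX"
    using maximal_independent_subset by blast
  obtain BM where BM: "BX \<subseteq> BM" "BM \<subseteq> M" "independent BM" "M \<subseteq> span BM"
    using maximal_independent_subset_extend[of BX M] BX X by blast
  define B where "B = BM - BX"
  have "\<forall>b. \<exists>f. Vector_Spaces.linear scale (*) f \<and> (\<forall>x\<in>BM. f x = (if b = x then 1 else 0))"
    by (intro allI p.linear_independent_extend BM(3))
  then obtain \<phi> where \<phi>: "\<And>b. Vector_Spaces.linear scale (*) (\<phi> b)"
      "\<And>b x. x \<in> BM \<Longrightarrow> \<phi> b x = (if b = x then 1 else 0)"
    by metis
  have finB: "finite B" using M(2) BM finite_subset unfolding B_def by blast
  have \<phi>0: "\<phi> b x = 0" if b: "b \<in> B" and x: "x \<in> X" for b x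
  proof -
    interpret f: Vector_Spaces.linear scale "(*)" "\<phi> b" by (rule \<phi>)
    have "\<phi> b y = 0" if "y \<in> BX" for y using \<phi>(2)[of y b] BM that b unfolding B_def by auto
    then show ?thesis using f.eq_0_on_span[of BX x] x BX by blast
  qed
  have proj: "v - (\<Sum>b\<in>B. \<phi> b v *s b) \<in> X" if v: "v \<in> span BM" for v
    using v
  proof (induction rule: span_induct_alt)
    case base
    have "\<phi> b 0 = 0" for b
    proof -
      interpret f: Vector_Spaces.linear scale "(*)" "\<phi> b" by (rule \<phi>)
      show ?thesis by (rule f.zero)
    qed
    then show ?case using subspace_0[OF X(1)] by simp
  next
    case (step c b0 x)
    have lin: "\<phi> b (c *s b0 + x) = c * \<phi> b b0 + \<phi> b x" for b
    proof -
      interpret f: Vector_Spaces.linear scale "(*)" "\<phi> b" by (rule \<phi>)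
      show ?thesis by (simp add: f.add f.scale)
    qed
    have "b0 - (\<Sum>b\<in>B. \<phi> b b0 *s b) \<in> X"
    proof (cases "b0 \<in> BX")
      case True
      then have "b0 \<in> X" using BX by blast
      moreover have "(\<Sum>b\<in>B. \<phi> b b0 *s b) = 0"
        using \<phi>0 \<open>b0 \<in> X\<close> by (intro sum.neutral) auto
      ultimately show ?thesis by simp
    next
      case False
      have "(\<Sum>b\<in>B. \<phi> b b0 *s b) = (\<Sum>b\<in>B. if b = b0 then b0 else 0)"
        using \<phi>(2)[OF step(1)] by (intro sum.cong) auto
      also have "\<dots> = b0" using False step(1) finB by (simp add: B_def)
      finally show ?thesis using subspace_0[OF X(1)] by simp
    qed
    then have "c *s (b0 - (\<Sum>b\<in>B. \<phi> b b0 *s b)) + (x - (\<Sum>b\<in>B. \<phi> b x *s b)) \<in> X"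
      using step.IH X subspace_add subspace_scale by blast
    moreover have "c *s (b0 - (\<Sum>b\<in>B. \<phi> b b0 *s b)) + (x - (\<Sum>b\<in>B. \<phi> b x *s b)) =
        c *s b0 + x - (\<Sum>b\<in>B. \<phi> b (c *s b0 + x) *s b)"
      unfolding lin by (simp add: scale_left_distrib sum.distrib algebra_simps scale_sum_right)
    ultimately show ?case by simp
  qed
  have "B \<subseteq> M" using BM unfolding B_def by blast
  moreover have "\<forall>b\<in>B. Vector_Spaces.linear scale (*) (\<phi> b)" "\<forall>b\<in>B. \<forall>x\<in>X. \<phi> b x = 0"
    using \<phi>(1) \<phi>0 by blast+
  moreover have "\<forall>b\<in>B. \<forall>b'\<in>B. \<phi> b b' = (if b = b' then 1 else 0)"
    using \<phi>(2) unfolding B_def by blast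
  moreover have "\<forall>v\<in>M. v - (\<Sum>b\<in>B. \<phi> b v *s b) \<in> X" using proj BM(4) by blast
  ultimately have "relative_basis X M B \<phi>" unfolding relative_basis_def by (intro conjI finB)
  then show ?thesis by (intro exI[of _ B] exI[of _ \<phi>])
qed

text \<open>Splitting off the subrepresentation \<open>X\<close> of \<open>M\<close> is a linear system. If it is not solvable,
  a functional separating its right hand side from its image yields the maps \<open>\<psi>\<close>, which are a
  nonzero element of the dual of the extension group of \<open>M / X\<close> by \<open>X\<close>.\<close>

lemma complement_or_dual_cocycle:
  fixes A :: "'c set" and I :: "'i set" and hd tl :: "'c \<Rightarrow> 'i"
    and M X :: "'i \<Rightarrow> 'b set" and m :: "'c \<Rightarrow> 'b \<Rightarrow> 'b"
  assumes finA: "finite A" and ht: "\<And>a. a \<in> A \<Longrightarrow> hd a \<in> I \<and> tl a \<in> I"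
    and M: "\<And>i. i \<in> I \<Longrightarrow> subspace (M i) \<and> finite (M i)"
    and X: "\<And>i. i \<in> I \<Longrightarrow> subspace (X i) \<and> X i \<subseteq> M i"
    and m: "\<And>a. a \<in> A \<Longrightarrow> Vector_Spaces.linear scale scale (m a)"
    and mM: "\<And>a v. a \<in> A \<Longrightarrow> v \<in> M (tl a) \<Longrightarrow> m a v \<in> M (hd a)"
    and mX: "\<And>a v. a \<in> A \<Longrightarrow> v \<in> X (tl a) \<Longrightarrow> m a v \<in> X (hd a)"
  obtains (complement) C where
      "\<And>i. i \<in> I \<Longrightarrow> subspace (C i) \<and> C i \<subseteq> M i \<and> C i \<inter> X i = {0}"
      "\<And>i v. i \<in> I \<Longrightarrow> v \<in> M i \<Longrightarrow> \<exists>x\<in>X i. v - x \<in> C i"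
      "\<And>a v. a \<in> A \<Longrightarrow> v \<in> C (tl a) \<Longrightarrow> m a v \<in> C (hd a)"
    | (dual) \<psi> a\<^sub>0 x\<^sub>0 where
      "\<And>a. a \<in> A \<Longrightarrow> Vector_Spaces.linear scale scale (\<psi> a)"
      "\<And>a x. a \<in> A \<Longrightarrow> \<psi> a x \<in> M (tl a)"
      "\<And>i x. i \<in> I \<Longrightarrow> x \<in> X i \<Longrightarrow>
        (\<Sum>a\<in>{a \<in> A. hd a = i}. m a (\<psi> a x)) - (\<Sum>a\<in>{a \<in> A. tl a = i}. \<psi> a (m a x)) \<in> X i"
      "a\<^sub>0 \<in> A" "x\<^sub>0 \<in> X (hd a\<^sub>0)" "\<psi> a\<^sub>0 x\<^sub>0 \<notin> X (tl a\<^sub>0)"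
proof -
  have "\<forall>i\<in>I. \<exists>B \<phi>. relative_basis (X i) (M i) B \<phi>"
    using X M by (intro ballI exists_relative_basis) auto
  then obtain B \<phi> where *: "\<And>i. i \<in> I \<Longrightarrow> relative_basis (X i) (M i) (B i) (\<phi> i)"
    by metis
  have finB: "finite (B i)" and BM: "B i \<subseteq> M i" if "i \<in> I" for i using *[OF that] by (auto simp: relative_basis_def)
  have \<phi>: "Vector_Spaces.linear scale (*) (\<phi> i b)" and \<phi>X: "\<And>x. x \<in> X i \<Longrightarrow> \<phi> i b x = 0"
    and \<phi>B: "\<And>b'. b' \<in> B i \<Longrightarrow> \<phi> i b b' = (if b = b' then 1 else 0)" if "i \<in> I" "b \<in> B i" for i b
    using *[OF that(1)] that(2) by (auto simp: relative_basis_def)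
  have proj: "v - (\<Sum>b\<in>B i. \<phi> i b v *s b) \<in> X i" if "i \<in> I" "v \<in> M i" for i v
    using *[OF that(1)] that(2) by (auto simp: relative_basis_def)
  define hs where "hs = (\<lambda>(c::'a) (h :: 'c \<times> 'b \<Rightarrow> 'b) z. c *s h z)"
  interpret H: vector_space hs
    by unfold_locales (auto simp: hs_def fun_eq_iff algebra_simps)
  interpret s: vector_space "(*) :: 'a \<Rightarrow> 'a \<Rightarrow> 'a" by (rule vector_space_scalars)
  interpret sp: vector_space_pair scale "(*) :: 'a \<Rightarrow> 'a \<Rightarrow> 'a" by unfold_locales
  interpret p: vector_space_pair scale scale by unfold_locales
  \<comment> \<open>\<open>\<Sigma>\<close> is the set of vertexwise maps from \<open>M / X\<close>
    to \<open>X\<close>, and \<open>d\<close> records, on the basis of the quotient, how far such a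
    family is from commuting with the arrows. For the vertexwise projection \<open>\<rho>\<close>
    from \<open>M\<close> to \<open>X\<close>, \<open>d \<rho>\<close> is the cocycle of the
    extension; it splits if this is a coboundary, that is, the value of \<open>d\<close> at some
    element of \<open>\<Sigma>\<close>.\<close>
  define d where "d \<sigma> = (\<lambda>(a, b). if a \<in> A \<and> b \<in> B (tl a) then \<sigma> (hd a) (m a b) - m a (\<sigma> (tl a) b) else 0)"
    for \<sigma> :: "'i \<Rightarrow> 'b \<Rightarrow> 'b"
  define \<Sigma> where "\<Sigma> = {\<sigma>. \<forall>i\<in>I. Vector_Spaces.linear scale scale (\<sigma> i) \<and> (\<forall>v\<in>M i. \<sigma> i v \<in> X i) \<and> (\<forall>v\<in>X i. \<sigma> i v = 0)}"
  define \<rho> where "\<rho> i v = v - (\<Sum>b\<in>B i. \<phi> i b v *s b)" for i v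
  have lin\<rho>: "Vector_Spaces.linear scale scale (\<rho> i)" if i: "i \<in> I" for i
  proof -
    have "\<phi> i b (x + y) = \<phi> i b x + \<phi> i b y" "\<phi> i b (c *s x) = c * \<phi> i b x" if "b \<in> B i" for b x y c
      using \<phi>[OF i that] by (auto simp: Vector_Spaces.linear_iff)
    then show ?thesis
      by (auto simp: Vector_Spaces.linear_iff \<rho>_def vector_space_axioms scale_left_distrib sum.distrib scale_sum_right algebra_simps cong: sum.cong)
  qed
  have \<rho>X: "\<rho> i v \<in> X i" if "i \<in> I" "v \<in> M i" for i v using proj[OF that] by (simp add: \<rho>_def)
  have \<rho>id: "\<rho> i v = v" if "i \<in> I" "v \<in> X i" for i v
    unfolding \<rho>_def using \<phi>X[OF that(1) _ that(2)] by simp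
  show ?thesis
  proof (cases "d \<rho> \<in> d ` \<Sigma>")
    case True
    then obtain \<sigma> where \<sigma>: "\<sigma> \<in> \<Sigma>" "d \<rho> = d \<sigma>" by auto
    \<comment> \<open>The correction by \<open>\<sigma>\<close> turns the projection
      \<open>\<rho>\<close> into one that commutes with the arrows, and its kernel is the
      complement.\<close>
    define r where "r i v = \<rho> i v - \<sigma> i v" for i v
    have linr: "Vector_Spaces.linear scale scale (r i)" if "i \<in> I" for i
      unfolding r_def using lin\<rho>[OF that] \<sigma>(1) that by (intro p.linear_compose_sub) (auto simp: \<Sigma>_def)
    have rX: "r i v \<in> X i" if "i \<in> I" "v \<in> M i" for i v
      unfolding r_def using \<rho>X[OF that] \<sigma>(1) that X[OF that(1)] subspace_diff by (auto simp: \<Sigma>_def)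
    have rid: "r i v = v" if "i \<in> I" "v \<in> X i" for i v
      unfolding r_def using \<rho>id[OF that] \<sigma>(1) that by (auto simp: \<Sigma>_def)
    have rB: "r (hd a) (m a b) = m a (r (tl a) b)" if "a \<in> A" "b \<in> B (tl a)" for a b
    proof -
      interpret ma: Vector_Spaces.linear scale scale "m a" using m that by blast
      show ?thesis using fun_cong[OF \<sigma>(2), of "(a, b)"] that
        by (simp add: d_def r_def ma.diff algebra_simps)
    qed
    have comm: "r (hd a) (m a v) = m a (r (tl a) v)" if a: "a \<in> A" and v: "v \<in> M (tl a)" for a v
    proof -
      interpret ma: Vector_Spaces.linear scale scale "m a" using m a by blast
      interpret rt: Vector_Spaces.linear scale scale "r (tl a)" using linr ht[OF a] by blast
      interpret rh: Vector_Spaces.linear scale scale "r (hd a)" using linr ht[OF a] by blast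
      let ?x = "\<rho> (tl a) v" and ?w = "\<Sum>b\<in>B (tl a). \<phi> (tl a) b v *s b"
      have x: "?x \<in> X (tl a)" using \<rho>X ht[OF a] v by blast
      have v': "v = ?x + ?w" by (simp add: \<rho>_def)
      have "r (hd a) (m a ?x) = m a (r (tl a) ?x)"
        using rid ht[OF a] x mX[OF a x] by simp
      moreover have "r (hd a) (m a ?w) = m a (r (tl a) ?w)"
        using rB[OF a] by (simp add: ma.sum rt.sum rh.sum ma.scale rt.scale rh.scale)
      ultimately show ?thesis by (subst (1 2) v') (simp add: ma.add rt.add rh.add)
    qed
    define C where "C i = {v \<in> M i. r i v = 0}" for i
    show ?thesis
    proof (rule complement[of C]; unfold C_def)
      fix i assume i: "i \<in> I"
      interpret ri: Vector_Spaces.linear scale scale "r i" using linr i by blast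
      have "subspace {v \<in> M i. r i v = 0}"
        using subspace_inter[OF _ ri.subspace_kernel, of "M i"] M[OF i] by (simp add: Collect_conj_eq)
      moreover have "{v \<in> M i. r i v = 0} \<inter> X i = {0}"
        using rid[OF i] subspace_0[of "X i"] subspace_0[of "M i"] X[OF i] M[OF i] by (auto simp: ri.zero)
      ultimately show "subspace {v \<in> M i. r i v = 0} \<and> {v \<in> M i. r i v = 0} \<subseteq> M i \<and> {v \<in> M i. r i v = 0} \<inter> X i = {0}"
        by blast
      fix v assume v: "v \<in> M i"
      have "r i (v - r i v) = 0" using rid[OF i rX[OF i v]] by (simp add: ri.diff)
      moreover have "v - r i v \<in> M i"
        using rX[OF i v] X[OF i] M[OF i] v subspace_diff by blast
      ultimately show "\<exists>x\<in>X i. v - x \<in> {v \<in> M i. r i v = 0}" using rX[OF i v] by auto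
    next
      fix a v assume a: "a \<in> A" and v: "v \<in> {v \<in> M (tl a). r (tl a) v = 0}"
      interpret ma: Vector_Spaces.linear scale scale "m a" using m a by blast
      show "m a v \<in> {v \<in> M (hd a). r (hd a) v = 0}"
        using v mM[OF a] comm[OF a] by (simp add: ma.zero)
    qed
  next
    case False
    have d_lin: "d (\<lambda>i v. c *s \<sigma> i v + \<tau> i v) = hs c (d \<sigma>) + d \<tau>" for c \<sigma> \<tau>
    proof
      fix z :: "'c \<times> 'b"
      obtain a b where z: "z = (a, b)" by force
      show "d (\<lambda>i v. c *s \<sigma> i v + \<tau> i v) z = (hs c (d \<sigma>) + d \<tau>) z"
      proof (cases "a \<in> A")
        case True
        interpret ma: Vector_Spaces.linear scale scale "m a" using m True by blast
        show ?thesis by (simp add: z d_def hs_def ma.add ma.scale algebra_simps)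
      qed (simp add: z d_def hs_def)
    qed
    have \<Sigma>_lin: "(\<lambda>i v. c *s \<sigma> i v + \<tau> i v) \<in> \<Sigma>" if "\<sigma> \<in> \<Sigma>" "\<tau> \<in> \<Sigma>" for c \<sigma> \<tau>
      unfolding \<Sigma>_def
    proof (intro CollectI ballI conjI)
      fix i assume i: "i \<in> I"
      show "Vector_Spaces.linear scale scale (\<lambda>v. c *s \<sigma> i v + \<tau> i v)"
        using that i by (intro p.linear_compose_add p.linear_compose_scale_right) (auto simp: \<Sigma>_def)
      show "c *s \<sigma> i v + \<tau> i v \<in> X i" if "v \<in> M i" for v
        using \<open>\<sigma> \<in> \<Sigma>\<close> \<open>\<tau> \<in> \<Sigma>\<close> i that X[OF i] subspace_add subspace_scale by (auto simp: \<Sigma>_def)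
      show "c *s \<sigma> i v + \<tau> i v = 0" if "v \<in> X i" for v
        using \<open>\<sigma> \<in> \<Sigma>\<close> \<open>\<tau> \<in> \<Sigma>\<close> i that by (auto simp: \<Sigma>_def)
    qed
    have zero\<Sigma>: "(\<lambda>i v. 0) \<in> \<Sigma>"
      using X subspace_0 by (auto simp: \<Sigma>_def Vector_Spaces.linear_iff vector_space_axioms)
    have "d (\<lambda>i v. 0) = 0"
    proof
      fix z :: "'c \<times> 'b"
      show "d (\<lambda>i v. 0) z = 0 z"
      proof (cases "fst z \<in> A")
        case True
        interpret ma: Vector_Spaces.linear scale scale "m (fst z)" using m True by blast
        show ?thesis by (cases z) (use ma.zero in \<open>auto simp: d_def\<close>)
      qed (auto simp: d_def split: prod.split)
    qed
    have "H.subspace (d ` \<Sigma>)"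
    proof (rule H.subspaceI)
      show "0 \<in> d ` \<Sigma>" using zero\<Sigma> \<open>d (\<lambda>i v. 0) = 0\<close> by force
      show "x + y \<in> d ` \<Sigma>" if xy: "x \<in> d ` \<Sigma>" "y \<in> d ` \<Sigma>" for x y
      proof -
        obtain \<sigma> \<tau> where st: "\<sigma> \<in> \<Sigma>" "x = d \<sigma>" "\<tau> \<in> \<Sigma>" "y = d \<tau>" using xy by auto
        then have "x + y = d (\<lambda>i v. 1 *s \<sigma> i v + \<tau> i v)" unfolding d_lin by (simp add: H.scale_one)
        then show ?thesis using \<Sigma>_lin[OF st(1,3), of 1] by blast
      qed
      show "hs c x \<in> d ` \<Sigma>" if x: "x \<in> d ` \<Sigma>" for x c
      proof -
        obtain \<sigma> where st: "\<sigma> \<in> \<Sigma>" "x = d \<sigma>" using x by auto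
        then have "hs c x = d (\<lambda>i v. c *s \<sigma> i v + 0)"
          using d_lin[of c \<sigma> "\<lambda>i v. 0"] \<open>d (\<lambda>i v. 0) = 0\<close> by simp
        then show ?thesis using \<Sigma>_lin[OF st(1) zero\<Sigma>, of c] by blast
      qed
    qed
    \<comment> \<open>\<open>L\<close> is an element of the dual of the extension group: it kills
      the coboundaries but not the class of \<open>M\<close>.\<close>
    then obtain L where L: "Vector_Spaces.linear hs (*) L" "\<And>x. x \<in> d ` \<Sigma> \<Longrightarrow> L x = 0" "L (d \<rho>) = 1"
      using H.exists_separating_functional False by blast
    interpret L: Vector_Spaces.linear hs "(*)" L by (rule L)
    \<comment> \<open>The elementary cochains. The values of \<open>L\<close> on them are the
      coordinates of maps \<open>\<psi> a\<close> from \<open>X (hd a)\<close> to the quotient at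
      \<open>tl a\<close>; this is the trace pairing between cochains and maps in the opposite
      direction.\<close>
    define u where "u a b x = (\<lambda>z. if z = (a, b) then x else 0 :: 'b)" for a :: 'c and b x :: 'b
    have u_lin: "u a b (x + y) = u a b x + u a b y" "u a b (c *s x) = hs c (u a b x)" for a b x y c
      by (auto simp: u_def hs_def fun_eq_iff)
    have L_lin: "L (u a b (x + y)) = L (u a b x) + L (u a b y)" "L (u a b (c *s x)) = c * L (u a b x)" for a b x y c
      by (simp_all add: u_lin L.add L.scale)
    define \<psi> where "\<psi> a x = (\<Sum>b\<in>B (tl a). L (u a b x) *s b)" for a x
    have lin\<psi>: "Vector_Spaces.linear scale scale (\<psi> a)" for a
      by (auto simp: Vector_Spaces.linear_iff vector_space_axioms \<psi>_def L_lin scale_left_distrib sum.distrib scale_sum_right)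
    have \<psi>M: "\<psi> a x \<in> M (tl a)" if "a \<in> A" for a x
      unfolding \<psi>_def using ht[OF that] M BM by (intro subspace_sum subspace_scale) auto
    have rel: "(\<Sum>a\<in>{a \<in> A. hd a = i}. m a (\<psi> a x)) - (\<Sum>a\<in>{a \<in> A. tl a = i}. \<psi> a (m a x)) \<in> X i"
      if i: "i \<in> I" and x: "x \<in> X i" for i x
    proof -
      let ?w = "(\<Sum>a\<in>{a \<in> A. hd a = i}. m a (\<psi> a x)) - (\<Sum>a\<in>{a \<in> A. tl a = i}. \<psi> a (m a x))"
      have wM: "?w \<in> M i"
        using M[OF i] mM \<psi>M by (intro subspace_diff subspace_sum) auto
      have "\<phi> i b ?w = 0" if b: "b \<in> B i" for b
      proof -
        interpret f: Vector_Spaces.linear scale "(*)" "\<phi> i b" using \<phi> i b by blast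
        \<comment> \<open>Test family of rank one, concentrated at the vertex \<open>i\<close>. That
          \<open>L\<close> vanishes on its coboundary is the relation for \<open>\<psi>\<close> in
          the coordinate \<open>b\<close>.\<close>
        define \<sigma> where "\<sigma> = (\<lambda>i' v. if i' = i then \<phi> i b v *s x else 0)"
        have "\<sigma> \<in> \<Sigma>" unfolding \<Sigma>_def
        proof (intro CollectI ballI conjI)
          fix i' assume i': "i' \<in> I"
          show "Vector_Spaces.linear scale scale (\<sigma> i')"
            by (auto simp: \<sigma>_def Vector_Spaces.linear_iff vector_space_axioms f.add f.scale scale_left_distrib)
          show "\<sigma> i' v \<in> X i'" if "v \<in> M i'" for v
            using x X[OF i'] subspace_scale subspace_0 by (auto simp: \<sigma>_def)
          show "\<sigma> i' v = 0" if "v \<in> X i'" for v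
            using that \<phi>X[OF i b] by (auto simp: \<sigma>_def)
        qed
        have "d \<sigma> = (\<Sum>a\<in>{a \<in> A. hd a = i}. \<Sum>b'\<in>B (tl a). u a b' (\<phi> i b (m a b') *s x))
            - (\<Sum>a\<in>{a \<in> A. tl a = i}. u a b (m a x))" (is "_ = ?R1 - ?R2")
        proof
          fix z :: "'c \<times> 'b"
          obtain a b' where z: "z = (a, b')" by force
          have "?R1 z = (\<Sum>a'\<in>{a \<in> A. hd a = i}. \<Sum>b''\<in>B (tl a'). if a' = a \<and> b'' = b' then \<phi> i b (m a b') *s x else 0)"
            by (auto simp: sum_apply u_def z intro!: sum.cong)
          also have "\<dots> = (\<Sum>a'\<in>{a \<in> A. hd a = i}. if a' = a then (if b' \<in> B (tl a) then \<phi> i b (m a b') *s x else 0) else 0)"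
            using finB ht by (intro sum.cong) auto
          also have "\<dots> = (if a \<in> A \<and> hd a = i \<and> b' \<in> B (tl a) then \<phi> i b (m a b') *s x else 0)"
            using finA by (simp add: sum.delta)
          finally have 1: "?R1 z = (if a \<in> A \<and> hd a = i \<and> b' \<in> B (tl a) then \<phi> i b (m a b') *s x else 0)" .
          have "?R2 z = (\<Sum>a'\<in>{a \<in> A. tl a = i}. if a' = a then (if b' = b then m a x else 0) else 0)"
            by (auto simp: sum_apply u_def z intro!: sum.cong)
          also have "\<dots> = (if a \<in> A \<and> tl a = i \<and> b' = b then m a x else 0)"
            using finA by (simp add: sum.delta)
          finally have 2: "?R2 z = (if a \<in> A \<and> tl a = i \<and> b' = b then m a x else 0)" .
          have "d \<sigma> z = ?R1 z - ?R2 z"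
          proof (cases "a \<in> A \<and> b' \<in> B (tl a)")
            case True
            interpret ma: Vector_Spaces.linear scale scale "m a" using m True by blast
            show ?thesis unfolding 1 2 using True \<phi>B[OF i b, of b']
              by (auto simp: d_def z \<sigma>_def ma.scale ma.zero)
          next
            case False
            then show ?thesis unfolding 1 2 using b by (auto simp: d_def z)
          qed
          then show "d \<sigma> z = (?R1 - ?R2) z" by simp
        qed
        moreover have "L (d \<sigma>) = 0" using L(2) \<open>\<sigma> \<in> \<Sigma>\<close> by blast
        ultimately have "(\<Sum>a\<in>{a \<in> A. hd a = i}. \<Sum>b'\<in>B (tl a). \<phi> i b (m a b') * L (u a b' x))
            - (\<Sum>a\<in>{a \<in> A. tl a = i}. L (u a b (m a x))) = 0"
          by (simp add: L.diff L.sum L_lin)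
        moreover have "\<phi> i b (m a (\<psi> a x)) = (\<Sum>b'\<in>B (tl a). \<phi> i b (m a b') * L (u a b' x))" if "a \<in> A" for a
        proof -
          interpret ma: Vector_Spaces.linear scale scale "m a" using m that by blast
          show ?thesis by (simp add: \<psi>_def ma.sum ma.scale f.sum f.scale mult.commute)
        qed
        moreover have "\<phi> i b (\<psi> a (m a x)) = L (u a b (m a x))" if "a \<in> A" "tl a = i" for a
        proof -
          have "\<phi> i b (\<psi> a (m a x)) = (\<Sum>b'\<in>B i. if b' = b then L (u a b (m a x)) else 0)"
            using \<phi>B[OF i b] that by (auto simp: \<psi>_def f.sum f.scale intro!: sum.cong)
          then show ?thesis using b finB[OF i] by simp
        qed
        ultimately show ?thesis by (simp add: f.diff f.sum)
      qed
      then have "(\<Sum>b\<in>B i. \<phi> i b ?w *s b) = 0" by simp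
      then show ?thesis using proj[OF i wM] by simp
    qed
    \<comment> \<open>\<open>d \<rho>\<close> is the sum of its elementary components and has value
      1 under \<open>L\<close>, so one component has nonzero value. It supplies the witness; it lies
      in \<open>X (hd a)\<close> because \<open>\<rho>\<close> takes values in \<open>X\<close> and
      the arrows preserve \<open>X\<close>.\<close>
    have "\<exists>a\<in>A. \<exists>b\<in>B (tl a). L (u a b (d \<rho> (a, b))) \<noteq> 0"
    proof (rule ccontr)
      assume *: "\<not> ?thesis"
      have "d \<rho> = (\<Sum>a\<in>A. \<Sum>b\<in>B (tl a). u a b (d \<rho> (a, b)))"
      proof
        fix z :: "'c \<times> 'b"
        obtain a b where z: "z = (a, b)" by force
        have "(\<Sum>a\<in>A. \<Sum>b\<in>B (tl a). u a b (d \<rho> (a, b))) z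
            = (\<Sum>a'\<in>A. \<Sum>b'\<in>B (tl a'). if a' = a \<and> b' = b then d \<rho> (a, b) else 0)"
          by (auto simp: sum_apply u_def z intro!: sum.cong)
        also have "\<dots> = (\<Sum>a'\<in>A. if a' = a then (if b \<in> B (tl a) then d \<rho> (a, b) else 0) else 0)"
          using finB ht by (intro sum.cong) auto
        also have "\<dots> = d \<rho> z" using finA by (auto simp: d_def z sum.delta)
        finally show "d \<rho> z = (\<Sum>a\<in>A. \<Sum>b\<in>B (tl a). u a b (d \<rho> (a, b))) z" ..
      qed
      then have "L (d \<rho>) = L (\<Sum>a\<in>A. \<Sum>b\<in>B (tl a). u a b (d \<rho> (a, b)))"
        by (rule arg_cong)
      also have "\<dots> = (\<Sum>a\<in>A. \<Sum>b\<in>B (tl a). L (u a b (d \<rho> (a, b))))"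
        by (simp only: L.sum)
      finally have "L (d \<rho>) = (\<Sum>a\<in>A. \<Sum>b\<in>B (tl a). L (u a b (d \<rho> (a, b))))" .
      then show False using * L(3) by simp
    qed
    then obtain a b where ab: "a \<in> A" "b \<in> B (tl a)" "L (u a b (d \<rho> (a, b))) \<noteq> 0" by blast
    let ?x = "d \<rho> (a, b)"
    have "?x \<in> X (hd a)"
    proof -
      have "b \<in> M (tl a)" using ab ht BM by blast
      then show ?thesis
        using ab ht[OF ab(1)] \<rho>X mM[OF ab(1)] mX[OF ab(1)] X subspace_diff by (simp add: d_def)
    qed
    moreover have "\<psi> a ?x \<notin> X (tl a)"
    proof
      assume "\<psi> a ?x \<in> X (tl a)"
      have tI: "tl a \<in> I" using ht ab by blast
      interpret f: Vector_Spaces.linear scale "(*)" "\<phi> (tl a) b" using \<phi> tI ab by blast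
      have "\<phi> (tl a) b (\<psi> a ?x) = (\<Sum>b'\<in>B (tl a). if b' = b then L (u a b ?x) else 0)"
        using \<phi>B[OF tI ab(2)] by (auto simp: \<psi>_def f.sum f.scale intro!: sum.cong)
      also have "\<dots> = L (u a b ?x)" using ab finB[OF tI] by simp
      finally show False using \<phi>X[OF tI ab(2)] \<open>\<psi> a ?x \<in> X (tl a)\<close> ab(3) by simp
    qed
    ultimately show ?thesis using dual[of \<psi> a ?x] lin\<psi> \<psi>M rel ab(1) by blast
  qed
qed

end

end

section \<open>Subrepresentations of maximal defect\<close>

text \<open>For \<open>a < N\<close> the map \<open>m a\<close> belongs to the arrow from
  \<open>a\<close> to \<open>a + 1\<close>, and \<open>m N\<close> belongs to the chord from
  \<open>1\<close> to \<open>N\<close>. The maps are linear on the whole ambient space; their values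
  outside the spaces \<open>M i\<close> carry no information.\<close>

locale affine_rep = vector_space scale
  for scale :: "'a::field \<Rightarrow> 'b::ab_group_add \<Rightarrow> 'b" (infixr "*s" 75) +
  fixes N :: nat and M :: "nat \<Rightarrow> 'b set" and m :: "nat \<Rightarrow> 'b \<Rightarrow> 'b"
  assumes finite_scalars: "finite (UNIV :: 'a set)"
    and N: "N \<ge> 3"
    and subspace_M: "i \<in> {1..N} \<Longrightarrow> subspace (M i)"
    and finite_M: "i \<in> {1..N} \<Longrightarrow> finite (M i)"
    and linear_m: "a \<in> {1..N} \<Longrightarrow> Vector_Spaces.linear scale scale (m a)"
    and m_step: "a \<in> {1..<N} \<Longrightarrow> v \<in> M a \<Longrightarrow> m a v \<in> M (Suc a)"
    and m_chord: "v \<in> M 1 \<Longrightarrow> m N v \<in> M N"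
begin

definition subrep :: "(nat \<Rightarrow> 'b set) \<Rightarrow> bool" where
  "subrep U \<longleftrightarrow> (\<forall>i\<in>{1..N}. subspace (U i) \<and> U i \<subseteq> M i) \<and>
     (\<forall>a\<in>{1..<N}. \<forall>v\<in>U a. m a v \<in> U (Suc a)) \<and> (\<forall>v\<in>U 1. m N v \<in> U N)"

text \<open>This is the value of the Euler form, without its factor 2, at \<delta> and the dimension
  vector; compare \<open>euler_interval_1\<close>.\<close>

definition defect :: "(nat \<Rightarrow> 'b set) \<Rightarrow> int" where
  "defect U = int (dim (U 1)) - int (dim (U N))"

lemma subrepD:
  assumes "subrep U"
  shows "i \<in> {1..N} \<Longrightarrow> subspace (U i)" "i \<in> {1..N} \<Longrightarrow> U i \<subseteq> M i" "i \<in> {1..N} \<Longrightarrow> finite (U i)"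
    "a \<in> {1..<N} \<Longrightarrow> v \<in> U a \<Longrightarrow> m a v \<in> U (Suc a)" "v \<in> U 1 \<Longrightarrow> m N v \<in> U N"
proof -
  show "i \<in> {1..N} \<Longrightarrow> subspace (U i)" and sub: "i \<in> {1..N} \<Longrightarrow> U i \<subseteq> M i"
    "a \<in> {1..<N} \<Longrightarrow> v \<in> U a \<Longrightarrow> m a v \<in> U (Suc a)" "v \<in> U 1 \<Longrightarrow> m N v \<in> U N"
    using assms unfolding subrep_def by simp_all
  show "i \<in> {1..N} \<Longrightarrow> finite (U i)" using finite_M sub(1) finite_subset by metis
qed

text \<open>If \<open>X\<close> has no complement, the dual cocycle \<open>\<psi>\<close> gives a subrepresentation \<open>K\<close> of \<open>X\<close>, where
  \<open>\<psi>\<close> vanishes modulo \<open>X\<close>, and a larger subrepresentation \<open>Z\<close>, generated by its values. Their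
  dimensions show that \<open>Z\<close> has at least the defect of \<open>X\<close>.\<close>

lemma complement_of_maximal_defect:
  assumes X: "subrep X"
    and max: "\<And>U. subrep U \<Longrightarrow> defect U \<le> defect X"
    and max': "\<And>U i. subrep U \<Longrightarrow> defect U = defect X \<Longrightarrow> (\<And>j. j \<in> {1..N} \<Longrightarrow> X j \<subseteq> U j) \<Longrightarrow> i \<in> {1..N} \<Longrightarrow> U i = X i"
  obtains C where "subrep C" "\<And>i. i \<in> {1..N} \<Longrightarrow> C i \<inter> X i = {0}"
    "\<And>i v. i \<in> {1..N} \<Longrightarrow> v \<in> M i \<Longrightarrow> \<exists>x\<in>X i. v - x \<in> C i"
proof -
  define hd where "hd a = (if a = N then N else Suc a)" for a
  define tl where "tl a = (if a = N then 1 else a)" for a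
  have ht: "hd a \<in> {1..N} \<and> tl a \<in> {1..N}" if "a \<in> {1..N}" for a
    using that N by (auto simp: hd_def tl_def)
  have mM: "m a v \<in> M (hd a)" if "a \<in> {1..N}" "v \<in> M (tl a)" for a v
    using that m_step[of a v] m_chord[of v] by (cases "a = N") (auto simp: hd_def tl_def)
  have mX: "m a v \<in> X (hd a)" if "a \<in> {1..N}" "v \<in> X (tl a)" for a v
    using that subrepD(4)[OF X, of a v] subrepD(5)[OF X, of v] by (cases "a = N") (auto simp: hd_def tl_def)
  have sX: "\<And>i. i \<in> {1..N} \<Longrightarrow> subspace (X i)" and fX: "\<And>i. i \<in> {1..N} \<Longrightarrow> finite (X i)"
    using subrepD[OF X] by auto
  show ?thesis
  proof (rule complement_or_dual_cocycle[of "{1..N}" hd "{1..N}" tl M X m])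
    fix C assume C: "\<And>i. i \<in> {1..N} \<Longrightarrow> subspace (C i) \<and> C i \<subseteq> M i \<and> C i \<inter> X i = {0}"
      "\<And>i v. i \<in> {1..N} \<Longrightarrow> v \<in> M i \<Longrightarrow> \<exists>x\<in>X i. v - x \<in> C i"
      "\<And>a v. a \<in> {1..N} \<Longrightarrow> v \<in> C (tl a) \<Longrightarrow> m a v \<in> C (hd a)"
    have "m a v \<in> C (Suc a)" if "a \<in> {1..<N}" "v \<in> C a" for a v
      using C(3)[of a v] that by (auto simp: hd_def tl_def)
    moreover have "m N v \<in> C N" if "v \<in> C 1" for v
      using C(3)[of N v] that N by (auto simp: hd_def tl_def)
    ultimately have "subrep C" using C(1) unfolding subrep_def by blast
    then show thesis using that C by blast
  next
    fix \<psi> a\<^sub>0 x\<^sub>0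
    assume \<psi>: "\<And>a. a \<in> {1..N} \<Longrightarrow> Vector_Spaces.linear scale scale (\<psi> a)"
      and \<psi>M: "\<And>a x. a \<in> {1..N} \<Longrightarrow> \<psi> a x \<in> M (tl a)"
      and rel: "\<And>i x. i \<in> {1..N} \<Longrightarrow> x \<in> X i \<Longrightarrow>
        (\<Sum>a\<in>{a \<in> {1..N}. hd a = i}. m a (\<psi> a x)) - (\<Sum>a\<in>{a \<in> {1..N}. tl a = i}. \<psi> a (m a x)) \<in> X i"
      and nontriv: "a\<^sub>0 \<in> {1..N}" "x\<^sub>0 \<in> X (hd a\<^sub>0)" "\<psi> a\<^sub>0 x\<^sub>0 \<notin> X (tl a\<^sub>0)"
    \<comment> \<open>The relation takes three shapes: vertex \<open>1\<close> has two outgoing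
      arrows and no incoming one, an inner vertex has one of each, and \<open>N\<close> has two
      incoming arrows and no outgoing one. The signs are arranged so that each shape reads
      \<open>f (\<alpha> p) + g (\<beta> p)\<close> as in \<open>dim_pushout_le\<close>.\<close>
    have rel1: "\<psi> 1 (m 1 x) + \<psi> N (m N x) \<in> X 1" if "x \<in> X 1" for x
    proof -
      have eq: "{a \<in> {1..N}. hd a = 1} = {}" "{a \<in> {1..N}. tl a = 1} = {1, N}"
        using N by (auto simp: hd_def tl_def)
      have c: "1 \<in> {1..N}" using N by simp
      have "- (\<psi> 1 (m 1 x) + \<psi> N (m N x)) \<in> X 1"
        using rel[OF c that] N unfolding eq by simp
      then have "- (- (\<psi> 1 (m 1 x) + \<psi> N (m N x))) \<in> X 1" by (rule subspace_neg[OF sX[OF c]])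
      then show ?thesis by (simp only: minus_minus)
    qed
    have reli: "\<psi> i (m i x) + m (i - 1) (- \<psi> (i - 1) x) \<in> X i" if i: "2 \<le> i" "i < N" and x: "x \<in> X i" for i x
    proof -
      have eq: "{a \<in> {1..N}. hd a = i} = {i - 1}" "{a \<in> {1..N}. tl a = i} = {i}"
        using i by (auto simp: hd_def tl_def)
      have r: "m (i - 1) (\<psi> (i - 1) x) - \<psi> i (m i x) \<in> X i"
        using rel[of i x] x i unfolding eq by simp
      interpret ma: Vector_Spaces.linear scale scale "m (i - 1)" by (rule linear_m) (use i in auto)
      have "- (m (i - 1) (\<psi> (i - 1) x) - \<psi> i (m i x)) \<in> X i"
        using subspace_neg[OF sX r] i by simp
      then show ?thesis unfolding ma.neg by simp
    qed
    have relN: "m (N - 1) (\<psi> (N - 1) x) + m N (\<psi> N x) \<in> X N" if "x \<in> X N" for x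
    proof -
      have eq: "{a \<in> {1..N}. hd a = N} = {N - 1, N}" "{a \<in> {1..N}. tl a = N} = {}"
        using N by (auto simp: hd_def tl_def)
      show ?thesis using rel[of N x] that N unfolding eq by simp
    qed
    have \<psi>Mi: "\<psi> i x \<in> M i" if "1 \<le> i" "i < N" for i x using \<psi>M[of i x] that by (simp add: tl_def)
    have \<psi>MN: "\<psi> N x \<in> M 1" for x using \<psi>M[of N x] N by (simp add: tl_def)
    have lin_neg: "Vector_Spaces.linear scale scale (\<lambda>x. - \<psi> a x)" if "a \<in> {1..N}" for a
      using \<psi>[OF that] by (auto simp: Vector_Spaces.linear_iff)

    \<comment> \<open>The conditions on \<open>K\<close> propagate against the arrows, so the
      recursion starts at the sink: \<open>Kd d\<close> is the space at \<open>N - d\<close>. Vertex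
      \<open>1\<close> is separate because two arrows leave it.\<close>
    define KN where "KN = {x \<in> X N. \<psi> (N - 1) x \<in> X (N - 1) \<and> \<psi> N x \<in> X 1}"
    define Kd where "Kd = rec_nat KN (\<lambda>d S. {x \<in> X (N - Suc d). m (N - Suc d) x \<in> S \<and>
      - \<psi> (N - Suc d - 1) x \<in> X (N - Suc d - 1)})"
    define K where "K i = (if i = 1 then {x \<in> X 1. m 1 x \<in> Kd (N - 2) \<and> m N x \<in> KN} else Kd (N - i))" for i
    have K_N: "K N = KN" using N by (simp add: K_def Kd_def)
    have K_1: "K 1 = {x \<in> X 1. m 1 x \<in> K 2 \<and> m N x \<in> K N}"
      unfolding K_N by (simp add: K_def)
    have K_i: "K i = {x \<in> X i. m i x \<in> K (Suc i) \<and> - \<psi> (i - 1) x \<in> X (i - 1)}" if "2 \<le> i" "i < N" for i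
    proof -
      have eq: "N - Suc (N - Suc i) = i" using that by auto
      have "Kd (Suc d) = {x \<in> X (N - Suc d). m (N - Suc d) x \<in> Kd d \<and>
          - \<psi> (N - Suc d - 1) x \<in> X (N - Suc d - 1)}" for d
        by (simp add: Kd_def)
      from this[of "N - Suc i"] show ?thesis
        using that unfolding eq by (simp add: K_def Suc_diff_Suc)
    qed
    have sub_pre: "subspace {x \<in> A. f x \<in> B}" if "subspace A" "subspace B" "Vector_Spaces.linear scale scale f" for A B f
    proof -
      interpret f: Vector_Spaces.linear scale scale f by fact
      have "{x \<in> A. f x \<in> B} = A \<inter> {x. f x \<in> B}" by auto
      then show ?thesis using subspace_inter[OF that(1) f.subspace_linear_preimage[OF that(2)]] by simp
    qed
    have sub_pre2: "subspace {x \<in> A. f x \<in> B \<and> g x \<in> C}" if "subspace A" "subspace B" "subspace C"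
      "Vector_Spaces.linear scale scale f" "Vector_Spaces.linear scale scale g" for A B C f g
      using sub_pre[OF sub_pre[OF that(1,2,4)] that(3,5)] by (simp add: conj_assoc)
    have K_up: "subspace (K i)" if "2 \<le> i" "i \<le> N" for i
      using that(2,1)
    proof (induction i rule: inc_induct)
      case base
      show ?case unfolding K_N KN_def using \<psi> sX N by (intro sub_pre2) auto
    next
      case (step i)
      have c: "i \<in> {1..N}" "i - 1 \<in> {1..N}" "2 \<le> Suc i" using step.prems step.hyps by auto
      show ?case unfolding K_i[OF step.prems step.hyps(2)]
        by (intro sub_pre2 sX linear_m lin_neg c step.IH)
    qed
    have sK: "subspace (K i)" if "i \<in> {1..N}" for i
    proof (cases "i = 1")
      case True
      show ?thesis unfolding True K_1 using K_up linear_m sX N by (intro sub_pre2) auto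
    qed (use K_up that in auto)
    have KX: "K i \<subseteq> X i" if i: "i \<in> {1..N}" for i
    proof -
      consider "i = 1" | "i = N" | "2 \<le> i \<and> i < N" using i by fastforce
      then show ?thesis by cases (use K_1 K_N KN_def K_i in auto)
    qed
    have "subrep K" unfolding subrep_def
    proof (intro conjI ballI)
      fix i assume "i \<in> {1..N}"
      then show "subspace (K i)" "K i \<subseteq> M i" using sK KX subrepD(2)[OF X] by blast+
    next
      fix a v assume "a \<in> {1..<N}" "v \<in> K a"
      then show "m a v \<in> K (Suc a)" using K_1 K_i[of a] by (cases "a = 1") (auto simp: numeral_2_eq_2)
    next
      fix v assume "v \<in> K 1" then show "m N v \<in> K N" using K_1 by auto
    qed
    then have defK: "defect K \<le> defect X" by (rule max)
    have \<psi>K: "\<psi> i x \<in> X i" if "x \<in> K (Suc i)" "1 \<le> i" "i < N" for i x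
    proof (cases "Suc i = N")
      case True
      then show ?thesis using that K_N KN_def by auto
    next
      case False
      then have "- \<psi> i x \<in> X i" using K_i[of "Suc i"] that by auto
      then have "- (- \<psi> i x) \<in> X i" by (rule subspace_neg[OF sX, rotated]) (use that in auto)
      then show ?thesis by simp
    qed
    have \<psi>NK: "\<psi> N x \<in> X 1" if "x \<in> K N" for x using that K_N KN_def by auto

    \<comment> \<open>\<open>Z\<close> grows along the arrows, so the recursion starts at vertex
      \<open>1\<close>: \<open>Zd d\<close> is the space at \<open>d + 1\<close>. The sink is
      separate because it receives both the path and the chord.\<close>
    define Z1 where "Z1 = {\<psi> 1 a + \<psi> N b + w |a b w. a \<in> X 2 \<and> b \<in> X N \<and> w \<in> X 1}"
    define Zd where "Zd = rec_nat Z1 (\<lambda>d S. {\<psi> (d + 2) a + m (d + 1) b + w |a b w.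
      a \<in> X (d + 3) \<and> b \<in> S \<and> w \<in> X (d + 2)})"
    define ZN where "ZN = {m (N - 1) a + m N b + w |a b w. a \<in> Zd (N - 2) \<and> b \<in> Z1 \<and> w \<in> X N}"
    define Z where "Z i = (if i = N then ZN else Zd (i - 1))" for i
    have Z_1: "Z 1 = {\<psi> 1 a + \<psi> N b + w |a b w. a \<in> X 2 \<and> b \<in> X N \<and> w \<in> X 1}"
      using N by (simp add: Z_def Zd_def Z1_def)
    have Z_i: "Z i = {\<psi> i a + m (i - 1) b + w |a b w. a \<in> X (Suc i) \<and> b \<in> Z (i - 1) \<and> w \<in> X i}"
      if i: "2 \<le> i" "i < N" for i
    proof -
      define d where "d = i - 2"
      have "i = d + 2" using i by (simp add: d_def)
      then show ?thesis using i by (simp add: Z_def Zd_def numeral_3_eq_3)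
    qed
    have Z_iI: "\<psi> (Suc i) a + m i b + w \<in> Z (Suc i)"
      if "1 \<le> i" "Suc i < N" "a \<in> X (Suc (Suc i))" "b \<in> Z i" "w \<in> X (Suc i)" for i a b w
    proof -
      have eq: "2 \<le> Suc i" "Suc i - 1 = i" using that by auto
      show ?thesis unfolding Z_i[OF eq(1) that(2)] eq(2) using that(3-5) by blast
    qed
    have Z_N: "Z N = {m (N - 1) a + m N b + w |a b w. a \<in> Z (N - 1) \<and> b \<in> Z 1 \<and> w \<in> X N}"
    proof -
      have "N - 1 \<noteq> N" "N - 1 - 1 = N - 2" "1 \<noteq> N" using N by auto
      then show ?thesis by (simp add: Z_def ZN_def) (simp add: Zd_def)
    qed
    have XZ: "X i \<subseteq> Z i" and \<psi>Z: "\<And>x. i < N \<Longrightarrow> x \<in> X (Suc i) \<Longrightarrow> \<psi> i x \<in> Z i"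
      and MZ: "Z i \<subseteq> M i" if "i \<in> {1..N}" for i
    proof -
      have x0: "0 \<in> X j" if "j \<in> {1..N}" for j using sX[OF that] subspace_0 by blast
      have \<psi>0: "\<psi> a 0 = 0" and m0: "m a 0 = 0" if "a \<in> {1..N}" for a
        using \<psi>[OF that] linear_m[OF that] by (metis Vector_Spaces.linear_iff scale_zero_left)+
      have z1: "X 1 \<subseteq> Z 1"
      proof
        fix w assume "w \<in> X 1"
        then show "w \<in> Z 1" unfolding Z_1 using x0[of 2] x0[of N] \<psi>0[of 1] \<psi>0[of N] N
          by (intro CollectI exI[of _ 0] exI[of _ w]) auto
      qed
      have cN: "1 \<in> {1..N}" "N - 1 \<in> {1..N}" "N \<in> {1..N}" "1 \<le> N - 1" "N - 1 < N" "Suc (N - 1) = N"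
        using N by auto
      have zi: "X i \<subseteq> Z i" if "1 \<le> i" "i < N" for i
        using that
      proof (induction i rule: dec_induct)
        case base show ?case by (rule z1)
      next
        case (step i)
        then have "0 \<in> Z i" using x0[of i] by auto
        show ?case
        proof
          fix w assume w: "w \<in> X (Suc i)"
          have a: "0 \<in> X (Suc (Suc i))" "\<psi> (Suc i) 0 = 0" "m i 0 = 0"
            using x0[of "Suc (Suc i)"] \<psi>0[of "Suc i"] m0[of i] step by auto
          have "\<psi> (Suc i) 0 + m i 0 + w \<in> Z (Suc i)"
            by (rule Z_iI[OF step(1,4) a(1) \<open>0 \<in> Z i\<close> w])
          then show "w \<in> Z (Suc i)" using a by simp
        qed
      qed
      have zN: "X N \<subseteq> Z N"
      proof
        fix w assume "w \<in> X N"
        moreover have "0 \<in> Z 1" "0 \<in> Z (N - 1)" using z1 zi[OF cN(4,5)] x0[OF cN(1)] x0[OF cN(2)] by blast+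
        ultimately have "m (N - 1) 0 + m N 0 + w \<in> Z N" unfolding Z_N by blast
        then show "w \<in> Z N" using m0[OF cN(2)] m0[OF cN(3)] by simp
      qed
      show XZ: "X i \<subseteq> Z i" using zi zN that by (cases "i = N") auto
      show "\<psi> i x \<in> Z i" if ix: "i < N" "x \<in> X (Suc i)" for x
      proof (cases "i = 1")
        case True
        have "\<psi> 1 x + \<psi> N 0 + 0 \<in> Z 1" unfolding Z_1 using ix True x0[of N] x0[of 1] N
          by (intro CollectI exI[of _ x] exI[of _ 0]) (auto simp: numeral_2_eq_2)
        then show ?thesis using \<psi>0[of N] True N by simp
      next
        case False
        then have i: "2 \<le> i" using \<open>i \<in> {1..N}\<close> by auto
        have "1 \<le> i - 1" "i - 1 < N" "i - 1 \<in> {1..N}" using i ix by auto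
        then have "0 \<in> Z (i - 1)" using subsetD[OF zi x0] by metis
        then have "\<psi> i x + m (i - 1) 0 + 0 \<in> Z i"
          unfolding Z_i[OF i ix(1)] using ix(2) x0[OF \<open>i \<in> {1..N}\<close>] by blast
        moreover have "i - 1 \<in> {1..N}" using i ix by auto
        ultimately show ?thesis using m0[of "i - 1"] by simp
      qed
      have mz1: "Z 1 \<subseteq> M 1"
        unfolding Z_1 using subspace_M[of 1] \<psi>Mi[of 1] \<psi>MN subrepD(2)[OF X, of 1] N subspace_add[of "M 1"] by auto
      have mzi: "Z i \<subseteq> M i" if "1 \<le> i" "i < N" for i
        using that
      proof (induction i rule: dec_induct)
        case base show ?case by (rule mz1)
      next
        case (step i)
        have add: "\<And>x y. x \<in> M (Suc i) \<Longrightarrow> y \<in> M (Suc i) \<Longrightarrow> x + y \<in> M (Suc i)"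
          using subspace_M[of "Suc i"] step subspace_add by auto
        have "\<And>z. z \<in> Z i \<Longrightarrow> m i z \<in> M (Suc i)" using step m_step[of i] by auto
        then show ?case
          using Z_i[of "Suc i"] \<psi>Mi[of "Suc i"] step subrepD(2)[OF X, of "Suc i"] by (auto intro!: add)
      qed
      have "Z N \<subseteq> M N"
      proof -
        have add: "\<And>x y. x \<in> M N \<Longrightarrow> y \<in> M N \<Longrightarrow> x + y \<in> M N"
          using subspace_M[of N] N subspace_add by auto
        have "\<And>z. z \<in> Z (N - 1) \<Longrightarrow> m (N - 1) z \<in> M N" using mzi[OF cN(4,5)] m_step[of "N - 1"] cN by auto
        moreover have "\<And>z. z \<in> Z 1 \<Longrightarrow> m N z \<in> M N" using mz1 m_chord by auto
        ultimately show ?thesis unfolding Z_N using subrepD(2)[OF X, of N] N by (auto intro!: add)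
      qed
      then show "Z i \<subseteq> M i" using mzi that by (cases "i = N") auto
    qed
    note pushout = dim_pushout_le[OF finite_scalars]
    have sub1: "subspace (Z 1)" and dim1: "dim (Z 1) + dim (K 2) + dim (K N) + dim (X 1) \<le> dim (K 1) + dim (X 2) + dim (X N) + dim (X 1)"
    proof -
      have c: "1 \<in> {1..N}" "2 \<in> {1..N}" "N \<in> {1..N}" using N by auto
      have a: "m 1 p \<in> X 2" "m N p \<in> X N" if "p \<in> X 1" for p
        using subrepD(4)[OF X, of 1 p] subrepD(5)[OF X that] that N by (auto simp: numeral_2_eq_2)
      have k: "\<psi> 1 x \<in> X 1" if "x \<in> K 2" for x using \<psi>K[of x 1] that N by (simp add: numeral_2_eq_2)
      show "subspace (Z 1)" unfolding Z_1
        by (rule pushout(1)[where A = "X 2" and B = "X N" and P = "X 1" and X = "X 1" and KA = "K 2" and KB = "K N"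
              and \<alpha> = "m 1" and \<beta> = "m N"])
           (use c fX sX sK KX \<psi> linear_m k \<psi>NK a rel1 in auto)
      show "dim (Z 1) + dim (K 2) + dim (K N) + dim (X 1) \<le> dim (K 1) + dim (X 2) + dim (X N) + dim (X 1)"
        unfolding Z_1 K_1
        by (rule pushout(3)[where A = "X 2" and B = "X N" and P = "X 1" and X = "X 1" and KA = "K 2" and KB = "K N"
              and \<alpha> = "m 1" and \<beta> = "m N"])
           (use c fX sX sK KX \<psi> linear_m k \<psi>NK a rel1 in auto)
    qed
    have fZ: "finite (Z i)" if "i \<in> {1..N}" for i using MZ[OF that] finite_M[OF that] finite_subset by blast
    have stepZ: "subspace (Z i) \<and>
        dim (Z i) + dim (K (Suc i)) + dim (X (i - 1)) + dim (X i) \<le> dim (K i) + dim (X (Suc i)) + dim (Z (i - 1)) + dim (X i)"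
      if i: "2 \<le> i" "i < N" and s: "subspace (Z (i - 1))" for i
    proof -
      have c: "i \<in> {1..N}" "i - 1 \<in> {1..N}" "Suc i \<in> {1..N}" using i by auto
      have k: "\<psi> i x \<in> X i" if "x \<in> K (Suc i)" for x using \<psi>K[of x i] that i by simp
      have k': "m (i - 1) x \<in> X i" if "x \<in> X (i - 1)" for x
      proof -
        have "i - 1 \<in> {1..<N}" "Suc (i - 1) = i" using i by auto
        then show ?thesis using subrepD(4)[OF X _ that] by metis
      qed
      have a: "m i p \<in> X (Suc i)" if "p \<in> X i" for p
        using subrepD(4)[OF X, of i p] that i by auto
      have b: "- \<psi> (i - 1) p \<in> Z (i - 1)" if "p \<in> X i" for p
        using \<psi>Z[OF c(2), of p] that i subspace_neg[OF s] by simp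
      have "subspace (Z i)" unfolding Z_i[OF i]
        by (rule pushout(1)[where A = "X (Suc i)" and B = "Z (i - 1)" and P = "X i" and X = "X i" and KA = "K (Suc i)"
              and KB = "X (i - 1)" and \<alpha> = "m i" and \<beta> = "\<lambda>x. - \<psi> (i - 1) x"])
           (use c fX fZ sX sK KX XZ s \<psi> lin_neg linear_m k k' a b reli[OF i] in auto)
      moreover have "dim (Z i) + dim (K (Suc i)) + dim (X (i - 1)) + dim (X i) \<le> dim (K i) + dim (X (Suc i)) + dim (Z (i - 1)) + dim (X i)"
        unfolding Z_i[OF i] K_i[OF i]
        by (rule pushout(3)[where A = "X (Suc i)" and B = "Z (i - 1)" and P = "X i" and X = "X i" and KA = "K (Suc i)"
              and KB = "X (i - 1)" and \<alpha> = "m i" and \<beta> = "\<lambda>x. - \<psi> (i - 1) x"])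
           (use c fX fZ sX sK KX XZ s \<psi> lin_neg linear_m k k' a b reli[OF i] in auto)
      ultimately show ?thesis ..
    qed
    \<comment> \<open>The inequalities of the inner vertices compare neighbours and telescope along
      the path.\<close>
    have chain: "subspace (Z i) \<and> dim (Z i) + dim (K (Suc i)) + dim (X 1) + dim (X 2) \<le> dim (K 2) + dim (X (Suc i)) + dim (Z 1) + dim (X i)"
      if "1 \<le> i" "i < N" for i
      using that
    proof (induction i rule: dec_induct)
      case base
      then show ?case using sub1 by (simp add: numeral_2_eq_2)
    next
      case (step i)
      have s: "subspace (Z i)" using step by auto
      show ?case using step(3) step(4) \<open>1 \<le> i\<close> stepZ[of "Suc i"] s by auto
    qed
    have subN: "subspace (Z N)" and dimN: "dim (Z N) + dim (X (N - 1)) + dim (X 1) + dim (X N) \<le> dim (K N) + dim (Z (N - 1)) + dim (Z 1) + dim (X N)"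
    proof -
      have c: "1 \<in> {1..N}" "N - 1 \<in> {1..N}" "N \<in> {1..N}" using N by auto
      have s: "subspace (Z (N - 1))" using chain[of "N - 1"] N by auto
      have k: "m (N - 1) x \<in> X N" if "x \<in> X (N - 1)" for x
        using subrepD(4)[OF X, of "N - 1" x] that N by auto
      have a: "\<psi> (N - 1) p \<in> Z (N - 1)" if "p \<in> X N" for p using \<psi>Z[OF c(2), of p] that N by auto
      have b: "\<psi> N p \<in> Z 1" if "p \<in> X N" for p
      proof -
        have "\<psi> 1 0 + \<psi> N p + 0 \<in> Z 1" unfolding Z_1
          using that sX[of 2] sX[of 1] N subspace_0 by (intro CollectI exI[of _ 0] exI[of _ p]) auto
        moreover have "\<psi> 1 0 = 0" using \<psi>[OF c(1)] by (metis Vector_Spaces.linear_iff scale_zero_left)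
        ultimately show ?thesis by simp
      qed
      show "subspace (Z N)" unfolding Z_N
        by (rule pushout(1)[where A = "Z (N - 1)" and B = "Z 1" and P = "X N" and X = "X N" and KA = "X (N - 1)" and KB = "X 1"
              and \<alpha> = "\<psi> (N - 1)" and \<beta> = "\<psi> N"])
           (use c fX fZ sX XZ s sub1 \<psi> linear_m k subrepD(5)[OF X] a b relN in auto)
      have "K N = {p \<in> X N. \<psi> (N - 1) p \<in> X (N - 1) \<and> \<psi> N p \<in> X 1}" by (simp add: K_N KN_def)
      then show "dim (Z N) + dim (X (N - 1)) + dim (X 1) + dim (X N) \<le> dim (K N) + dim (Z (N - 1)) + dim (Z 1) + dim (X N)"
        unfolding Z_N
        by (simp only:, intro pushout(3)[where A = "Z (N - 1)" and B = "Z 1" and P = "X N" and X = "X N" and KA = "X (N - 1)" and KB = "X 1"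
              and \<alpha> = "\<psi> (N - 1)" and \<beta> = "\<psi> N"])
           (use c fX fZ sX XZ s sub1 \<psi> linear_m k subrepD(5)[OF X] a b relN in auto)
    qed
    \<comment> \<open>Together the inequalities at all vertices say
      \<open>2 * defect X \<le> defect Z + defect K\<close>, and \<open>defK\<close> removes
      \<open>K\<close>.\<close>
    have defZ: "defect X \<le> defect Z"
    proof -
      have c: "1 \<le> N - 1" "N - 1 < N" "Suc (N - 1) = N" using N by auto
      show ?thesis
        using chain[OF c(1,2)] dim1 dimN defK unfolding defect_def c(3) by linarith
    qed
    have sZ: "subspace (Z i)" if "i \<in> {1..N}" for i
      using chain[of i] subN that by (cases "i = N") auto
    have "subrep Z" unfolding subrep_def
    proof (intro conjI ballI)
      fix i assume "i \<in> {1..N}"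
      then show "subspace (Z i)" "Z i \<subseteq> M i" using sZ MZ by auto
    next
      fix a v assume a: "a \<in> {1..<N}" and v: "v \<in> Z a"
      have x0: "0 \<in> X j" if "j \<in> {1..N}" for j using sX[OF that] subspace_0 by blast
      show "m a v \<in> Z (Suc a)"
      proof (cases "Suc a = N")
        case True
        have "m a v + m N 0 + 0 \<in> Z N" unfolding Z_N
          using v True a x0[of N] subspace_0[OF sub1] by (intro CollectI exI[of _ v] exI[of _ 0]) auto
        moreover have "m N 0 = 0" using linear_m[of N] N by (metis Vector_Spaces.linear_iff scale_zero_left atLeastAtMost_iff le_numeral_extra(4) order_refl order_trans one_le_numeral)
        ultimately show ?thesis using True by simp
      next
        case False
        have "\<psi> (Suc a) 0 + m a v + 0 \<in> Z (Suc a)"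
          using Z_iI[of a 0 v 0] v False a x0[of "Suc (Suc a)"] x0[of "Suc a"] by auto
        moreover have "\<psi> (Suc a) 0 = 0" using \<psi>[of "Suc a"] a by (metis Vector_Spaces.linear_iff scale_zero_left Suc_leI atLeastAtMost_iff atLeastLessThan_iff le_SucI)
        ultimately show ?thesis by simp
      qed
    next
      fix v assume v: "v \<in> Z 1"
      have "m (N - 1) 0 + m N v + 0 \<in> Z N" unfolding Z_N
        using v sX[of N] subspace_0 sZ[of "N - 1"] N by (intro CollectI exI[of _ 0] exI[of _ v]) auto
      moreover have "m (N - 1) 0 = 0"
      proof -
        interpret l: Vector_Spaces.linear scale scale "m (N - 1)" using linear_m N by auto
        show ?thesis by (rule l.zero)
      qed
      ultimately show "m N v \<in> Z N" by simp
    qed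
    \<comment> \<open>Maximality of \<open>X\<close> leaves no room for \<open>Z\<close>, so all
      values of \<open>\<psi>\<close> lie in \<open>X\<close>, against the choice of
      \<open>a\<^sub>0\<close> and \<open>x\<^sub>0\<close>.\<close>
    then have ZX: "Z i = X i" if "i \<in> {1..N}" for i
      using max'[of Z i] max[of Z] defZ XZ that by auto
    have "\<psi> a\<^sub>0 x\<^sub>0 \<in> X (tl a\<^sub>0)"
    proof (cases "a\<^sub>0 = N")
      case True
      have "\<psi> 1 0 + \<psi> N x\<^sub>0 + 0 \<in> Z 1" unfolding Z_1
        using nontriv(2) True sX[of 2] sX[of 1] N subspace_0 by (intro CollectI exI[of _ 0] exI[of _ x\<^sub>0]) (auto simp: hd_def)
      moreover have "\<psi> 1 0 = 0"
      proof -
        interpret l: Vector_Spaces.linear scale scale "\<psi> 1" using \<psi> N by auto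
        show ?thesis by (rule l.zero)
      qed
      ultimately show ?thesis using ZX[of 1] True N by (simp add: tl_def)
    next
      case False
      then show ?thesis using \<psi>Z[of a\<^sub>0 x\<^sub>0] ZX[of a\<^sub>0] nontriv by (auto simp: tl_def hd_def)
    qed
    then show thesis using nontriv(3) by contradiction
  qed (use subspace_M finite_M sX subrepD(2)[OF X] linear_m mM mX ht in auto)
qed

end

section \<open>Representations as hyperplane configurations\<close>

text \<open>This is what a subrepresentation becomes when the spaces at \<open>2\<close>, ...,
  \<open>N\<close> are identified with \<open>W\<close> along the path and the space at
  \<open>1\<close> with a subspace \<open>V\<close> of \<open>W\<close> along the chord: the arrows
  turn into inclusions, except for the first one, which turns into \<open>b\<close>.\<close>

definition (in vector_space) nested_flags ::
    "nat \<Rightarrow> 'b set \<Rightarrow> 'b set \<Rightarrow> ('b \<Rightarrow> 'b) \<Rightarrow> (nat \<Rightarrow> nat) \<Rightarrow> (nat \<Rightarrow> 'b set) set" where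
  "nested_flags N V W b e = {U \<in> extensional {1..N}.
     (\<forall>i\<in>{1..N}. subspace (U i) \<and> dim (U i) = e i) \<and> U 1 \<subseteq> V \<and> (\<forall>i\<in>{2..N}. U i \<subseteq> W) \<and>
     (\<forall>i\<in>{2..<N}. U i \<subseteq> U (Suc i)) \<and> b ` U 1 \<subseteq> U 2 \<and> U 1 \<subseteq> U N}"

context affine_rep begin

text \<open>The maximum is taken twice, of the defect and then of the total dimension, because the
  splitting of \<open>X\<close> requires both. The zero subrepresentation gives
  \<open>0 \<le> defect X\<close>, so \<open>X\<close> is not all of \<open>M\<close> and its
  complement is nonzero. Once \<open>X\<close> is zero, the second maximality excludes nonzero
  subrepresentations of defect 0.\<close>

lemma negative_defect:
  assumes indec: "\<And>C X. subrep C \<Longrightarrow> subrep X \<Longrightarrow> (\<And>i. i \<in> {1..N} \<Longrightarrow> C i \<inter> X i = {0}) \<Longrightarrow>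
      (\<And>i v. i \<in> {1..N} \<Longrightarrow> v \<in> M i \<Longrightarrow> \<exists>x\<in>X i. v - x \<in> C i) \<Longrightarrow>
      (\<forall>i\<in>{1..N}. C i = {0}) \<or> (\<forall>i\<in>{1..N}. X i = {0})"
    and M: "defect M < 0" and U: "subrep U" "j \<in> {1..N}" "U j \<noteq> {0}"
  shows "defect U < 0"
proof -
  have c: "1 \<in> {1..N}" "N \<in> {1..N}" using N by auto
  have zero: "subrep (\<lambda>_. {0})"
  proof -
    have "m a 0 = 0" if "a \<in> {1..N}" for a
    proof -
      interpret l: Vector_Spaces.linear scale scale "m a" using linear_m that by blast
      show ?thesis by (rule l.zero)
    qed
    then show ?thesis using subspace_0[OF subspace_M] N unfolding subrep_def by auto
  qed
  have le: "dim (U i) \<le> dim (M i)" if "subrep U" "i \<in> {1..N}" for U i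
    using that subrepD subspace_M finite_M by (intro dim_mono_finite[OF finite_scalars]) auto
  \<comment> \<open>Adding \<open>dim (M N)\<close> makes the defect a natural number, for which
    boundedness gives a maximum.\<close>
  obtain X0 where X0: "subrep X0" "\<And>U. subrep U \<Longrightarrow> nat (defect U + int (dim (M N))) \<le> nat (defect X0 + int (dim (M N)))"
  proof -
    have b: "\<forall>U. subrep U \<longrightarrow> nat (defect U + int (dim (M N))) < Suc (dim (M 1) + dim (M N))"
    proof (intro allI impI)
      fix U assume "subrep U"
      then show "nat (defect U + int (dim (M N))) < Suc (dim (M 1) + dim (M N))"
        using le[of U 1] c by (simp add: defect_def)
    qed
    show ?thesis using that ex_has_greatest_nat[of subrep, OF zero b] by blast
  qed
  have X0max: "defect U \<le> defect X0" if "subrep U" for U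
    using X0(2)[OF that] le[OF that c(2)] le[OF X0(1) c(2)] by (simp add: defect_def)
  obtain X where X: "subrep X" "defect X = defect X0"
    "\<And>U. subrep U \<Longrightarrow> defect U = defect X0 \<Longrightarrow> (\<Sum>i\<in>{1..N}. dim (U i)) \<le> (\<Sum>i\<in>{1..N}. dim (X i))"
  proof -
    have b: "\<forall>U. subrep U \<and> defect U = defect X0 \<longrightarrow> (\<Sum>i\<in>{1..N}. dim (U i)) < Suc (\<Sum>i\<in>{1..N}. dim (M i))"
      using le by (auto intro!: sum_mono le_imp_less_Suc)
    show ?thesis
      using that ex_has_greatest_nat[of "\<lambda>U. subrep U \<and> defect U = defect X0" X0 "\<lambda>U. \<Sum>i\<in>{1..N}. dim (U i)", OF _ b] X0(1)
      by blast
  qed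
  have max: "defect U \<le> defect X" if "subrep U" for U using X0max[OF that] X(2) by simp
  have max': "U i = X i"
    if U: "subrep U" "defect U = defect X" "\<And>j. j \<in> {1..N} \<Longrightarrow> X j \<subseteq> U j" and i: "i \<in> {1..N}" for U i
  proof -
    have mono: "dim (X j) \<le> dim (U j)" if "j \<in> {1..N}" for j
      using that U subrepD[OF U(1)] subrepD[OF X(1)] by (intro dim_mono_finite[OF finite_scalars]) auto
    have "dim (U i) \<le> dim (X i)"
    proof (rule ccontr)
      assume "\<not> dim (U i) \<le> dim (X i)"
      then have "(\<Sum>i\<in>{1..N}. dim (X i)) < (\<Sum>i\<in>{1..N}. dim (U i))"
        using mono i by (intro sum_strict_mono_ex1) (auto intro!: bexI[of _ i])
      then show False using X(3)[OF U(1)] U(2) X(2) by simp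
    qed
    then have "X i = U i"
      using i U(3)[OF i] subrepD[OF U(1)] subrepD[OF X(1)] by (intro subspace_eq_if_dim[OF finite_scalars]) auto
    then show ?thesis by simp
  qed
  obtain C where C: "subrep C" "\<And>i. i \<in> {1..N} \<Longrightarrow> C i \<inter> X i = {0}"
    "\<And>i v. i \<in> {1..N} \<Longrightarrow> v \<in> M i \<Longrightarrow> \<exists>x\<in>X i. v - x \<in> C i"
  proof (rule complement_of_maximal_defect[OF X(1)])
    fix U assume "subrep U"
    then show "defect U \<le> defect X" by (rule max)
  next
    fix U i assume "subrep U" "defect U = defect X" "\<And>j. j \<in> {1..N} \<Longrightarrow> X j \<subseteq> U j" "i \<in> {1..N}"
    then show "U i = X i" by (rule max')
  qed blast
  have pos: "0 \<le> defect X" using max[OF zero] by (simp add: defect_def)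
  have "\<not> (\<forall>i\<in>{1..N}. C i = {0})"
  proof
    assume C0: "\<forall>i\<in>{1..N}. C i = {0}"
    have "X i = M i" if i: "i \<in> {1..N}" for i
    proof
      show "M i \<subseteq> X i" using C(3)[OF i] C0 i by fastforce
    qed (use subrepD(2)[OF X(1) i] in auto)
    then have "defect X = defect M" using c by (simp add: defect_def)
    then show False using pos M by simp
  qed
  then have X_0: "X i = {0}" if "i \<in> {1..N}" for i using indec[OF C(1) X(1) C(2,3)] that by blast
  then have dX: "defect X = 0" using c by (simp add: defect_def)
  have "defect U \<noteq> 0"
  proof
    assume "defect U = 0"
    then have "U j = X j" using max'[OF U(1) _ _ U(2)] dX X_0 subspace_0[OF subrepD(1)[OF U(1)]] by auto
    then show False using U X_0 by simp
  qed
  then show ?thesis using max[OF U(1)] dX by simp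
qed

text \<open>Negative defect is exploited through test subrepresentations. A kernel placed at a
  single inner vertex has defect 0, so the inner arrows are injective. A space \<open>S\<close> at
  vertex \<open>1\<close> whose images under the path and the chord fit into some \<open>T\<close>
  with \<open>dim T \<le> dim S\<close> has defect at least 0; this gives injectivity of the chord
  and excludes invariant subspaces. Bijectivity of the inner arrows then comes from equal
  dimensions.\<close>

lemma subreps_as_nested_flags:
  assumes neg: "\<And>U j. subrep U \<Longrightarrow> j \<in> {1..N} \<Longrightarrow> U j \<noteq> {0} \<Longrightarrow> defect U < 0"
    and dim_1: "dim (M 1) = l" and dim_i: "\<And>i. i \<in> {2..N} \<Longrightarrow> dim (M i) = Suc l"
  obtains V b where "subspace V" "V \<subseteq> M N" "dim V = l" "Vector_Spaces.linear scale scale b"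
    "\<And>v. v \<in> V \<Longrightarrow> b v \<in> M N" "\<And>S. subspace S \<Longrightarrow> S \<subseteq> V \<Longrightarrow> b ` S \<subseteq> S \<Longrightarrow> S = {0}"
    "\<And>e. card {U \<in> extensional {1..N}. subrep U \<and> (\<forall>i\<in>{1..N}. dim (U i) = e i)} = card (nested_flags N V (M N) b e)"
proof -
  have c: "1 \<in> {1..N}" "2 \<in> {1..N}" "N \<in> {1..N}" "2 \<in> {2..N}" "N \<in> {2..N}" using N by auto
  have m0: "m a 0 = 0" if "a \<in> {1..N}" for a
  proof -
    interpret l: Vector_Spaces.linear scale scale "m a" using linear_m that by blast
    show ?thesis by (rule l.zero)
  qed
  have M0: "0 \<in> M i" if "i \<in> {1..N}" for i using subspace_0[OF subspace_M[OF that]] .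
  have inj_step: "inj_on (m i) (M i)" if i: "i \<in> {2..<N}" for i
  proof -
    have i': "i \<in> {1..N}" "i \<in> {1..<N}" using i by auto
    interpret l: Vector_Spaces.linear scale scale "m i" using linear_m i' by blast
    define U where "U j = (if j = i then {v \<in> M i. m i v = 0} else {0})" for j
    have "subrep U" unfolding subrep_def
    proof (intro conjI ballI)
      fix j assume j: "j \<in> {1..N}"
      have "subspace {v \<in> M i. m i v = 0}"
        using subspace_inter[OF subspace_M[OF i'(1)] l.subspace_kernel] by (simp add: Collect_conj_eq)
      then show "subspace (U j)" by (simp add: U_def)
      show "U j \<subseteq> M j" using M0[OF j] by (auto simp: U_def)
    next
      fix a v assume "a \<in> {1..<N}" "v \<in> U a"
      then show "m a v \<in> U (Suc a)" using m0[of a] by (auto simp: U_def M0 i' split: if_splits)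
    next
      fix v assume "v \<in> U 1"
      then show "m N v \<in> U N" using m0[of N] c i by (auto simp: U_def)
    qed
    moreover have "defect U = 0" using i by (auto simp: defect_def U_def)
    ultimately have "U i = {0}" using neg[of U i] i' by force
    then have "\<And>v. v \<in> M i \<Longrightarrow> m i v = 0 \<Longrightarrow> v = 0" by (auto simp: U_def)
    then show ?thesis
      using subspace_diff[OF subspace_M[OF i'(1)]] by (intro inj_onI) (metis l.diff right_minus_eq)
  qed
  \<comment> \<open>\<open>\<theta> i\<close> is the composite of the arrows from \<open>i\<close>
    to \<open>N\<close>; \<open>\<theta>d d\<close> is the one that starts at
    \<open>N - d\<close>.\<close>
  define \<theta>d where "\<theta>d = rec_nat id (\<lambda>d f. f \<circ> m (N - Suc d))"
  define \<theta> where "\<theta> i = \<theta>d (N - i)" for i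
  have \<theta>_N: "\<theta> N = id" by (simp add: \<theta>_def \<theta>d_def)
  have \<theta>_i: "\<theta> i = \<theta> (Suc i) \<circ> m i" if "i \<in> {2..<N}" for i
  proof -
    have "N - i = Suc (N - Suc i)" "N - Suc (N - Suc i) = i" using that by auto
    moreover have "\<theta>d (Suc d) = \<theta>d d \<circ> m (N - Suc d)" for d by (simp add: \<theta>d_def)
    ultimately show ?thesis by (metis \<theta>_def)
  qed
  have \<theta>: "Vector_Spaces.linear scale scale (\<theta> i) \<and> inj_on (\<theta> i) (M i) \<and> \<theta> i ` M i \<subseteq> M N"
    if "2 \<le> i" "i \<le> N" for i
    using that(2,1)
  proof (induction i rule: inc_induct)
    case base
    show ?case unfolding \<theta>_N by (intro conjI linear_id inj_on_id) simp
  next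
    case (step i)
    then have i: "i \<in> {2..<N}" "i \<in> {1..N}" "i \<in> {1..<N}" by auto
    have im: "m i ` M i \<subseteq> M (Suc i)" using m_step[OF i(3)] by blast
    have IH: "Vector_Spaces.linear scale scale (\<theta> (Suc i))" "inj_on (\<theta> (Suc i)) (M (Suc i))"
      "\<theta> (Suc i) ` M (Suc i) \<subseteq> M N" using step.IH step.prems by auto
    show ?case unfolding \<theta>_i[OF i(1)]
    proof (intro conjI)
      show "Vector_Spaces.linear scale scale (\<theta> (Suc i) \<circ> m i)"
        by (rule Vector_Spaces.linear_compose[OF linear_m[OF i(2)] IH(1)])
      show "inj_on (\<theta> (Suc i) \<circ> m i) (M i)"
        by (rule comp_inj_on[OF inj_step[OF i(1)] inj_on_subset[OF IH(2) im]])
      show "(\<theta> (Suc i) \<circ> m i) ` M i \<subseteq> M N" using im IH(3) by auto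
    qed
  qed
  have \<theta>2: "Vector_Spaces.linear scale scale (\<theta> 2)" "\<theta> 2 ` M 2 \<subseteq> M N" using \<theta>[of 2] N by auto
  interpret m1: Vector_Spaces.linear scale scale "m 1" by (rule linear_m[OF c(1)])
  interpret mN: Vector_Spaces.linear scale scale "m N" by (rule linear_m[OF c(3)])
  define p where "p = \<theta> 2 \<circ> m 1"
  have lin_p: "Vector_Spaces.linear scale scale p"
    unfolding p_def by (rule Vector_Spaces.linear_compose[OF linear_m[OF c(1)] \<theta>2(1)])
  have m1M: "m 1 v \<in> M 2" if "v \<in> M 1" for v using m_step[of 1 v] that N by (simp add: numeral_2_eq_2)
  have pM: "p v \<in> M N" if "v \<in> M 1" for v using \<theta>2(2) m1M[OF that] by (auto simp: p_def)
  \<comment> \<open>The test subrepresentation has \<open>S\<close> at vertex \<open>1\<close> and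
    the preimage of \<open>T\<close> under \<open>\<theta> i\<close> at the others, hence
    \<open>T\<close> itself at \<open>N\<close>.\<close>
  have key: "S = {0}" if S: "subspace S" "S \<subseteq> M 1" and T: "subspace T" "T \<subseteq> M N" "p ` S \<subseteq> T" "m N ` S \<subseteq> T"
      "dim T \<le> dim S" for S T
  proof (rule ccontr)
    assume S0: "S \<noteq> {0}"
    define U where "U i = (if i = 1 then S else {v \<in> M i. \<theta> i v \<in> T})" for i
    have "subrep U" unfolding subrep_def
    proof (intro conjI ballI)
      fix i assume i: "i \<in> {1..N}"
      show "subspace (U i)"
      proof (cases "i = 1")
        case False
        then interpret l: Vector_Spaces.linear scale scale "\<theta> i" using \<theta>[of i] i by auto
        show ?thesis using subspace_inter[OF subspace_M[OF i] l.subspace_linear_preimage[OF T(1)]] False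
          by (simp add: U_def Collect_conj_eq)
      qed (simp add: U_def S)
      show "U i \<subseteq> M i" using S by (auto simp: U_def)
    next
      fix a v assume a: "a \<in> {1..<N}" and v: "v \<in> U a"
      show "m a v \<in> U (Suc a)"
      proof (cases "a = 1")
        case True
        then show ?thesis using v S T m1M by (auto simp: U_def p_def numeral_2_eq_2)
      next
        case False
        then have "a \<in> {2..<N}" using a by auto
        then show ?thesis using v False m_step[OF a] \<theta>_i[of a] by (auto simp: U_def)
      qed
    next
      fix v assume "v \<in> U 1"
      then show "m N v \<in> U N" using S T m_chord N by (auto simp: U_def \<theta>_N)
    qed
    then have "defect U < 0" using neg[of U 1] c S0 by (simp add: U_def)
    moreover have "U N = T" "U 1 = S" using T N by (auto simp: U_def \<theta>_N)
    ultimately show False using T(5) by (simp add: defect_def)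
  qed
  have finM1: "finite (M 1)" using finite_M c by blast
  have dim_im: "dim (f ` S) \<le> dim S" if "subspace S" "S \<subseteq> M 1" "Vector_Spaces.linear scale scale f" for S f
    using dim_image_kernel[OF finite_scalars _ that(1,3)] finite_subset[OF that(2) finM1] by linarith
  have inj_N: "inj_on (m N) (M 1)"
  proof -
    have s: "subspace {v \<in> M 1. m N v = 0}"
      using subspace_inter[OF subspace_M[OF c(1)] mN.subspace_kernel] by (simp add: Collect_conj_eq)
    interpret lp: Vector_Spaces.linear scale scale p by (rule lin_p)
    have sp: "subspace (p ` {v \<in> M 1. m N v = 0})" using lp.subspace_image[OF s] .
    \<comment> \<open>\<open>T\<close> is the image under \<open>p\<close> of the kernel of the
      chord; the chord sends that kernel to 0 and adds nothing to \<open>T\<close>.\<close>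
    have "{v \<in> M 1. m N v = 0} = {0}"
      by (rule key[OF s _ sp]) (use pM subspace_0[OF sp] dim_im[OF s _ lin_p] in auto)
    then have "\<And>v. v \<in> M 1 \<Longrightarrow> m N v = 0 \<Longrightarrow> v = 0" by auto
    then show ?thesis
      using subspace_diff[OF subspace_M[OF c(1)]] by (intro inj_onI) (metis mN.diff right_minus_eq)
  qed
  interpret pr: vector_space_pair scale scale by unfold_locales
  \<comment> \<open>A left inverse of the chord condenses the two maps \<open>p\<close> and
    \<open>m N\<close> from \<open>M 1\<close> to \<open>M N\<close> into one map \<open>b\<close>
    on the image \<open>V\<close> of the chord.\<close>
  obtain g where g: "Vector_Spaces.linear scale scale g" "\<And>v. v \<in> M 1 \<Longrightarrow> g (m N v) = v"
    using pr.linear_exists_left_inverse_on[OF linear_m[OF c(3)] subspace_M[OF c(1)] inj_N] by blast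
  define b where "b = p \<circ> g"
  have lin_b: "Vector_Spaces.linear scale scale b"
    unfolding b_def by (rule Vector_Spaces.linear_compose[OF g(1) lin_p])
  have b: "b (m N v) = p v" if "v \<in> M 1" for v using g(2)[OF that] by (simp add: b_def)
  define V where "V = m N ` M 1"
  have V: "subspace V" "V \<subseteq> M N" "dim V = l"
    using mN.subspace_image[OF subspace_M[OF c(1)]] m_chord
      dim_inj_image[OF finite_scalars finM1 subspace_M[OF c(1)] linear_m[OF c(3)] inj_N] dim_1 by (auto simp: V_def)
  have bV: "b v \<in> M N" if "v \<in> V" for v using that b pM by (auto simp: V_def)
  have noinv: "S = {0}" if S: "subspace S" "S \<subseteq> V" "b ` S \<subseteq> S" for S
  proof -
    let ?S = "{v \<in> M 1. m N v \<in> S}"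
    have im: "m N ` ?S = S" using S(2) by (auto simp: V_def)
    have sub: "subspace ?S"
      using subspace_inter[OF subspace_M[OF c(1)] mN.subspace_linear_preimage[OF S(1)]] by (simp add: Collect_conj_eq)
    have "?S = {0}"
    proof (rule key[OF sub _ S(1)])
      show "p ` ?S \<subseteq> S" using S(3) b by force
      show "dim S \<le> dim ?S" using dim_im[OF sub _ linear_m[OF c(3)]] im by auto
    qed (use S V in auto)
    then show ?thesis using im mN.zero by auto
  qed
  \<comment> \<open>Transport into the space at \<open>N\<close>, along the chord from vertex
    \<open>1\<close> and along the path from the others. It carries subrepresentations to nested
    flags without changing dimensions.\<close>
  define \<tau> where "\<tau> i = (if i = 1 then m N else \<theta> i)" for i
  define Wi where "Wi i = (if i = 1 then V else M N)" for i :: nat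
  have lin_\<tau>: "Vector_Spaces.linear scale scale (\<tau> i)" and inj_\<tau>: "inj_on (\<tau> i) (M i)"
    and im_\<tau>: "\<tau> i ` M i = Wi i" if i: "i \<in> {1..N}" for i
  proof -
    show l: "Vector_Spaces.linear scale scale (\<tau> i)" using \<theta>[of i] linear_m[OF c(3)] i by (auto simp: \<tau>_def)
    show inj: "inj_on (\<tau> i) (M i)" using \<theta>[of i] inj_N i by (auto simp: \<tau>_def)
    interpret l: Vector_Spaces.linear scale scale "\<tau> i" by (rule l)
    show "\<tau> i ` M i = Wi i"
    proof (cases "i = 1")
      case False
      then have i2: "i \<in> {2..N}" using i by auto
      have "\<theta> i ` M i = M N"
      proof (rule subspace_eq_if_dim[OF finite_scalars finite_M[OF c(3)] _ subspace_M[OF c(3)]])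
        show "subspace (\<theta> i ` M i)" using l.subspace_image[OF subspace_M[OF i]] False by (simp add: \<tau>_def)
        show "dim (M N) \<le> dim (\<theta> i ` M i)"
          using dim_inj_image[OF finite_scalars finite_M[OF i] subspace_M[OF i] l inj] dim_i[OF i2] dim_i[OF c(5)] False
          by (simp add: \<tau>_def)
      qed (use \<theta>[of i] i2 in auto)
      then show ?thesis using False by (simp add: \<tau>_def Wi_def)
    qed (simp add: \<tau>_def Wi_def V_def)
  qed
  have \<tau>_step: "\<tau> (Suc i) (m i v) = \<tau> i v" if "i \<in> {2..<N}" for i v
    using \<theta>_i[OF that] that by (auto simp: \<tau>_def)
  have \<tau>_1: "\<tau> 2 (m 1 v) = b (\<tau> 1 v)" if "v \<in> M 1" for v
    using b[OF that] by (simp add: \<tau>_def p_def)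
  have \<tau>_N: "\<tau> N v = v" for v using N by (simp add: \<tau>_def \<theta>_N)
  have "card {U \<in> extensional {1..N}. subrep U \<and> (\<forall>i\<in>{1..N}. dim (U i) = e i)} = card (nested_flags N V (M N) b e)"
    (is "card ?A = card ?B") for e
  proof -
    define F where "F U = restrict (\<lambda>i. \<tau> i ` U i) {1..N}" for U
    define G where "G U = restrict (\<lambda>i. {v \<in> M i. \<tau> i v \<in> U i}) {1..N}" for U
    have GU: "{v \<in> M i. \<tau> i v \<in> \<tau> i ` S} = S" if i: "i \<in> {1..N}" and S: "S \<subseteq> M i" for i S
    proof
      show "{v \<in> M i. \<tau> i v \<in> \<tau> i ` S} \<subseteq> S"
      proof
        fix v assume "v \<in> {v \<in> M i. \<tau> i v \<in> \<tau> i ` S}"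
        then obtain w where "v \<in> M i" "w \<in> S" "\<tau> i v = \<tau> i w" by auto
        then show "v \<in> S" using inj_onD[OF inj_\<tau>[OF i]] S by (metis subsetD)
      qed
    qed (use S in auto)
    have FU: "\<tau> i ` {v \<in> M i. \<tau> i v \<in> S} = S" if "i \<in> {1..N}" "S \<subseteq> Wi i" for i S
    proof
      show "S \<subseteq> \<tau> i ` {v \<in> M i. \<tau> i v \<in> S}"
      proof
        fix s assume s: "s \<in> S"
        then have "s \<in> \<tau> i ` M i" using that(2) im_\<tau>[OF that(1)] by blast
        then show "s \<in> \<tau> i ` {v \<in> M i. \<tau> i v \<in> S}" using s by blast
      qed
    qed auto
    have "bij_betw F ?A ?B"
    proof (rule bij_betw_byWitness[where f' = G])
      show "\<forall>U\<in>?A. G (F U) = U"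
      proof
        fix U assume U: "U \<in> ?A"
        show "G (F U) = U"
        proof (rule extensionalityI[of _ "{1..N}"])
          fix i assume i: "i \<in> {1..N}"
          show "G (F U) i = U i" using U GU[OF i subrepD(2)[OF _ i]] i by (simp add: F_def G_def)
        qed (use U in \<open>auto simp: G_def\<close>)
      qed
      have Wi: "U i \<subseteq> Wi i" if "U \<in> ?B" "i \<in> {1..N}" for U i
        using that by (auto simp: nested_flags_def Wi_def)
      show "\<forall>U\<in>?B. F (G U) = U"
      proof
        fix U assume U: "U \<in> ?B"
        show "F (G U) = U"
        proof (rule extensionalityI[of _ "{1..N}"])
          fix i assume i: "i \<in> {1..N}"
          show "F (G U) i = U i" using FU[OF i Wi[OF U i]] i by (simp add: F_def G_def)
        qed (use U in \<open>auto simp: F_def nested_flags_def\<close>)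
      qed
      show "F ` ?A \<subseteq> ?B"
      proof
        fix U' assume "U' \<in> F ` ?A"
        then obtain U where U: "U \<in> ?A" "U' = F U" by auto
        then have s: "subrep U" and d: "\<And>i. i \<in> {1..N} \<Longrightarrow> dim (U i) = e i" by auto
        have U'i: "U' i = \<tau> i ` U i" if "i \<in> {1..N}" for i using that U by (simp add: F_def)
        have 1: "subspace (U' i) \<and> dim (U' i) = e i" if i: "i \<in> {1..N}" for i
        proof -
          interpret l: Vector_Spaces.linear scale scale "\<tau> i" by (rule lin_\<tau>[OF i])
          show ?thesis
            using l.subspace_image[OF subrepD(1)[OF s i]] d[OF i]
              dim_inj_image[OF finite_scalars subrepD(3)[OF s i] subrepD(1)[OF s i] lin_\<tau>[OF i]
                inj_on_subset[OF inj_\<tau>[OF i] subrepD(2)[OF s i]]]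
            by (simp add: U'i[OF i])
        qed
        have 2: "U' i \<subseteq> Wi i" if i: "i \<in> {1..N}" for i
          using subrepD(2)[OF s i] im_\<tau>[OF i] U'i[OF i] by blast
        have 3: "U' i \<subseteq> U' (Suc i)" if i: "i \<in> {2..<N}" for i
        proof -
          have i': "i \<in> {1..N}" "Suc i \<in> {1..N}" "i \<in> {1..<N}" using i by auto
          show ?thesis unfolding U'i[OF i'(1)] U'i[OF i'(2)]
            using \<tau>_step[OF i] subrepD(4)[OF s i'(3)] by (metis image_subset_iff image_eqI)
        qed
        have 4: "b ` U' 1 \<subseteq> U' 2" unfolding U'i[OF c(1)] U'i[OF c(2)]
        proof clarify
          fix v assume v: "v \<in> U 1"
          then have "m 1 v \<in> U 2" using subrepD(4)[OF s, of 1 v] N by (simp add: numeral_2_eq_2)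
          then show "b (\<tau> 1 v) \<in> \<tau> 2 ` U 2" using \<tau>_1[of v] subrepD(2)[OF s c(1)] v by (metis image_eqI subsetD)
        qed
        have 5: "U' 1 \<subseteq> U' N" unfolding U'i[OF c(1)] U'i[OF c(3)] \<tau>_N
          using subrepD(5)[OF s] by (auto simp: \<tau>_def)
        have "U' \<in> extensional {1..N}" using U by (simp add: F_def)
        moreover have "U' 1 \<subseteq> V" using 2[OF c(1)] by (simp add: Wi_def)
        moreover have "\<forall>i\<in>{2..N}. U' i \<subseteq> M N"
        proof
          fix i assume "i \<in> {2..N}"
          then have "i \<in> {1..N}" "i \<noteq> 1" by auto
          then show "U' i \<subseteq> M N" using 2[of i] by (simp add: Wi_def)
        qed
        moreover have "\<forall>i\<in>{1..N}. subspace (U' i) \<and> dim (U' i) = e i" using 1 by blast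
        moreover have "\<forall>i\<in>{2..<N}. U' i \<subseteq> U' (Suc i)" using 3 by blast
        ultimately show "U' \<in> ?B" unfolding nested_flags_def using 4 5 by (intro CollectI conjI)
      qed
      show "G ` ?B \<subseteq> ?A"
      proof
        fix U' assume "U' \<in> G ` ?B"
        then obtain U where U: "U \<in> ?B" "U' = G U" by auto
        have U'i: "U' i = {v \<in> M i. \<tau> i v \<in> U i}" if "i \<in> {1..N}" for i using that U by (simp add: G_def)
        have sU: "subspace (U i)" and dU: "dim (U i) = e i" if "i \<in> {1..N}" for i
          using U that by (auto simp: nested_flags_def)
        have sub: "subspace (U' i)" if i: "i \<in> {1..N}" for i
        proof -
          interpret l: Vector_Spaces.linear scale scale "\<tau> i" by (rule lin_\<tau>[OF i])
          show ?thesis unfolding U'i[OF i]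
            using subspace_inter[OF subspace_M[OF i] l.subspace_linear_preimage[OF sU[OF i]]] by (simp add: Collect_conj_eq)
        qed
        have dims: "dim (U' i) = e i" if i: "i \<in> {1..N}" for i
        proof -
          have sb: "U' i \<subseteq> M i" using U'i[OF i] by auto
          have "dim (\<tau> i ` U' i) = dim (U' i)"
            using dim_inj_image[OF finite_scalars finite_subset[OF sb finite_M[OF i]] sub[OF i] lin_\<tau>[OF i]
                inj_on_subset[OF inj_\<tau>[OF i] sb]] .
          moreover have "\<tau> i ` U' i = U i" unfolding U'i[OF i] by (rule FU[OF i Wi[OF U(1) i]])
          ultimately show ?thesis using dU[OF i] by simp
        qed
        have "subrep U'" unfolding subrep_def
        proof (intro conjI ballI)
          fix i assume i: "i \<in> {1..N}"
          then show "subspace (U' i)" "U' i \<subseteq> M i" using sub U'i by auto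
        next
          fix a v assume a: "a \<in> {1..<N}" and v: "v \<in> U' a"
          have a': "a \<in> {1..N}" "Suc a \<in> {1..N}" using a by auto
          have va: "v \<in> M a" "\<tau> a v \<in> U a" using v U'i[OF a'(1)] by auto
          have "\<tau> (Suc a) (m a v) \<in> U (Suc a)"
          proof (cases "a = 1")
            case True
            then show ?thesis using va \<tau>_1[of v] U(1) by (auto simp: nested_flags_def numeral_2_eq_2)
          next
            case False
            then have a2: "a \<in> {2..<N}" using a by auto
            then have "U a \<subseteq> U (Suc a)" using U(1) by (simp add: nested_flags_def)
            then show ?thesis using va \<tau>_step[OF a2] by auto
          qed
          then show "m a v \<in> U' (Suc a)" using U'i[OF a'(2)] m_step[OF a va(1)] by simp
        next
          fix v assume v: "v \<in> U' 1"
          then have va: "v \<in> M 1" "\<tau> 1 v \<in> U 1" using U'i[OF c(1)] by auto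
          have "U 1 \<subseteq> U N" using U(1) by (simp add: nested_flags_def)
          then show "m N v \<in> U' N" using U'i[OF c(3)] m_chord[OF va(1)] va(2) by (auto simp: \<tau>_N) (auto simp: \<tau>_def)
        qed
        then show "U' \<in> ?A" using dims U by (auto simp: G_def)
      qed
    qed
    then show ?thesis by (rule bij_betw_same_card)
  qed
  then show ?thesis using that[OF V lin_b bV noinv] by blast
qed

end

section \<open>Counting nested flags\<close>

text \<open>The index is one more than the dimension of \<open>W\<close>, thus \<open>l + 2\<close>
  for M_1(l); \<open>0\<close> and \<open>Suc 0\<close> both stand for the zero configuration. The
  three summands count the flags inside the hyperplane, those that leave it from some vertex
  \<open>j \<ge> 2\<close> on, and those that leave it at every vertex. \<open>Q\<close> is the size
  of the field.\<close>

fun flag_count :: "nat \<Rightarrow> real \<Rightarrow> nat \<Rightarrow> (nat \<Rightarrow> nat) \<Rightarrow> real" where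
  "flag_count N Q 0 e = (if \<forall>i\<in>{1..N}. e i = 0 then 1 else 0)"
| "flag_count N Q (Suc 0) e = (if \<forall>i\<in>{1..N}. e i = 0 then 1 else 0)"
| "flag_count N Q (Suc (Suc k)) e = flag_count N Q (Suc k) e +
     (\<Sum>j\<in>{2..N}. if \<forall>i\<in>{j..N}. 1 \<le> e i
        then Q powi (int (Suc k) - int (e j)) * flag_count N Q (Suc k) (\<lambda>i. e i - (if i \<in> {j..N} then 1 else 0)) else 0) +
     (if \<forall>i\<in>{1..N}. 1 \<le> e i
        then Q powi (int (e N) - int (e 1) - 1) *
          (flag_count N Q (Suc k) (\<lambda>i. e i - (if i \<in> {1..N} then 1 else 0)) -
           flag_count N Q k (\<lambda>i. e i - (if i \<in> {1..N} then 1 else 0))) else 0)"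

lemma card_eq_sum_fibres:
  assumes "finite A" "finite B" "f ` A \<subseteq> B"
  shows "card A = (\<Sum>y\<in>B. card {x \<in> A. f x = y})"
  using sum.group[OF assms, of "\<lambda>_. 1::nat"] by simp

context vector_space begin

lemma dim_span_insert:
  assumes fin: "finite (UNIV :: 'a set)" and "finite S" "subspace S" "u \<notin> S"
  shows "dim (span (insert u S)) = Suc (dim S)"
proof -
  obtain B where B: "B \<subseteq> S" "independent B" "S \<subseteq> span B" "card B = dim S"
    using basis_exists by blast
  have sB: "span B = S" using B assms(3) span_minimal by blast
  then have ind: "independent (insert u B)" using B(2) assms(4) independent_insertI by blast
  have "span (insert u B) = span (insert u S)"
  proof -
    have "span S = S" using assms(3) by simp
    then show ?thesis by (simp only: span_insert sB)
  qed
  then have "dim (span (insert u S)) = card (insert u B)"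
    using dim_eq_card[of "insert u B"] ind by (metis span_span)
  moreover have "u \<notin> B" "finite B" using B assms(2,4) finite_subset by auto
  ultimately show ?thesis using B(4) by simp
qed

text \<open>A space that is not contained in the hyperplane \<open>V\<close> is its intersection
  with \<open>V\<close> plus any one vector outside \<open>V\<close>. Hence one known subspace
  \<open>T\<close> outside \<open>V\<close> determines it; in the flag counts \<open>T\<close> is
  \<open>U j\<close> or the image of \<open>U 1\<close> under \<open>b\<close>.\<close>

lemma hyperplane_extension:
  assumes fin: "finite (UNIV :: 'a set)" and W: "finite W" "subspace W" and V: "subspace V" "V \<subseteq> W" "dim W = Suc (dim V)"
    and A: "subspace A" "A \<subseteq> V" and T: "subspace T" "T \<subseteq> W" "T \<inter> V \<subseteq> A" "\<not> T \<subseteq> V"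
  defines "E \<equiv> {x + t |x t. x \<in> A \<and> t \<in> T}"
  shows "subspace E" "E \<subseteq> W" "E \<inter> V = A" "E \<noteq> A" "dim E = Suc (dim A)" "A \<subseteq> E" "T \<subseteq> E"
    and "\<And>U. subspace U \<Longrightarrow> U \<subseteq> W \<Longrightarrow> U \<inter> V = A \<Longrightarrow> T \<subseteq> U \<Longrightarrow> U = E"
proof -
  show sE: "subspace E" unfolding E_def by (rule subspace_sums[OF A(1) T(1)])
  show EW: "E \<subseteq> W" unfolding E_def using A V T subspace_add[OF W(2)] by blast
  show AE: "A \<subseteq> E"
  proof
    fix x assume "x \<in> A"
    then have "x + 0 \<in> E" unfolding E_def using subspace_0[OF T(1)] by blast
    then show "x \<in> E" by simp
  qed
  show TE: "T \<subseteq> E"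
  proof
    fix x assume "x \<in> T"
    then have "0 + x \<in> E" unfolding E_def using subspace_0[OF A(1)] by blast
    then show "x \<in> E" by simp
  qed
  show EV: "E \<inter> V = A"
  proof
    show "E \<inter> V \<subseteq> A"
    proof
      fix y assume y: "y \<in> E \<inter> V"
      then obtain x t where xt: "y = x + t" "x \<in> A" "t \<in> T" unfolding E_def by blast
      have "(x + t) - x \<in> V" using y xt A subspace_diff[OF V(1)] by blast
      then have "t \<in> A" using T(3) xt(3) by auto
      then show "y \<in> A" using xt subspace_add[OF A(1)] by simp
    qed
  qed (use AE A in auto)
  show EA: "E \<noteq> A" using TE T A by blast
  note hyp = card_hyperplane_complements(2)[OF fin W V A]
  show dE: "dim E = Suc (dim A)" by (rule hyp[OF sE EW EV EA])
  fix U assume U: "subspace U" "U \<subseteq> W" "U \<inter> V = A" "T \<subseteq> U"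
  have "U \<noteq> A" using U T A by blast
  then have dU: "dim U = Suc (dim A)" by (rule hyp[OF U(1-3)])
  have "E \<subseteq> U" unfolding E_def using U subspace_add[OF U(1)] by blast
  then have "E = U"
    using dU dE by (intro subspace_eq_if_dim[OF fin finite_subset[OF U(2) W(1)] sE U(1)]) auto
  then show "U = E" by simp
qed

lemma finite_nested_flags: "finite W \<Longrightarrow> V \<subseteq> W \<Longrightarrow> N \<ge> 1 \<Longrightarrow> finite (nested_flags N V W b e)"
proof -
  assume "finite W" "V \<subseteq> W" "N \<ge> 1"
  have "U i \<subseteq> W" if "U \<in> nested_flags N V W b e" "i \<in> {1..N}" for U i
    using that \<open>V \<subseteq> W\<close> by (cases "i = 1") (auto simp: nested_flags_def)
  moreover have "U \<in> extensional {1..N}" if "U \<in> nested_flags N V W b e" for U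
    using that by (simp add: nested_flags_def)
  ultimately have "nested_flags N V W b e \<subseteq> PiE {1..N} (\<lambda>_. Pow W)"
    by (intro subsetI PiE_I) (auto simp: extensional_def)
  then show ?thesis using finite_PiE[of "{1..N}" "\<lambda>_. Pow W"] \<open>finite W\<close> finite_subset by blast
qed

lemma nested_flagsD:
  assumes "U \<in> nested_flags N V W b e"
  shows "U \<in> extensional {1..N}" "i \<in> {1..N} \<Longrightarrow> subspace (U i)" "i \<in> {1..N} \<Longrightarrow> dim (U i) = e i"
    "U 1 \<subseteq> V" "i \<in> {2..N} \<Longrightarrow> U i \<subseteq> W" "i \<in> {2..<N} \<Longrightarrow> U i \<subseteq> U (Suc i)" "b ` U 1 \<subseteq> U 2" "U 1 \<subseteq> U N"
  using assms unfolding nested_flags_def by simp_all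

lemma nested_flagsI:
  assumes "U \<in> extensional {1..N}" "\<And>i. i \<in> {1..N} \<Longrightarrow> subspace (U i) \<and> dim (U i) = e i"
    "U 1 \<subseteq> V" "\<And>i. i \<in> {2..N} \<Longrightarrow> U i \<subseteq> W" "\<And>i. i \<in> {2..<N} \<Longrightarrow> U i \<subseteq> U (Suc i)" "b ` U 1 \<subseteq> U 2" "U 1 \<subseteq> U N"
  shows "U \<in> nested_flags N V W b e"
  unfolding nested_flags_def using assms(1,3,6,7) by (intro CollectI conjI ballI assms(2,4,5)) (use assms(2) in auto)

lemma nested_flags_mono:
  assumes "U \<in> nested_flags N V W b e" "i \<in> {2..N}" "j \<in> {i..N}"
  shows "U i \<subseteq> U j"
proof -
  have "i \<le> j" "j \<le> N" using assms by auto
  then show ?thesis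
  proof (induction j rule: dec_induct)
    case (step k)
    then have "U k \<subseteq> U (Suc k)" using nested_flagsD(6)[OF assms(1), of k] assms(2) by auto
    then show ?case using step by auto
  qed simp
qed

end

text \<open>\<open>V' = {v \<in> V. b v \<in> V}\<close> is a hyperplane of \<open>V\<close>. A flag \<open>U\<close> restricts to the flag \<open>U' i = U i \<inter> H i\<close> of the
  smaller configuration, where \<open>H 1 = V'\<close> and \<open>H i = V\<close> otherwise. The dimension drops by one exactly at the
  indices \<open>i \<ge> j\<close> for some \<open>j\<close>, and the flags with given \<open>U'\<close> and \<open>j \<le> N\<close> are parametrized by \<open>U j\<close>.\<close>

locale flag_configuration = vector_space scale
  for scale :: "'a::field \<Rightarrow> 'b::ab_group_add \<Rightarrow> 'b" (infixr "*s" 75) +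
  fixes N :: nat and V W :: "'b set" and b :: "'b \<Rightarrow> 'b"
  assumes finite_scalars: "finite (UNIV :: 'a set)"
    and N: "N \<ge> 3"
    and linear_b: "Vector_Spaces.linear scale scale b"
    and V: "subspace V" "V \<subseteq> W" "dim W = Suc (dim V)"
    and W: "finite W" "subspace W"
    and b_V: "\<And>v. v \<in> V \<Longrightarrow> b v \<in> W"
    and no_invariant: "\<And>S. subspace S \<Longrightarrow> S \<subseteq> V \<Longrightarrow> b ` S \<subseteq> S \<Longrightarrow> S = {0}"
begin

section \<open>Restriction of flags to the hyperplane, and its fibres\<close>

sublocale b: Vector_Spaces.linear scale scale b by (rule linear_b)

definition V' where "V' = {v \<in> V. b v \<in> V}"
text \<open>The space \<open>V'\<close> of the smaller configuration, in which \<open>V'\<close> and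
  \<open>V\<close> replace \<open>V\<close> and \<open>W\<close>.\<close>

definition V'' where "V'' = {v \<in> V'. b v \<in> V'}"

lemma subspace_V': "subspace V'" "V' \<subseteq> V" "finite V"
  unfolding V'_def using subspace_inter[OF V(1) b.subspace_linear_preimage[OF V(1)]] V(2) W(1) finite_subset
  by (auto simp: Collect_conj_eq)

text \<open>\<open>V\<close> is not invariant, so \<open>b u\<close> lies outside \<open>V\<close>
  for some \<open>u\<close> in \<open>V\<close> and spans \<open>W\<close> modulo \<open>V\<close>.
  Every vector of \<open>V\<close> is therefore moved into \<open>V'\<close> by subtracting a
  multiple of \<open>u\<close>.\<close>

lemma dim_V': "V \<noteq> {0} \<Longrightarrow> dim V = Suc (dim V')"
proof -
  assume "V \<noteq> {0}"
  then obtain u where u: "u \<in> V" "b u \<notin> V" using no_invariant[of V] V(1) by blast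
  then have uV': "u \<notin> V'" by (simp add: V'_def)
  have "span (insert (b u) V) = W"
  proof (rule subspace_eq_if_dim[OF finite_scalars W(1) subspace_span W(2)])
    show "span (insert (b u) V) \<subseteq> W" using u b_V V W by (intro span_minimal) auto
    show "dim W \<le> dim (span (insert (b u) V))"
      using dim_span_insert[OF finite_scalars subspace_V'(3) V(1) u(2)] V(3) by simp
  qed
  have span_V: "span V = V" "span V' = V'" using V(1) subspace_V'(1) by simp_all
  have ex: "\<exists>k. v - k *s u \<in> V'" if "v \<in> V" for v
  proof -
    have "b v \<in> span (insert (b u) V)" using b_V[OF that] \<open>span (insert (b u) V) = W\<close> by simp
    then obtain k where "b v - k *s b u \<in> V" unfolding span_insert span_V by blast
    then have "b (v - k *s u) \<in> V" by (simp add: b.diff b.scale)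
    moreover have "v - k *s u \<in> V" using that u V(1) subspace_diff subspace_scale by blast
    ultimately show ?thesis by (auto simp: V'_def)
  qed
  have "span (insert u V') = V"
  proof
    show "span (insert u V') \<subseteq> V" using u subspace_V' V by (intro span_minimal) auto
    show "V \<subseteq> span (insert u V')" unfolding span_insert span_V using ex by blast
  qed
  then show ?thesis
    using dim_span_insert[OF finite_scalars _ subspace_V'(1) uV'] subspace_V' finite_subset by metis
qed

abbreviation "Fl \<equiv> nested_flags N V W b"
abbreviation "Fl' \<equiv> nested_flags N V' V b"
abbreviation "Fl'' \<equiv> nested_flags N V'' V' b"

definition H :: "nat \<Rightarrow> 'b set" where "H i = (if i = 1 then V' else V)"
definition res :: "(nat \<Rightarrow> 'b set) \<Rightarrow> nat \<Rightarrow> 'b set" where "res U = restrict (\<lambda>i. U i \<inter> H i) {1..N}"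
definition lower :: "(nat \<Rightarrow> nat) \<Rightarrow> nat \<Rightarrow> nat \<Rightarrow> nat" where "lower e j = (\<lambda>i. e i - (if i \<in> {j..N} then 1 else 0))"
text \<open>\<open>j\<close> is the first vertex at which the flag leaves \<open>H\<close>; the
  value \<open>Suc N\<close> stands for flags that never do.\<close>

definition piece :: "(nat \<Rightarrow> nat) \<Rightarrow> nat \<Rightarrow> (nat \<Rightarrow> 'b set) set" where
  "piece e j = {U \<in> Fl e. \<forall>i\<in>{1..N}. U i \<subseteq> H i \<longleftrightarrow> i < j}"

lemma index_mem: "1 \<in> {1..N}" "2 \<in> {1..N}" "N \<in> {1..N}" "2 \<in> {2..N}" "N \<in> {2..N}" using N by auto

lemma H_eq: "i \<in> {2..N} \<Longrightarrow> H i = V" "H 1 = V'" by (auto simp: H_def)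

text \<open>Leaving \<open>H\<close> propagates along the arrows: from \<open>1\<close> to
  \<open>2\<close> because \<open>b\<close> sends a vector of \<open>V\<close> outside
  \<open>V'\<close> to one outside \<open>V\<close>, and from there on because the flag increases.
  So the vertices in question form a final segment, and the pieces exhaust the flags.\<close>

lemma card_Fl: "card (Fl e) = (\<Sum>j\<in>{1..Suc N}. card (piece e j))"
proof -
  have up: "\<not> U (Suc i) \<subseteq> H (Suc i)" if U: "U \<in> Fl e" and i: "i \<in> {1..<N}" and n: "\<not> U i \<subseteq> H i" for U i
  proof (cases "i = 1")
    case True
    then obtain u where u: "u \<in> U 1" "u \<notin> V'" using n by (auto simp: H_def)
    then have "b u \<notin> V" using nested_flagsD(4)[OF U] by (auto simp: V'_def)
    moreover have "b u \<in> U 2" using nested_flagsD(7)[OF U] u by blast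
    ultimately show ?thesis using True by (auto simp: H_def numeral_2_eq_2)
  next
    case False
    then have "i \<in> {2..<N}" using i by auto
    then show ?thesis using nested_flagsD(6)[OF U] n False by (fastforce simp: H_def)
  qed
  have "\<exists>j\<in>{1..Suc N}. U \<in> piece e j" if U: "U \<in> Fl e" for U
  proof (cases "\<exists>i\<in>{1..N}. \<not> U i \<subseteq> H i")
    case False
    then have "U \<in> piece e (Suc N)" using U by (auto simp: piece_def)
    then show ?thesis by auto
  next
    case True
    define j where "j = (LEAST i. i \<in> {1..N} \<and> \<not> U i \<subseteq> H i)"
    have j: "j \<in> {1..N} \<and> \<not> U j \<subseteq> H j"
      unfolding j_def by (rule LeastI_ex) (use True in auto)
    have less: "U i \<subseteq> H i" if "i \<in> {1..N}" "i < j" for i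
      using not_less_Least[of i "\<lambda>i. i \<in> {1..N} \<and> \<not> U i \<subseteq> H i"] that unfolding j_def by blast
    have ge: "\<not> U i \<subseteq> H i" if "j \<le> i" "i \<le> N" for i
      using that
    proof (induction i rule: dec_induct)
      case base
      then show ?case using j by blast
    next
      case (step i)
      then show ?case using up[OF U, of i] j by auto
    qed
    have "\<forall>i\<in>{1..N}. U i \<subseteq> H i \<longleftrightarrow> i < j"
    proof
      fix i assume "i \<in> {1..N}"
      then show "U i \<subseteq> H i \<longleftrightarrow> i < j" using less[of i] ge[of i] by (cases "i < j") auto
    qed
    then have "U \<in> piece e j" using U by (simp add: piece_def)
    then show ?thesis using j by (auto intro!: bexI[of _ j])
  qed
  then have "Fl e = (\<Union>j\<in>{1..Suc N}. piece e j)" by (auto simp: piece_def)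
  moreover have "piece e j \<inter> piece e k = {}" if "j \<in> {1..Suc N}" "k \<in> {1..Suc N}" "j \<noteq> k" for j k
  proof -
    have *: "piece e j \<inter> piece e k = {}" if "j \<in> {1..Suc N}" "k \<in> {1..Suc N}" "j < k" for j k
    proof -
      have j: "j \<in> {1..N}" using that by auto
      have False if U: "U \<in> piece e j" "U \<in> piece e k" for U
      proof -
        have "U j \<subseteq> H j \<longleftrightarrow> j < j" "U j \<subseteq> H j \<longleftrightarrow> j < k"
          using U j unfolding piece_def by blast+
        then show False using \<open>j < k\<close> by simp
      qed
      then show ?thesis by blast
    qed
    show ?thesis using *[of j k] *[of k j] that by (cases "j < k") auto
  qed
  moreover have "finite (piece e j)" for j
    using finite_nested_flags[OF W(1) V(2), of N b e] N by (auto simp: piece_def)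
  ultimately show ?thesis by (simp add: card_UN_disjoint)
qed

lemma piece_last: "piece e (Suc N) = Fl' e"
proof (intro equalityI subsetI)
  fix U assume "U \<in> piece e (Suc N)"
  then have U: "U \<in> Fl e" and s: "\<And>i. i \<in> {1..N} \<Longrightarrow> U i \<subseteq> H i" by (auto simp: piece_def)
  show "U \<in> Fl' e"
  proof (rule nested_flagsI)
    show "U 1 \<subseteq> V'" using s[OF index_mem(1)] by (simp add: H_def)
    show "U i \<subseteq> V" if "i \<in> {2..N}" for i using s[of i] that H_eq(1)[OF that] by auto
  qed (use nested_flagsD[OF U] in auto)
next
  fix U assume U: "U \<in> Fl' e"
  have "U \<in> Fl e"
  proof (rule nested_flagsI)
    show "U 1 \<subseteq> V" using nested_flagsD(4)[OF U] subspace_V' by auto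
    show "U i \<subseteq> W" if "i \<in> {2..N}" for i using nested_flagsD(5)[OF U that] V by auto
  qed (use nested_flagsD[OF U] in auto)
  moreover have "U i \<subseteq> H i" if "i \<in> {1..N}" for i
    using nested_flagsD(4)[OF U] nested_flagsD(5)[OF U, of i] that by (cases "i = 1") (auto simp: H_def)
  ultimately show "U \<in> piece e (Suc N)" by (auto simp: piece_def)
qed

lemma res_piece:
  assumes U: "U \<in> piece e j" and j: "j \<in> {1..N}"
  shows "res U \<in> Fl' (lower e j)" and "\<And>i. i \<in> {j..N} \<Longrightarrow> 1 \<le> e i"
proof -
  have UF: "U \<in> Fl e" and t: "\<And>i. i \<in> {1..N} \<Longrightarrow> U i \<subseteq> H i \<longleftrightarrow> i < j" using U by (auto simp: piece_def)
  have r: "res U i = U i \<inter> H i" if "i \<in> {1..N}" for i using that by (simp add: res_def)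
  have sH: "subspace (H i)" for i using V subspace_V' by (auto simp: H_def)
  have dim: "dim (U i) = Suc (dim (U i \<inter> H i))" if i: "i \<in> {1..N}" "j \<le> i" for i
  proof -
    have ne: "U i \<noteq> U i \<inter> H i" using t[OF i(1)] i by auto
    show ?thesis
    proof (cases "i = 1")
      case True
      have UV: "U 1 \<subseteq> V" by (rule nested_flagsD(4)[OF UF])
      \<comment> \<open>\<open>V'\<close> is a hyperplane of \<open>V\<close> when \<open>V\<close>
        is nonzero; here \<open>U 1\<close> leaves \<open>V'\<close>, so it is.\<close>
      have "V \<noteq> {0}"
      proof
        assume "V = {0}"
        then show False using ne True UV subspace_0[OF nested_flagsD(2)[OF UF index_mem(1)]] subspace_0[OF sH[of 1]] by auto
      qed
      then show ?thesis
        using card_hyperplane_complements(2)[OF finite_scalars subspace_V'(3) V(1) subspace_V'(1,2) dim_V' _ _ nested_flagsD(2)[OF UF index_mem(1)] UV, of "U 1 \<inter> V'"]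
          subspace_inter[OF nested_flagsD(2)[OF UF index_mem(1)] subspace_V'(1)] ne True by (auto simp: H_def)
    next
      case False
      then have i2: "i \<in> {2..N}" using i by auto
      show ?thesis
        using card_hyperplane_complements(2)[OF finite_scalars W V _ _ nested_flagsD(2)[OF UF i(1)] nested_flagsD(5)[OF UF i2], of "U i \<inter> V"]
          subspace_inter[OF nested_flagsD(2)[OF UF i(1)] V(1)] ne False by (auto simp: H_def)
    qed
  qed
  then show "1 \<le> e i" if "i \<in> {j..N}" for i
    using nested_flagsD(3)[OF UF, of i] that j by fastforce
  show "res U \<in> Fl' (lower e j)"
  proof (rule nested_flagsI)
    show "res U \<in> extensional {1..N}" by (simp add: res_def)
    show "subspace (res U i) \<and> dim (res U i) = lower e j i" if i: "i \<in> {1..N}" for i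
    proof (cases "i < j")
      case True
      then have "res U i = U i" using t[OF i] r[OF i] by auto
      then show ?thesis using nested_flagsD(2,3)[OF UF i] True by (auto simp: lower_def)
    next
      case False
      then show ?thesis using dim[OF i] r[OF i] nested_flagsD(2,3)[OF UF i] subspace_inter[OF _ sH] i by (auto simp: lower_def)
    qed
    show "res U 1 \<subseteq> V'" using r[OF index_mem(1)] by (simp add: H_def)
    show "res U i \<subseteq> V" if "i \<in> {2..N}" for i using r[of i] that H_eq(1)[OF that] by auto
    show "res U i \<subseteq> res U (Suc i)" if i: "i \<in> {2..<N}" for i
      using r[of i] r[of "Suc i"] i H_eq(1)[of i] H_eq(1)[of "Suc i"] nested_flagsD(6)[OF UF i] by auto
    show "b ` res U 1 \<subseteq> res U 2"
      using r[OF index_mem(1)] r[OF index_mem(2)] H_eq(1)[OF index_mem(4)] H_eq(2) nested_flagsD(7)[OF UF] by (auto simp: V'_def)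
    show "res U 1 \<subseteq> res U N"
      using r[OF index_mem(1)] r[OF index_mem(3)] H_eq(1)[OF index_mem(5)] H_eq(2) nested_flagsD(8)[OF UF] subspace_V'(2) by auto
  qed
qed

text \<open>The free choice is \<open>U j\<close>, any space that meets \<open>V\<close> in
  \<open>U' j\<close> and leaves \<open>V\<close>. Below \<open>j\<close> nothing changes, and above
  \<open>j\<close> the flag is forced to be \<open>U' i + U j\<close> by
  \<open>hyperplane_extension\<close>, whose condition holds as \<open>U' j\<close> is contained in
  \<open>U' i\<close>. The exponent is \<open>dim V - dim (U' j)\<close>, and both terms are one
  less than \<open>dim W\<close> and \<open>e j\<close>.\<close>

lemma card_fibre_middle:
  assumes j: "j \<in> {2..N}" and e: "\<And>i. i \<in> {j..N} \<Longrightarrow> 1 \<le> e i" and U': "U' \<in> Fl' (lower e j)"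
  shows "card {U \<in> piece e j. res U = U'} = CARD('a) ^ (dim W - e j)"
proof -
  have j': "j \<in> {1..N}" using j by auto
  note F = nested_flagsD[OF U']
  let ?T = "{T. subspace T \<and> T \<subseteq> W \<and> T \<inter> V = U' j \<and> T \<noteq> U' j}"
  define G where "G T = restrict (\<lambda>i. if i < j then U' i else {x + t |x t. x \<in> U' i \<and> t \<in> T}) {1..N}" for T
  have ext: "T \<inter> V \<subseteq> U' i" "\<not> T \<subseteq> V" if T: "T \<in> ?T" and i: "i \<in> {j..N}" for T i
    using T nested_flags_mono[OF U' j i] by auto
  have U'V: "U' i \<subseteq> V" if "i \<in> {1..N}" for i
    using F(4) F(5)[of i] subspace_V'(2) that by (cases "i = 1") auto
  note HE = hyperplane_extension[OF finite_scalars W V F(2) U'V]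
  have "bij_betw (\<lambda>U. U j) {U \<in> piece e j. res U = U'} ?T"
  proof (rule bij_betw_byWitness[where f' = G])
    show "\<forall>U\<in>{U \<in> piece e j. res U = U'}. G (U j) = U"
    proof
      fix U assume U: "U \<in> {U \<in> piece e j. res U = U'}"
      then have UF: "U \<in> Fl e" and t: "\<And>i. i \<in> {1..N} \<Longrightarrow> U i \<subseteq> H i \<longleftrightarrow> i < j" and r: "res U = U'"
        by (auto simp: piece_def)
      have ri: "U' i = U i \<inter> H i" if "i \<in> {1..N}" for i using r that by (auto simp: res_def)
      show "G (U j) = U"
      proof (rule extensionalityI[of _ "{1..N}"])
        fix i assume i: "i \<in> {1..N}"
        show "G (U j) i = U i"
        proof (cases "i < j")
          case True
          then show ?thesis using i t[OF i] ri[OF i] by (auto simp: G_def)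
        next
          case False
          then have i2: "i \<in> {2..N}" "i \<in> {j..N}" using i j by auto
          have mono: "U j \<subseteq> U i" by (rule nested_flags_mono[OF UF j i2(2)])
          have "U i = {x + t |x t. x \<in> U' i \<and> t \<in> U j}"
          proof (rule HE(8)[OF i i])
            show "\<not> U j \<subseteq> V" using t[OF j'] H_eq(1)[OF j] by auto
            show "U j \<inter> V \<subseteq> U' i" using mono ri[OF i] H_eq(1)[OF i2(1)] by auto
            show "U i \<inter> V = U' i" using ri[OF i] H_eq(1)[OF i2(1)] by auto
          qed (use nested_flagsD[OF UF] i i2 j j' mono in auto)
          then show ?thesis using False i by (simp add: G_def)
        qed
      qed (use nested_flagsD(1)[OF UF] in \<open>auto simp: G_def\<close>)
    qed
    show "\<forall>T\<in>?T. G T j = T"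
    proof
      fix T assume T: "T \<in> ?T"
      have "T = {x + t |x t. x \<in> U' j \<and> t \<in> T}"
        by (rule HE(8)[OF j' j']) (use T ext[OF T, of j] j in auto)
      then show "G T j = T" using j' by (simp add: G_def)
    qed
    show "(\<lambda>U. U j) ` {U \<in> piece e j. res U = U'} \<subseteq> ?T"
    proof clarify
      fix U assume U: "U \<in> piece e j" "U' = res U"
      then have UF: "U \<in> Fl e" and t': "\<forall>i\<in>{1..N}. U i \<subseteq> H i \<longleftrightarrow> i < j" by (simp_all add: piece_def)
      have "\<not> U j \<subseteq> V" using bspec[OF t' j'] H_eq(1)[OF j] by simp
      then show "subspace (U j) \<and> U j \<subseteq> W \<and> U j \<inter> V = res U j \<and> U j \<noteq> res U j"
        using nested_flagsD(2)[OF UF j'] nested_flagsD(5)[OF UF j] j' H_eq(1)[OF j] by (auto simp: res_def)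
    qed
    show "G ` ?T \<subseteq> {U \<in> piece e j. res U = U'}"
    proof
      fix U assume "U \<in> G ` ?T"
      then obtain T where T: "T \<in> ?T" "U = G T" by auto
      have T': "subspace T" "T \<subseteq> W" using T by auto
      have Ul: "U i = U' i" if "i \<in> {1..N}" "i < j" for i using that T by (simp add: G_def)
      have Ug: "U i = {x + t |x t. x \<in> U' i \<and> t \<in> T}" if "i \<in> {j..N}" for i using that T j by (auto simp: G_def)
      have P: "subspace (U i)" "U i \<subseteq> W" "U i \<inter> V = U' i" "U i \<noteq> U' i" "dim (U i) = Suc (dim (U' i))" "U' i \<subseteq> U i" "T \<subseteq> U i"
        if i: "i \<in> {j..N}" for i
      proof -
        have i': "i \<in> {1..N}" using i j by auto
        show "subspace (U i)" "U i \<subseteq> W" "U i \<inter> V = U' i" "U i \<noteq> U' i" "dim (U i) = Suc (dim (U' i))" "U' i \<subseteq> U i" "T \<subseteq> U i"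
          unfolding Ug[OF i] using HE(1-7)[OF i' i' T' ext[OF T(1) i]] by auto
      qed
      have sub: "U' i \<subseteq> U i" if "i \<in> {1..N}" for i using Ul[OF that] P(6)[of i] that by (cases "i < j") auto
      have U1: "U 1 = U' 1" using Ul[OF index_mem(1)] j by auto
      have "U \<in> Fl e"
      proof (rule nested_flagsI)
        show "U \<in> extensional {1..N}" using T by (simp add: G_def)
        show "subspace (U i) \<and> dim (U i) = e i" if i: "i \<in> {1..N}" for i
        proof (cases "i < j")
          case True
          then show ?thesis using Ul[OF i] F(2,3)[OF i] by (simp add: lower_def)
        next
          case False
          then have "i \<in> {j..N}" using i by auto
          then show ?thesis using P(1,5) F(3)[OF i] e[of i] by (simp add: lower_def)
        qed
        show "U 1 \<subseteq> V" using U1 U'V[OF index_mem(1)] by simp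
        show "U i \<subseteq> W" if "i \<in> {2..N}" for i
          using P(2)[of i] Ul[of i] F(5)[OF that] V(2) that by (cases "i < j") auto
        show "U i \<subseteq> U (Suc i)" if i: "i \<in> {2..<N}" for i
        proof (cases "i < j")
          case True
          then show ?thesis using Ul[of i] F(6)[OF i] sub[of "Suc i"] i by auto
        next
          case False
          then have "i \<in> {j..N}" "Suc i \<in> {j..N}" using i by auto
          then show ?thesis using Ug[of i] Ug[of "Suc i"] F(6)[OF i] by blast
        qed
        show "b ` U 1 \<subseteq> U 2" using U1 F(7) sub[OF index_mem(2)] by auto
        show "U 1 \<subseteq> U N" using U1 F(8) sub[OF index_mem(3)] by auto
      qed
      moreover have "U i \<subseteq> H i \<longleftrightarrow> i < j" if i: "i \<in> {1..N}" for i
      proof (cases "i < j")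
        case True
        then show ?thesis using Ul[OF i] F(4) F(5)[of i] i by (cases "i = 1") (auto simp: H_def)
      next
        case False
        then have i': "i \<in> {j..N}" "i \<in> {2..N}" using i j by auto
        then show ?thesis using P(3,4)[OF i'(1)] H_eq(1)[OF i'(2)] False by auto
      qed
      moreover have "res U = U'"
      proof (rule extensionalityI[of _ "{1..N}"])
        fix i assume i: "i \<in> {1..N}"
        show "res U i = U' i"
        proof (cases "i < j")
          case True
          then show ?thesis using Ul[OF i] F(4) F(5)[of i] i by (cases "i = 1") (auto simp: H_def res_def)
        next
          case False
          then have i': "i \<in> {j..N}" "i \<in> {2..N}" using i j by auto
          then show ?thesis using P(3)[OF i'(1)] H_eq(1)[OF i'(2)] i by (auto simp: res_def)
        qed
      qed (use F(1) in \<open>auto simp: res_def\<close>)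
      ultimately show "U \<in> {U \<in> piece e j. res U = U'}" by (simp add: piece_def)
    qed
  qed
  then have "card {U \<in> piece e j. res U = U'} = card ?T" by (rule bij_betw_same_card)
  also have "\<dots> = CARD('a) ^ (dim V - dim (U' j))"
    by (rule card_hyperplane_complements(1)[OF finite_scalars W V F(2)[OF j'] U'V[OF j']])
  also have "dim V - dim (U' j) = dim W - e j"
    using F(3)[OF j'] e[of j] j V(3) by (auto simp: lower_def)
  finally show ?thesis .
qed

text \<open>Here \<open>U 1\<close> is the free choice, and \<open>U i\<close> is forced to be the
  sum of \<open>U' i\<close> and the image of \<open>U 1\<close> under \<open>b\<close>. But
  \<open>U 1\<close> lies in \<open>U N\<close> and in \<open>V\<close>, hence in
  \<open>U' N\<close>, so it is chosen inside \<open>U' N\<close> with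
  \<open>U' N \<inter> V'\<close> as the hyperplane; if \<open>U' N\<close> lies in
  \<open>V'\<close> there is no choice at all. The exponent is
  \<open>(e N - 2) - (e 1 - 1)\<close>.\<close>

lemma card_fibre_first:
  assumes e: "\<And>i. i \<in> {1..N} \<Longrightarrow> 1 \<le> e i" and U': "U' \<in> Fl' (lower e 1)"
  shows "real (card {U \<in> piece e 1. res U = U'}) =
    (if U' N \<subseteq> V' then 0 else real CARD('a) powi (int (e N) - int (e 1) - 1))"
proof -
  note F = nested_flagsD[OF U']
  have U'V: "U' i \<subseteq> V" if "i \<in> {1..N}" for i
    using F(4) F(5)[of i] subspace_V'(2) that by (cases "i = 1") auto
  let ?T = "{T. subspace T \<and> T \<subseteq> U' N \<and> T \<inter> (U' N \<inter> V') = U' 1 \<and> T \<noteq> U' 1}"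
  define G where "G T = restrict (\<lambda>i. if i = 1 then T else {x + t |x t. x \<in> U' i \<and> t \<in> b ` T}) {1..N}" for T
  note HE = hyperplane_extension[OF finite_scalars W V F(2) U'V]
  have T_facts: "T \<subseteq> V" "T \<inter> V' = U' 1" "subspace (b ` T)" "b ` T \<subseteq> W" "\<not> b ` T \<subseteq> V" "\<not> T \<subseteq> V'"
    "\<And>i. i \<in> {2..N} \<Longrightarrow> b ` T \<inter> V \<subseteq> U' i" if T: "T \<in> ?T" for T
  proof -
    show TV: "T \<subseteq> V" using T U'V[OF index_mem(3)] by auto
    show TV': "T \<inter> V' = U' 1" using T by auto
    show "subspace (b ` T)" using T b.subspace_image by auto
    show "b ` T \<subseteq> W" using TV b_V by auto
    show n: "\<not> T \<subseteq> V'" using TV' T by auto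
    then show "\<not> b ` T \<subseteq> V" using TV by (auto simp: V'_def)
    show "b ` T \<inter> V \<subseteq> U' i" if i: "i \<in> {2..N}" for i
    proof clarify
      fix t assume "t \<in> T" "b t \<in> V"
      then have "t \<in> U' 1" using TV TV' by (auto simp: V'_def)
      then have "b t \<in> U' 2" using F(7) by auto
      then show "b t \<in> U' i" using nested_flags_mono[OF U' index_mem(4), of i] i by auto
    qed
  qed
  have "bij_betw (\<lambda>U. U 1) {U \<in> piece e 1. res U = U'} ?T"
  proof (rule bij_betw_byWitness[where f' = G])
    have step: "U 1 \<in> ?T" if U: "U \<in> piece e 1" "res U = U'" for U
    proof -
      have UF: "U \<in> Fl e" and t': "\<forall>i\<in>{1..N}. U i \<subseteq> H i \<longleftrightarrow> i < 1" using U(1) by (simp_all add: piece_def)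
      have t: "\<not> U 1 \<subseteq> V'" using bspec[OF t' index_mem(1)] H_eq(2) by simp
      have ri: "U' i = U i \<inter> H i" if "i \<in> {1..N}" for i using U that by (auto simp: res_def)
      have "U 1 \<subseteq> U' N" using ri[OF index_mem(3)] nested_flagsD(4,8)[OF UF] H_eq(1)[OF index_mem(5)] by auto
      then show ?thesis using nested_flagsD(2)[OF UF index_mem(1)] ri[OF index_mem(1)] t H_eq(2) by auto
    qed
    then show "(\<lambda>U. U 1) ` {U \<in> piece e 1. res U = U'} \<subseteq> ?T" by blast
    show "\<forall>U\<in>{U \<in> piece e 1. res U = U'}. G (U 1) = U"
    proof
      fix U assume U: "U \<in> {U \<in> piece e 1. res U = U'}"
      then have UF: "U \<in> Fl e" and r: "res U = U'" by (auto simp: piece_def)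
      have ri: "U' i = U i \<inter> H i" if "i \<in> {1..N}" for i using r that by (auto simp: res_def)
      have T: "U 1 \<in> ?T" using step U by blast
      show "G (U 1) = U"
      proof (rule extensionalityI[of _ "{1..N}"])
        fix i assume i: "i \<in> {1..N}"
        show "G (U 1) i = U i"
        proof (cases "i = 1")
          case False
          then have i2: "i \<in> {2..N}" using i by auto
          have mono: "b ` U 1 \<subseteq> U i"
            using nested_flagsD(7)[OF UF] nested_flags_mono[OF UF index_mem(4), of i] i2 by auto
          have "U i = {x + t |x t. x \<in> U' i \<and> t \<in> b ` U 1}"
          proof (rule HE(8)[OF i i T_facts(3)[OF T] T_facts(4)[OF T] T_facts(7)[OF T i2] T_facts(5)[OF T]])
            show "U i \<inter> V = U' i" using ri[OF i] H_eq(1)[OF i2] by auto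
          qed (use nested_flagsD[OF UF] i i2 mono in auto)
          then show ?thesis using False i by (simp add: G_def)
        qed (use index_mem(1) in \<open>simp add: G_def\<close>)
      qed (use nested_flagsD(1)[OF UF] in \<open>auto simp: G_def\<close>)
    qed
    show "\<forall>T\<in>?T. G T 1 = T" using index_mem(1) by (simp add: G_def)
    show "G ` ?T \<subseteq> {U \<in> piece e 1. res U = U'}"
    proof
      fix U assume "U \<in> G ` ?T"
      then obtain T where T: "T \<in> ?T" "U = G T" by auto
      have U1: "U 1 = T" using T index_mem(1) by (simp add: G_def)
      have Ug: "U i = {x + t |x t. x \<in> U' i \<and> t \<in> b ` T}" if "i \<in> {2..N}" for i using that T by (auto simp: G_def)
      have P: "subspace (U i)" "U i \<subseteq> W" "U i \<inter> V = U' i" "U i \<noteq> U' i" "dim (U i) = Suc (dim (U' i))" "U' i \<subseteq> U i" "b ` T \<subseteq> U i"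
        if i: "i \<in> {2..N}" for i
      proof -
        have i': "i \<in> {1..N}" using i by auto
        show "subspace (U i)" "U i \<subseteq> W" "U i \<inter> V = U' i" "U i \<noteq> U' i" "dim (U i) = Suc (dim (U' i))" "U' i \<subseteq> U i" "b ` T \<subseteq> U i"
          unfolding Ug[OF i]
          using HE(1-7)[OF i' i' T_facts(3,4)[OF T(1)] T_facts(7)[OF T(1) i] T_facts(5)[OF T(1)]] by auto
      qed
      have dimT: "dim T = Suc (dim (U' 1))"
      proof -
        have "V \<noteq> {0}"
        proof
          assume "V = {0}"
          then show False using T_facts(1,6)[OF T(1)] subspace_0[OF subspace_V'(1)] by auto
        qed
        then show ?thesis
          using card_hyperplane_complements(2)[OF finite_scalars subspace_V'(3) V(1) subspace_V'(1,2) dim_V' F(2)[OF index_mem(1)] F(4) _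
              T_facts(1)[OF T(1)] T_facts(2)[OF T(1)]] T by auto
      qed
      have "U \<in> Fl e"
      proof (rule nested_flagsI)
        show "U \<in> extensional {1..N}" using T by (simp add: G_def)
        show "subspace (U i) \<and> dim (U i) = e i" if i: "i \<in> {1..N}" for i
        proof (cases "i = 1")
          case True
          then show ?thesis using T U1 dimT F(3)[OF index_mem(1)] e[OF index_mem(1)] index_mem(1) by (simp add: lower_def)
        next
          case False
          then have "i \<in> {2..N}" using i by auto
          then show ?thesis using P(1,5) F(3)[OF i] e[OF i] i by (simp add: lower_def)
        qed
        show "U 1 \<subseteq> V" using U1 T_facts(1)[OF T(1)] by simp
        show "U i \<subseteq> W" if "i \<in> {2..N}" for i by (rule P(2)[OF that])
        show "U i \<subseteq> U (Suc i)" if i: "i \<in> {2..<N}" for i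
        proof -
          have i': "i \<in> {2..N}" "Suc i \<in> {2..N}" using i by auto
          show ?thesis unfolding Ug[OF i'(1)] Ug[OF i'(2)] using F(6)[OF i] by blast
        qed
        show "b ` U 1 \<subseteq> U 2" using U1 P(7)[OF index_mem(4)] by auto
        show "U 1 \<subseteq> U N" using U1 T P(6)[OF index_mem(5)] by auto
      qed
      moreover have "\<not> U i \<subseteq> H i" if i: "i \<in> {1..N}" for i
      proof (cases "i = 1")
        case True
        then show ?thesis using U1 T_facts(6)[OF T(1)] H_eq(2) by auto
      next
        case False
        then have i': "i \<in> {2..N}" using i by auto
        then show ?thesis using P(3,4)[OF i'] H_eq(1)[OF i'] by auto
      qed
      moreover have "res U = U'"
      proof (rule extensionalityI[of _ "{1..N}"])
        fix i assume i: "i \<in> {1..N}"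
        show "res U i = U' i"
        proof (cases "i = 1")
          case True
          then show ?thesis using U1 T_facts(2)[OF T(1)] H_eq(2) index_mem(1) by (simp add: res_def)
        next
          case False
          then have i': "i \<in> {2..N}" using i by auto
          then show ?thesis using P(3)[OF i'] H_eq(1)[OF i'] i by (auto simp: res_def)
        qed
      qed (use F(1) in \<open>auto simp: res_def\<close>)
      ultimately show "U \<in> {U \<in> piece e 1. res U = U'}" by (auto simp: piece_def)
    qed
  qed
  then have card: "card {U \<in> piece e 1. res U = U'} = card ?T" by (rule bij_betw_same_card)
  show ?thesis
  proof (cases "U' N \<subseteq> V'")
    case True
    then have "?T = {}" by auto
    then have "card ?T = 0" by (simp only: card.empty)
    with card have "card {U \<in> piece e 1. res U = U'} = 0" by (rule trans)
    then show ?thesis using True by simp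
  next
    case False
    have fin: "finite (U' N)" using U'V[OF index_mem(3)] subspace_V'(3) finite_subset by blast
    have sI: "subspace (U' N \<inter> V')" by (rule subspace_inter[OF F(2)[OF index_mem(3)] subspace_V'(1)])
    have "V \<noteq> {0}" using False U'V[OF index_mem(3)] subspace_0[OF subspace_V'(1)] by auto
    then have dN: "dim (U' N) = Suc (dim (U' N \<inter> V'))"
      using False by (intro card_hyperplane_complements(2)[OF finite_scalars subspace_V'(3) V(1) subspace_V'(1,2) dim_V' sI _ F(2)[OF index_mem(3)] U'V[OF index_mem(3)]]) auto
    have sub: "U' 1 \<subseteq> U' N \<inter> V'" using F(4,8) by auto
    have "card ?T = CARD('a) ^ (dim (U' N \<inter> V') - dim (U' 1))"
      by (rule card_hyperplane_complements(1)[OF finite_scalars fin F(2)[OF index_mem(3)] sI _ dN F(2)[OF index_mem(1)] sub]) auto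
    moreover have "dim (U' 1) \<le> dim (U' N \<inter> V')"
      by (rule dim_mono_finite[OF finite_scalars _ F(2)[OF index_mem(1)] sI sub]) (use fin in auto)
    moreover have "int (dim (U' N \<inter> V') - dim (U' 1)) = int (e N) - int (e 1) - 1"
      using dN F(3)[OF index_mem(3)] F(3)[OF index_mem(1)] e[OF index_mem(1)] e[OF index_mem(3)] index_mem calculation(2) by (simp add: lower_def)
    moreover have "real (card {U \<in> piece e 1. res U = U'}) = real CARD('a) powi int (dim (U' N \<inter> V') - dim (U' 1))"
      unfolding card calculation(1) power_int_of_nat by simp
    ultimately show ?thesis using False by simp
  qed
qed

text \<open>With the last space also all spaces from vertex \<open>2\<close> on lie in
  \<open>V'\<close>, and since \<open>b\<close> maps \<open>U 1\<close> into \<open>U 2\<close>,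
  this puts \<open>U 1\<close> into \<open>V''\<close>. The exceptional flags of
  \<open>card_fibre_first\<close> are thus counted by the configuration two steps lower.\<close>

lemma flags_in_V': "{U' \<in> Fl' e. U' N \<subseteq> V'} = Fl'' e"
proof (intro equalityI subsetI)
  fix U assume "U \<in> {U' \<in> Fl' e. U' N \<subseteq> V'}"
  then have U: "U \<in> Fl' e" "U N \<subseteq> V'" by auto
  have sub: "U i \<subseteq> V'" if "i \<in> {2..N}" for i using nested_flags_mono[OF U(1) that, of N] that U(2) by auto
  show "U \<in> Fl'' e"
  proof (rule nested_flagsI)
    show "U 1 \<subseteq> V''" using nested_flagsD(4,7)[OF U(1)] sub[OF index_mem(4)] by (auto simp: V''_def)
    show "U i \<subseteq> V'" if "i \<in> {2..N}" for i by (rule sub[OF that])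
  qed (use nested_flagsD[OF U(1)] in auto)
next
  fix U assume U: "U \<in> Fl'' e"
  have "U \<in> Fl' e"
  proof (rule nested_flagsI)
    show "U 1 \<subseteq> V'" using nested_flagsD(4)[OF U] by (auto simp: V''_def)
    show "U i \<subseteq> V" if "i \<in> {2..N}" for i using nested_flagsD(5)[OF U that] subspace_V' by auto
  qed (use nested_flagsD[OF U] in auto)
  then show "U \<in> {U' \<in> Fl' e. U' N \<subseteq> V'}" using nested_flagsD(5)[OF U index_mem(5)] by auto
qed

text \<open>Each piece is counted through the fibres of \<open>res\<close>, which have constant size
  except that for \<open>j = 1\<close> those over the exceptional flags are empty; this is where the
  difference in the last summand comes from.\<close>

lemma card_Fl_recursion:
  "real (card (Fl e)) = real (card (Fl' e)) +
     (\<Sum>j\<in>{2..N}. if \<forall>i\<in>{j..N}. 1 \<le> e i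
        then real CARD('a) powi (int (dim W) - int (e j)) * real (card (Fl' (lower e j))) else 0) +
     (if \<forall>i\<in>{1..N}. 1 \<le> e i
        then real CARD('a) powi (int (e N) - int (e 1) - 1) *
          (real (card (Fl' (lower e 1))) - real (card (Fl'' (lower e 1)))) else 0)"
proof -
  have fin': "finite (Fl' e)" for e using finite_nested_flags[OF subspace_V'(3,2)] N by simp
  have finp: "finite (piece e j)" for j
    using finite_nested_flags[OF W(1) V(2), of N b e] N by (auto simp: piece_def)
  have split: "{1..Suc N} = insert 1 (insert (Suc N) {2..N})" using N by auto
  have fib: "real (card (piece e j)) = (\<Sum>U'\<in>Fl' (lower e j). real (card {U \<in> piece e j. res U = U'}))"
    if "j \<in> {1..N}" for j
  proof -
    have "res ` piece e j \<subseteq> Fl' (lower e j)" using res_piece(1)[OF _ that] by blast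
    from card_eq_sum_fibres[OF finp fin' this] show ?thesis by simp
  qed
  have empty: "piece e j = {}" if "j \<in> {1..N}" "\<not> (\<forall>i\<in>{j..N}. 1 \<le> e i)" for j
    using res_piece(2)[OF _ that(1)] that(2) by blast
  have mid: "real (card (piece e j)) = (if \<forall>i\<in>{j..N}. 1 \<le> e i
        then real CARD('a) powi (int (dim W) - int (e j)) * real (card (Fl' (lower e j))) else 0)"
    if j: "j \<in> {2..N}" for j
  proof (cases "\<forall>i\<in>{j..N}. 1 \<le> e i")
    case True
    have j': "j \<in> {1..N}" using j by auto
    \<comment> \<open>The integer exponent may be negative when there are no flags to restrict to,
      and then both sides are 0. Otherwise \<open>e j \<le> dim W\<close>, and it agrees with the
      natural subtraction.\<close>
    show ?thesis
    proof (cases "Fl' (lower e j) = {}")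
      case True
      then show ?thesis using fib[OF j'] by simp
    next
      case False
      then obtain U' where U': "U' \<in> Fl' (lower e j)" by blast
      have "dim (U' j) \<le> dim V"
        using nested_flagsD(2)[OF U' j'] nested_flagsD(5)[OF U' j] subspace_V'(3) V(1)
        by (intro dim_mono_finite[OF finite_scalars]) auto
      then have "e j \<le> dim W" using nested_flagsD(3)[OF U' j'] V(3) j by (auto simp: lower_def)
      then have "real (CARD('a) ^ (dim W - e j)) = real CARD('a) powi (int (dim W) - int (e j))"
        by (simp flip: power_int_of_nat add: of_nat_diff)
      moreover have "real (card (piece e j)) = (\<Sum>U'\<in>Fl' (lower e j). real (CARD('a) ^ (dim W - e j)))"
        unfolding fib[OF j'] using card_fibre_middle[OF j] True by (intro sum.cong) auto
      ultimately show ?thesis using True by simp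
    qed
  next
    case False
    then show ?thesis using empty[of j] j by auto
  qed
  have first: "real (card (piece e 1)) = (if \<forall>i\<in>{1..N}. 1 \<le> e i
        then real CARD('a) powi (int (e N) - int (e 1) - 1) *
          (real (card (Fl' (lower e 1))) - real (card (Fl'' (lower e 1)))) else 0)"
  proof (cases "\<forall>i\<in>{1..N}. 1 \<le> e i")
    case True
    let ?q = "real CARD('a) powi (int (e N) - int (e 1) - 1)"
    have "real (card (piece e 1)) = (\<Sum>U'\<in>Fl' (lower e 1). if U' N \<subseteq> V' then 0 else ?q)"
      unfolding fib[OF index_mem(1)] using card_fibre_first[of e] True by (intro sum.cong) auto
    also have "\<dots> = (\<Sum>U'\<in>Fl' (lower e 1) - Fl'' (lower e 1). ?q)"
      using fin' flags_in_V'[of "lower e 1"] by (intro sum.mono_neutral_cong_right) auto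
    also have "\<dots> = ?q * real (card (Fl' (lower e 1) - Fl'' (lower e 1)))" by simp
    also have "card (Fl' (lower e 1) - Fl'' (lower e 1)) = card (Fl' (lower e 1)) - card (Fl'' (lower e 1))"
      using fin' flags_in_V'[of "lower e 1"] by (intro card_Diff_subset) (auto intro: finite_subset)
    also have "real (card (Fl' (lower e 1)) - card (Fl'' (lower e 1))) = real (card (Fl' (lower e 1))) - real (card (Fl'' (lower e 1)))"
      using fin' flags_in_V'[of "lower e 1"] by (intro of_nat_diff card_mono) auto
    finally show ?thesis using True by simp
  next
    case False
    then show ?thesis using empty[OF index_mem(1)] by auto
  qed
  have "real (card (Fl e)) = real (card (piece e 1)) + real (card (piece e (Suc N))) + (\<Sum>j\<in>{2..N}. real (card (piece e j)))"
    unfolding card_Fl split using N by simp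
  then show ?thesis unfolding first piece_last using mid by simp
qed

end

text \<open>Two predecessors occur in the recursion, so the induction is a strong one; both inherit
  the absence of invariant subspaces. The truncated subtractions in the dimensions serve the bottom:
  when \<open>V\<close> is zero, both predecessors are zero configurations.\<close>

lemma (in vector_space) card_nested_flags:
  assumes fin: "finite (UNIV :: 'a set)" and N: "N \<ge> 3" and b: "Vector_Spaces.linear scale scale b"
    and "subspace V" "V \<subseteq> W" "finite W" "subspace W"
    and "\<And>v. v \<in> V \<Longrightarrow> b v \<in> W" and "\<And>S. subspace S \<Longrightarrow> S \<subseteq> V \<Longrightarrow> b ` S \<subseteq> S \<Longrightarrow> S = {0}"
    and "dim W = k - 1" "dim V = k - 2"
  shows "real (card (nested_flags N V W b e)) = flag_count N (real CARD('a)) k e"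
  using assms(4-)
proof (induction k arbitrary: V W e rule: less_induct)
  case (less k)
  interpret b: Vector_Spaces.linear scale scale b by (rule b)
  show ?case
  proof (cases "k < 2")
    case True
    have "dim W = 0" using True less.prems by auto
    then have W0: "W = {0}" using dim_zero_iff[OF fin less.prems(3,4)] by simp
    then have V0: "V = {0}" using less.prems(1,2) subspace_0 by blast
    have "nested_flags N V W b e = (if \<forall>i\<in>{1..N}. e i = 0 then {restrict (\<lambda>_. {0}) {1..N}} else {})"
    proof (cases "\<forall>i\<in>{1..N}. e i = 0")
      case True
      have "restrict (\<lambda>_. {0}) {1..N} \<in> nested_flags N V W b e"
        using True N by (intro nested_flagsI) (auto simp: W0 V0 b.zero)
      moreover have "U = restrict (\<lambda>_. {0}) {1..N}" if U: "U \<in> nested_flags N V W b e" for U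
      proof (rule extensionalityI[of _ "{1..N}"])
        fix i assume i: "i \<in> {1..N}"
        have "U i \<subseteq> {0}" using nested_flagsD(4)[OF U] nested_flagsD(5)[OF U, of i] i W0 V0 by (cases "i = 1") auto
        then show "U i = restrict (\<lambda>_. {0}) {1..N} i" using subspace_0[OF nested_flagsD(2)[OF U i]] i by auto
      qed (use nested_flagsD(1)[OF U] in auto)
      ultimately show ?thesis unfolding if_P[OF True] by blast
    next
      case False
      have "e i = 0" if U: "U \<in> nested_flags N V W b e" and i: "i \<in> {1..N}" for U i
      proof -
        have "U i \<subseteq> {0}" using nested_flagsD(4)[OF U] nested_flagsD(5)[OF U, of i] i W0 V0 by (cases "i = 1") auto
        then have "U i = {0}" using subspace_0[OF nested_flagsD(2)[OF U i]] by auto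
        then show ?thesis using nested_flagsD(3)[OF U i] by simp
      qed
      then show ?thesis using False by auto
    qed
    then have eq: "real (card (nested_flags N V W b e)) = (if \<forall>i\<in>{1..N}. e i = 0 then 1 else 0)"
      by simp
    have "k = 0 \<or> k = Suc 0" using True by auto
    then show ?thesis
    proof
      assume "k = 0"
      show ?thesis unfolding \<open>k = 0\<close> flag_count.simps by (rule eq)
    next
      assume "k = Suc 0"
      show ?thesis unfolding \<open>k = Suc 0\<close> flag_count.simps by (rule eq)
    qed
  next
    case False
    then obtain k' where k: "k = Suc (Suc k')" by (metis One_nat_def less_2_cases_iff not0_implies_Suc)
    interpret flag_configuration scale N V W b
      using less.prems fin N b k by unfold_locales auto
    have dV': "dim V = k'" using less.prems(8) k by simp
    have d': "dim V' = k' - 1"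
    proof (cases "V = {0}")
      case True
      then have "V' = {0}" using subspace_V'(1,2) subspace_0 by blast
      then show ?thesis using True dV' by simp
    next
      case False
      then show ?thesis using dim_V' dV' by simp
    qed
    have noinv': "S = {0}" if "subspace S" "S \<subseteq> V" "b ` S \<subseteq> S" for S using less.prems(6) that by blast
    have IH1: "real (card (Fl' e)) = flag_count N (real CARD('a)) (Suc k') e" for e
    proof (rule less.IH)
      show "S = {0}" if "subspace S" "S \<subseteq> V'" "b ` S \<subseteq> S" for S using noinv' that subspace_V'(2) by blast
    qed (use k subspace_V' V(1) d' dV' in \<open>auto simp: V'_def\<close>)
    have s2: "subspace V''" "V'' \<subseteq> V'"
      unfolding V''_def using subspace_inter[OF subspace_V'(1) b.subspace_linear_preimage[OF subspace_V'(1)]]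
      by (auto simp: Collect_conj_eq)
    have d'': "dim V'' = k' - 2"
    proof (cases "V = {0}")
      case True
      then have "V'' = {0}" using s2 subspace_V'(1,2) subspace_0 by blast
      then show ?thesis using True dV' by simp
    next
      case False
      interpret f: flag_configuration scale N V' V b
      proof unfold_locales
        show "S = {0}" if "subspace S" "S \<subseteq> V'" "b ` S \<subseteq> S" for S using noinv' that subspace_V'(2) by blast
      qed (use fin N b subspace_V' V(1) dim_V'[OF False] in \<open>auto simp: V'_def\<close>)
      have eq: "f.V' = V''" by (simp add: f.V'_def V''_def)
      show ?thesis
      proof (cases "V' = {0}")
        case True
        then have "V'' = {0}" using s2 subspace_0 by blast
        then show ?thesis using True d' by simp
      next
        case False
        then show ?thesis using f.dim_V' d' eq by simp
      qed
    qed
    have IH2: "real (card (Fl'' e)) = flag_count N (real CARD('a)) k' e" for e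
    proof (rule less.IH)
      show "S = {0}" if "subspace S" "S \<subseteq> V''" "b ` S \<subseteq> S" for S
        using noinv' that subspace_V'(2) s2(2) by blast
    qed (use k subspace_V' s2 d' d'' finite_subset[OF subspace_V'(2,3)] in \<open>auto simp: V''_def\<close>)
    have "dim W = Suc k'" using V(3) dV' by simp
    then show ?thesis
      unfolding card_Fl_recursion IH1 IH2 k flag_count.simps lower_def \<open>dim W = Suc k'\<close> by simp
  qed
qed

section \<open>Identities in the quantum torus\<close>

lemma bilin_add_left: "bilin S A (x + y) w = bilin S A x w + bilin S A y w"
  by (simp add: bilin_def algebra_simps sum.distrib)

lemma bilin_diff_left: "bilin S A (x - y) w = bilin S A x w - bilin S A y w"
  by (simp add: bilin_def algebra_simps sum_subtractf)

lemma mat_vec_add: "mat_vec S A (x + y) = mat_vec S A x + mat_vec S A y"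
  by (auto simp: mat_vec_def fun_eq_iff algebra_simps sum.distrib)

lemma mat_vec_diff: "mat_vec S A (x - y) = mat_vec S A x - mat_vec S A y"
  by (auto simp: mat_vec_def fun_eq_iff algebra_simps sum_subtractf)

lemma bilin_add_right: "bilin S A w (x + y) = bilin S A w x + bilin S A w y"
  by (simp add: bilin_def mat_vec_add algebra_simps sum.distrib)

lemma bilin_diff_right: "bilin S A w (x - y) = bilin S A w x - bilin S A w y"
  by (simp add: bilin_def mat_vec_diff algebra_simps sum_subtractf)

lemma bilin_eq_sum: "bilin S A x y = (\<Sum>i\<in>S. \<Sum>j\<in>S. x i * A i j * y j)"
  by (simp add: bilin_def mat_vec_def sum_distrib_left algebra_simps)

text \<open>Exponents may be repeated, and their coefficients then add up. In this form no
  injectivity of the exponent maps has to be shown.\<close>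

definition lincomb :: "'i set \<Rightarrow> ('i \<Rightarrow> real) \<Rightarrow> ('i \<Rightarrow> nat \<Rightarrow> int) \<Rightarrow> (nat \<Rightarrow> int) \<Rightarrow> real" where
  "lincomb I a u g = (\<Sum>i\<in>I. if g = u i then a i else 0)"

lemma sum_swap_pairs:
  fixes F :: "'a \<Rightarrow> 'b \<Rightarrow> 'c \<Rightarrow> 'd \<Rightarrow> real"
  shows "(\<Sum>e\<in>A. \<Sum>f\<in>B. \<Sum>i\<in>I. \<Sum>j\<in>J. F e f i j) = (\<Sum>i\<in>I. \<Sum>j\<in>J. \<Sum>e\<in>A. \<Sum>f\<in>B. F e f i j)"
proof -
  have "(\<Sum>e\<in>A. \<Sum>f\<in>B. \<Sum>i\<in>I. \<Sum>j\<in>J. F e f i j) = (\<Sum>e\<in>A. \<Sum>i\<in>I. \<Sum>f\<in>B. \<Sum>j\<in>J. F e f i j)"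
    by (rule sum.cong[OF refl], rule sum.swap)
  also have "\<dots> = (\<Sum>i\<in>I. \<Sum>e\<in>A. \<Sum>f\<in>B. \<Sum>j\<in>J. F e f i j)" by (rule sum.swap)
  also have "\<dots> = (\<Sum>i\<in>I. \<Sum>e\<in>A. \<Sum>j\<in>J. \<Sum>f\<in>B. F e f i j)"
    by (rule sum.cong[OF refl], rule sum.cong[OF refl], rule sum.swap)
  also have "\<dots> = (\<Sum>i\<in>I. \<Sum>j\<in>J. \<Sum>e\<in>A. \<Sum>f\<in>B. F e f i j)"
    by (rule sum.cong[OF refl], rule sum.swap)
  finally show ?thesis .
qed

text \<open>The product is defined through the supports of the factors. The sum is enlarged to all
  pairs of occurring exponents and then split by indices, so cancellation among repeated exponents
  does no harm.\<close>

lemma mult_lincomb: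
  assumes "finite I" "finite J"
  shows "lincomb I a u \<otimes>\<^bsub>qtorus q n\<^esub> lincomb J b w =
    lincomb (I \<times> J) (\<lambda>(i, j). a i * b j * real q powr (of_int (bilin {1..2*n} Lam (u i) (w j)) / 2)) (\<lambda>(i, j). u i + w j)"
proof
  fix g
  define \<omega> where "\<omega> e f = real q powr (of_int (bilin {1..2*n} Lam e f) / 2)" for e f
  let ?x = "lincomb I a u" and ?y = "lincomb J b w"
  have zero: "?x e = 0" if "e \<notin> u ` I" for e using that by (auto simp: lincomb_def intro!: sum.neutral)
  have zero': "?y e = 0" if "e \<notin> w ` J" for e using that by (auto simp: lincomb_def intro!: sum.neutral)
  have "(?x \<otimes>\<^bsub>qtorus q n\<^esub> ?y) g = (\<Sum>(e, f)\<in>{(e, f). ?x e \<noteq> 0 \<and> ?y f \<noteq> 0 \<and> e + f = g}. ?x e * ?y f * \<omega> e f)"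
    by (simp add: qtorus_def \<omega>_def)
  also have "\<dots> = (\<Sum>(e, f)\<in>u ` I \<times> w ` J. if e + f = g then ?x e * ?y f * \<omega> e f else 0)"
  proof (rule sum.mono_neutral_cong_left)
    show "finite (u ` I \<times> w ` J)" using assms by simp
    show "{(e, f). ?x e \<noteq> 0 \<and> ?y f \<noteq> 0 \<and> e + f = g} \<subseteq> u ` I \<times> w ` J" using zero zero' by blast
  qed (auto split: if_splits)
  also have "\<dots> = (\<Sum>e\<in>u ` I. \<Sum>f\<in>w ` J. if e + f = g then ?x e * ?y f * \<omega> e f else 0)"
    by (simp add: sum.cartesian_product)
  also have "\<dots> = (\<Sum>e\<in>u ` I. \<Sum>f\<in>w ` J. \<Sum>i\<in>I. \<Sum>j\<in>J.
      if e = u i then (if f = w j then (if e + f = g then a i * b j * \<omega> e f else 0) else 0) else 0)"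
    unfolding lincomb_def sum_product by (auto simp: sum_distrib_right intro!: sum.cong sum.neutral)
  also have "\<dots> = (\<Sum>i\<in>I. \<Sum>j\<in>J. \<Sum>e\<in>u ` I. \<Sum>f\<in>w ` J.
      if e = u i then (if f = w j then (if e + f = g then a i * b j * \<omega> e f else 0) else 0) else 0)"
    by (rule sum_swap_pairs)
  also have "\<dots> = (\<Sum>i\<in>I. \<Sum>j\<in>J. if u i + w j = g then a i * b j * \<omega> (u i) (w j) else 0)"
  proof (intro sum.cong refl)
    fix i j assume ij: "i \<in> I" "j \<in> J"
    have "(\<Sum>e\<in>u ` I. \<Sum>f\<in>w ` J. if e = u i then (if f = w j then (if e + f = g then a i * b j * \<omega> e f else 0) else 0) else 0)
        = (\<Sum>e\<in>u ` I. if e = u i then (\<Sum>f\<in>w ` J. if f = w j then (if u i + f = g then a i * b j * \<omega> (u i) f else 0) else 0) else 0)"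
      by (intro sum.cong refl) (auto cong: if_cong)
    also have "\<dots> = (if u i + w j = g then a i * b j * \<omega> (u i) (w j) else 0)"
      using assms ij by simp
    finally show "(\<Sum>e\<in>u ` I. \<Sum>f\<in>w ` J. if e = u i then (if f = w j then (if e + f = g then a i * b j * \<omega> e f else 0) else 0) else 0)
      = (if u i + w j = g then a i * b j * \<omega> (u i) (w j) else 0)" .
  qed
  also have "\<dots> = lincomb (I \<times> J) (\<lambda>(i, j). a i * b j * \<omega> (u i) (w j)) (\<lambda>(i, j). u i + w j) g"
    by (auto simp: lincomb_def sum.cartesian_product intro!: sum.cong)
  finally show "(?x \<otimes>\<^bsub>qtorus q n\<^esub> ?y) g = lincomb (I \<times> J) (\<lambda>(i, j). a i * b j *
      real q powr (of_int (bilin {1..2*n} Lam (u i) (w j)) / 2)) (\<lambda>(i, j). u i + w j) g"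
    by (simp add: \<omega>_def)
qed

abbreviation "euler n \<equiv> bilin {1..2*n} (id_minus_Rtr (Qaff n))"

text \<open>These are the dimension vectors of the subrepresentations of E(\<lambda>): \<delta> for
  \<open>j = 1\<close>, zero for \<open>j = 2 * n + 1\<close>.\<close>

definition interval_vec :: "nat \<Rightarrow> nat \<Rightarrow> nat \<Rightarrow> int" where
  "interval_vec n j i = (if i \<in> {j..2*n} then 1 else 0)"

text \<open>\<open>layer_dim n (l + 2)\<close> is the dimension vector of \<open>M\<^sub>1(l)\<close>. In the multiplication formula, the cluster
  variables \<open>X\<^sub>1\<close> and \<open>X\<^sub>2\<^sub>n\<close> play the role of \<open>M\<^sub>1(-1)\<close> and \<open>M\<^sub>1(-2)\<close>.\<close>

definition layer_dim :: "nat \<Rightarrow> nat \<Rightarrow> nat \<Rightarrow> int" where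
  "layer_dim n k i = (if i \<in> {1..2*n} then int k - (if i = 1 then 2 else 1) else 0)"

definition box :: "nat \<Rightarrow> nat \<Rightarrow> (nat \<Rightarrow> nat) set" where
  "box n K = {e. \<forall>i. e i \<le> (if i \<in> {1..2*n} then K else 0)}"

definition expo :: "nat \<Rightarrow> (nat \<Rightarrow> int) \<Rightarrow> (nat \<Rightarrow> int) \<Rightarrow> nat \<Rightarrow> int" where
  "expo n v x = - mat_vec {1..2*n} (Bmat n) x - mat_vec {1..2*n} (id_minus_Rtr (Qaff n)) v"

lemma Rmat_Qaff:
  assumes "n \<ge> 2" "i \<in> {1..2*n}" "j \<in> {1..2*n}"
  shows "Rmat (Qaff n) j i = (if j = i + 1 \<or> (i = 1 \<and> j = 2*n) then 1 else 0)"
proof -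
  have "{a \<in> arcs (Qaff n). tail (Qaff n) a = i \<and> head (Qaff n) a = j} =
      (if j = i + 1 then {i} else if i = 1 \<and> j = 2*n then {2*n} else {})"
    using assms by (auto simp: Qaff_def split: if_splits)
  then show ?thesis by (auto simp: Rmat_def)
qed

lemma finite_box: "finite (box n K)"
proof -
  have "box n K \<subseteq> {e. \<forall>i. (i \<in> {1..2*n} \<longrightarrow> e i \<in> {..K}) \<and> (i \<notin> {1..2*n} \<longrightarrow> e i = 0)}"
    unfolding box_def by (auto split: if_splits)
  moreover have "finite {e. \<forall>i. (i \<in> {1..2*n} \<longrightarrow> e i \<in> {..K}) \<and> (i \<notin> {1..2*n} \<longrightarrow> e i = (0::nat))}"
    by (rule finite_set_of_finite_funs) auto
  ultimately show ?thesis by (rule finite_subset)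
qed

text \<open>The bound is the dimension of \<open>W\<close> in the geometric reading. It is derived
  from the recursion itself, as \<open>Q\<close> is arbitrary here and no configuration is at
  hand.\<close>

lemma flag_count_bound: "flag_count N Q k e \<noteq> 0 \<Longrightarrow> i \<in> {1..N} \<Longrightarrow> e i \<le> k - 1"
proof (induction N Q k e rule: flag_count.induct)
  case (3 N Q k e)
  have eps: "e i \<le> Suc (e i - (if i \<in> {j..N} then 1 else 0))" for j by auto
  show ?case
  proof (rule ccontr)
    assume gt: "\<not> e i \<le> Suc (Suc k) - 1"
    have a: "flag_count N Q (Suc k) e = 0"
    proof (rule ccontr)
      assume "flag_count N Q (Suc k) e \<noteq> 0"
      then have "e i \<le> Suc k - 1" using 3(1) 3(6) by blast
      then show False using gt by simp
    qed
    have b: "flag_count N Q (Suc k) (\<lambda>i. e i - (if i \<in> {j..N} then 1 else 0)) = 0"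
      if "j \<in> {2..N}" "\<forall>i\<in>{j..N}. 1 \<le> e i" for j
    proof (rule ccontr)
      assume "flag_count N Q (Suc k) (\<lambda>i. e i - (if i \<in> {j..N} then 1 else 0)) \<noteq> 0"
      then have "e i - (if i \<in> {j..N} then 1 else 0) \<le> Suc k - 1" using 3(2)[OF that] 3(6) by blast
      then show False using gt by (simp split: if_splits)
    qed
    have c: "flag_count N Q (Suc k) (\<lambda>i. e i - (if i \<in> {1..N} then 1 else 0)) = 0"
      "flag_count N Q k (\<lambda>i. e i - (if i \<in> {1..N} then 1 else 0)) = 0"
      if p: "\<forall>i\<in>{1..N}. 1 \<le> e i"
    proof -
      show "flag_count N Q (Suc k) (\<lambda>i. e i - (if i \<in> {1..N} then 1 else 0)) = 0"
      proof (rule ccontr)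
        assume "flag_count N Q (Suc k) (\<lambda>i. e i - (if i \<in> {1..N} then 1 else 0)) \<noteq> 0"
        then have "e i - (if i \<in> {1..N} then 1 else 0) \<le> Suc k - 1" using 3(3)[OF p] 3(6) by blast
        then show False using gt by (simp split: if_splits)
      qed
      show "flag_count N Q k (\<lambda>i. e i - (if i \<in> {1..N} then 1 else 0)) = 0"
      proof (rule ccontr)
        assume "flag_count N Q k (\<lambda>i. e i - (if i \<in> {1..N} then 1 else 0)) \<noteq> 0"
        then have "e i - (if i \<in> {1..N} then 1 else 0) \<le> k - 1" using 3(4)[OF p] 3(6) by blast
        then show False using gt by (simp split: if_splits)
      qed
    qed
    have s: "(\<Sum>j\<in>{2..N}. if \<forall>i\<in>{j..N}. 1 \<le> e i
        then Q powi (int (Suc k) - int (e j)) * flag_count N Q (Suc k) (\<lambda>i. e i - (if i \<in> {j..N} then 1 else 0)) else 0) = 0"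
    proof (rule sum.neutral, rule ballI)
      fix j assume j: "j \<in> {2..N}"
      show "(if \<forall>i\<in>{j..N}. 1 \<le> e i
        then Q powi (int (Suc k) - int (e j)) * flag_count N Q (Suc k) (\<lambda>i. e i - (if i \<in> {j..N} then 1 else 0)) else 0) = 0"
        using b[OF j] by (cases "\<forall>i\<in>{j..N}. 1 \<le> e i") auto
    qed
    have "flag_count N Q (Suc (Suc k)) e = 0"
      unfolding flag_count.simps a s using c by (cases "\<forall>i\<in>{1..N}. 1 \<le> e i") auto
    then show False using 3(5) by contradiction
  qed
qed (auto split: if_splits)

locale affine_torus =
  fixes n q :: nat
  assumes n: "n \<ge> 2" and q: "q \<ge> 2"
begin

context notes [[coercion_enabled = false]] One_nat_def [simp del]
begin

abbreviation "N \<equiv> 2 * n"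
abbreviation "S \<equiv> {1..2*n}"
abbreviation "A \<equiv> id_minus_Rtr (Qaff n)"
abbreviation "B \<equiv> Bmat n"
abbreviation "\<epsilon> \<equiv> interval_vec n"

section \<open>Euler form, exchange matrix and their compatibility with the commutation
  matrix\<close>

lemma A_eq: "i \<in> S \<Longrightarrow> j \<in> S \<Longrightarrow> A i j = (if i = j then 1 else 0) - (if j = i + 1 \<or> (i = 1 \<and> j = N) then 1 else 0)"
  using Rmat_Qaff[OF n] by (simp add: id_minus_Rtr_def)

text \<open>\<open>B\<close> antisymmetrizes the matrix of the Euler form, which lets
  \<open>dot_B\<close> express pairings with \<open>B\<close> through Euler forms.\<close>

lemma B_eq: "i \<in> S \<Longrightarrow> j \<in> S \<Longrightarrow> B i j = A j i - A i j"
  using n by (auto simp: A_eq Bmat_def)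

lemma mat_vec_A:
  assumes i: "i \<in> S"
  shows "mat_vec S A x i = x i - (if i < N then x (i + 1) else 0) - (if i = 1 then x N else 0)"
proof -
  have "mat_vec S A x i = (\<Sum>j\<in>S. (if j = i then x j else 0) - (if j = i + 1 then x j else 0) - (if j = N then (if i = 1 then x j else 0) else 0))"
    using i n A_eq[OF i] by (auto simp: mat_vec_def intro!: sum.cong)
  also have "\<dots> = x i - (if i < N then x (i + 1) else 0) - (if i = 1 then x N else 0)"
    using i n by (simp add: sum_subtractf)
  finally show ?thesis .
qed

lemma mat_vec_B:
  assumes i: "i \<in> S"
  shows "mat_vec S B x i = (if i < N then x (i + 1) else 0) + (if i = 1 then x N else 0) -
    (if 1 < i then x (i - 1) else 0) - (if i = N then x 1 else 0)"
proof -
  have "mat_vec S B x i = (\<Sum>j\<in>S. (if j = i + 1 then x j else 0) + (if j = N then (if i = 1 then x j else 0) else 0)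
      - (if j = i - 1 then (if 1 < i then x j else 0) else 0) - (if j = 1 then (if i = N then x j else 0) else 0))"
    unfolding mat_vec_def if_P[OF i]
  proof (rule sum.cong[OF refl])
    fix j assume j: "j \<in> S"
    have "B i j = (if j = i + 1 then 1 else 0) + (if j = N then (if i = 1 then 1 else 0) else 0)
        - (if j = i - 1 then (if 1 < i then 1 else 0) else 0) - (if j = 1 then (if i = N then 1 else 0) else 0)"
      using i j n unfolding Bmat_def by (cases "i = 1"; cases "i = N") auto
    moreover have "(if P then 1 else 0) * z = (if P then z else 0)"
      "(if P then (if R then 1 else 0) else 0) * z = (if P then (if R then z else 0) else 0)" for P R and z :: int
      by auto
    ultimately show "B i j * x j = (if j = i + 1 then x j else 0) + (if j = N then (if i = 1 then x j else 0) else 0)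
        - (if j = i - 1 then (if 1 < i then x j else 0) else 0) - (if j = 1 then (if i = N then x j else 0) else 0)"
      by (simp only: left_diff_distrib distrib_right)
  qed
  also have "\<dots> = (if i < N then x (i + 1) else 0) + (if i = 1 then x N else 0) -
    (if 1 < i then x (i - 1) else 0) - (if i = N then x 1 else 0)"
    using i n by (auto simp: sum_subtractf sum.distrib)
  finally show ?thesis .
qed

lemma dot_B: "(\<Sum>i\<in>S. x i * mat_vec S B y i) = euler n y x - euler n x y"
proof -
  have "x i * mat_vec S B y i = (\<Sum>j\<in>S. x i * A j i * y j - x i * A i j * y j)" if i: "i \<in> S" for i
    unfolding mat_vec_def if_P[OF i] sum_distrib_left
  proof (rule sum.cong[OF refl])
    fix j assume j: "j \<in> S"
    show "x i * (B i j * y j) = x i * A j i * y j - x i * A i j * y j"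
      unfolding B_eq[OF i j] by (simp only: left_diff_distrib right_diff_distrib mult.assoc)
  qed
  then have "(\<Sum>i\<in>S. x i * mat_vec S B y i) = (\<Sum>i\<in>S. \<Sum>j\<in>S. x i * A j i * y j) - (\<Sum>i\<in>S. \<Sum>j\<in>S. x i * A i j * y j)"
    by (simp add: sum_subtractf)
  also have "(\<Sum>i\<in>S. \<Sum>j\<in>S. x i * A j i * y j) = (\<Sum>j\<in>S. \<Sum>i\<in>S. x i * A j i * y j)" by (rule sum.swap)
  finally show ?thesis by (simp add: bilin_eq_sum algebra_simps)
qed

text \<open>This is B^tr \<Lambda> = 2 I read entry by entry, with the sign changed because
  \<open>B\<close> is skew. In the rows \<open>1\<close> and \<open>N\<close> the entries cancel
  because \<open>N\<close> is even; in the other rows only entries next to the diagonal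
  contribute.\<close>

lemma Lam_B_column:
  assumes k: "k \<in> S" and j: "j \<in> S"
  shows "mat_vec S B (\<lambda>i. Lam i j) k = (if k = j then - 2 else 0)"
proof -
  consider "k = 1" | "k = N" | "1 < k" "k < N" using k by fastforce
  then show ?thesis
  proof cases
    case 1
    have "Lam 2 j + Lam N j = (if j = 1 then - 2 else 0)"
      using j n by (auto simp: Lam_def; presburger)
    then show ?thesis using 1 n mat_vec_B[OF k] by auto
  next
    case 2
    have "Lam (N - 1) j + Lam 1 j = (if j = N then 2 else 0)"
      using j n by (auto simp: Lam_def; presburger)
    then show ?thesis using 2 n mat_vec_B[OF k] by auto
  next
    case 3
    then obtain k' where k': "k = Suc k'" "k' \<ge> 1" by (cases k) auto
    have "Lam (k + 1) j - Lam (k - 1) j = (if k = j then - 2 else 0)"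
    proof -
      consider "j = k" | "j < k'" | "j = k'" | "j = k + 1" | "k + 1 < j" using k' by fastforce
      then show ?thesis by cases (use k' in \<open>auto simp: Lam_def Suc_diff_le\<close>)
    qed
    then show ?thesis using 3 n mat_vec_B[OF k] by auto
  qed
qed

lemma Lam_B: "bilin S Lam (mat_vec S B x) w = 2 * (\<Sum>k\<in>S. x k * w k)"
proof -
  have "bilin S Lam (mat_vec S B x) w = (\<Sum>i\<in>S. \<Sum>j\<in>S. (\<Sum>k\<in>S. B i k * x k) * Lam i j * w j)"
    by (simp add: bilin_eq_sum mat_vec_def)
  also have "\<dots> = (\<Sum>i\<in>S. \<Sum>j\<in>S. \<Sum>k\<in>S. - (x k * w j * (B k i * Lam i j)))"
    by (intro sum.cong refl) (auto simp: sum_distrib_right sum_distrib_left B_eq algebra_simps intro!: sum.cong)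
  also have "\<dots> = (\<Sum>i\<in>S. \<Sum>k\<in>S. \<Sum>j\<in>S. - (x k * w j * (B k i * Lam i j)))"
    by (intro sum.cong refl sum.swap)
  also have "\<dots> = (\<Sum>k\<in>S. \<Sum>i\<in>S. \<Sum>j\<in>S. - (x k * w j * (B k i * Lam i j)))" by (rule sum.swap)
  also have "\<dots> = (\<Sum>k\<in>S. \<Sum>j\<in>S. \<Sum>i\<in>S. - (x k * w j * (B k i * Lam i j)))"
    by (intro sum.cong refl sum.swap)
  also have "\<dots> = (\<Sum>k\<in>S. \<Sum>j\<in>S. - (x k * w j * mat_vec S B (\<lambda>i. Lam i j) k))"
    by (intro sum.cong refl) (simp add: mat_vec_def sum_negf sum_distrib_left)
  also have "\<dots> = (\<Sum>k\<in>S. \<Sum>j\<in>S. if j = k then 2 * (x k * w k) else 0)"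
    by (intro sum.cong refl) (simp add: Lam_B_column)
  also have "\<dots> = 2 * (\<Sum>k\<in>S. x k * w k)" by (simp add: sum_distrib_left)
  finally show ?thesis .
qed

text \<open>For \<open>j \<ge> 2\<close> the vector \<open>\<epsilon> j\<close> is the dimension
  vector of the projective at \<open>j\<close>, for which the Euler form reads off the dimension at
  \<open>j\<close>. Numerically the differences along the path telescope.\<close>

lemma euler_interval:
  assumes "j \<in> {2..N}"
  shows "euler n (\<epsilon> j) x = x j"
proof -
  have step: "euler n (\<epsilon> i) x = mat_vec S A x i + euler n (\<epsilon> (Suc i)) x" if "i \<in> S" for i
  proof -
    have "\<epsilon> i k * mat_vec S A x k = (if k = i then mat_vec S A x k else 0) + \<epsilon> (Suc i) k * mat_vec S A x k" if "k \<in> S" for k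
      using that by (auto simp: interval_vec_def)
    then show ?thesis using that by (simp add: bilin_def sum.distrib)
  qed
  have "2 \<le> j \<Longrightarrow> j \<le> N \<Longrightarrow> euler n (\<epsilon> j) x = x j"
  proof (induction "N - j" arbitrary: j)
    case 0
    then have j: "j = N" by simp
    have "euler n (\<epsilon> (Suc j)) x = 0" unfolding j by (simp add: bilin_def interval_vec_def)
    then show ?case using step[of j] mat_vec_A[of j] j n by simp
  next
    case (Suc d)
    then have "euler n (\<epsilon> (Suc j)) x = x (Suc j)" by simp
    moreover have "x (j + 1) = x (Suc j)" by (simp only: Suc_eq_plus1)
    ultimately show ?case using step[of j] mat_vec_A[of j x] Suc by auto
  qed
  then show ?thesis using assms by simp
qed

text \<open>Pairing with \<delta> gives the defect; the term \<open>x N\<close> comes from the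
  chord.\<close>

lemma euler_interval_1: "euler n (\<epsilon> 1) x = x 1 - x N"
proof -
  have "euler n (\<epsilon> 1) x = mat_vec S A x 1 + euler n (\<epsilon> 2) x"
  proof -
    have "\<epsilon> 1 k * mat_vec S A x k = (if k = 1 then mat_vec S A x k else 0) + \<epsilon> 2 k * mat_vec S A x k" if "k \<in> S" for k
      using that by (auto simp: interval_vec_def)
    then show ?thesis using n by (simp add: bilin_def sum.distrib)
  qed
  then show ?thesis using euler_interval[of 2 x] mat_vec_A[of 1 x] n by (simp add: numeral_2_eq_2)
qed

lemma euler_interval_last: "euler n (\<epsilon> (Suc N)) x = 0"
  by (simp add: bilin_def interval_vec_def)

lemma mat_vec_A_1: "i \<in> S \<Longrightarrow> mat_vec S A (\<epsilon> 1) i = (if i = N then 1 else 0) - (if i = 1 then 1 else 0)"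
  using n by (auto simp: mat_vec_A interval_vec_def)

lemma euler_right_1: "euler n x (\<epsilon> 1) = x N - x 1"
proof -
  have "euler n x (\<epsilon> 1) = (\<Sum>i\<in>S. (if i = N then x i else 0) - (if i = 1 then x i else 0))"
    unfolding bilin_def by (intro sum.cong) (auto simp: mat_vec_A_1)
  also have "\<dots> = x N - x 1" using n by (simp add: sum_subtractf)
  finally show ?thesis .
qed

text \<open>\<delta> lies in the radical of the symmetrized Euler form, so the transpose of
  \<open>A\<close> acts on it as \<open>- A\<close>, and \<open>B\<close> is the transpose minus
  \<open>A\<close>.\<close>

lemma mat_vec_B_1: "mat_vec S B (\<epsilon> 1) = - (2 * mat_vec S A (\<epsilon> 1))"
proof
  fix i
  show "mat_vec S B (\<epsilon> 1) i = (- (2 * mat_vec S A (\<epsilon> 1))) i"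
  proof (cases "i \<in> S")
    case True
    then show ?thesis using n by (auto simp: mat_vec_A_1 mat_vec_B interval_vec_def)
  qed (simp add: mat_vec_def del: atLeastAtMost_iff)
qed

text \<open>By \<open>mat_vec_B_1\<close>, twice the exponent of the monomial \<open>j\<close> of
  X_\<delta> is \<open>B\<close> applied to \<open>\<epsilon> 1 - 2 * \<epsilon> j\<close>.
  Compatibility then turns the pairing into a dot product, and that into Euler forms.\<close>

lemma Lam_expo:
  "bilin S Lam (expo n (\<epsilon> 1) (\<epsilon> j)) (expo n v x) =
     2 * euler n (\<epsilon> 1) x + 2 * euler n x (\<epsilon> j) - 2 * euler n (\<epsilon> j) x - euler n (\<epsilon> 1) v + 2 * euler n (\<epsilon> j) v"
proof -
  define d where "d = \<epsilon> 1 - (\<epsilon> j + \<epsilon> j)"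
  define u where "u = expo n (\<epsilon> 1) (\<epsilon> j)"
  define w where "w = expo n v x"
  have "u + u = mat_vec S B d"
    unfolding d_def u_def expo_def mat_vec_diff mat_vec_add mat_vec_B_1 by (simp add: fun_eq_iff)
  then have "bilin S Lam u w + bilin S Lam u w = 2 * (\<Sum>k\<in>S. d k * w k)"
    using Lam_B[of d w] bilin_add_left[of S Lam u u w] by simp
  then have "bilin S Lam u w = (\<Sum>k\<in>S. d k * w k)" by simp
  also have "\<dots> = - (\<Sum>k\<in>S. d k * mat_vec S B x k) - (\<Sum>k\<in>S. d k * mat_vec S A v k)"
    unfolding w_def expo_def by (simp add: algebra_simps sum_subtractf sum_negf)
  also have "\<dots> = - (euler n x d - euler n d x) - euler n d v"
    by (simp only: dot_B bilin_def)
  also have "\<dots> = 2 * euler n (\<epsilon> 1) x + 2 * euler n x (\<epsilon> j) - 2 * euler n (\<epsilon> j) x - euler n (\<epsilon> 1) v + 2 * euler n (\<epsilon> j) v"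
    unfolding d_def bilin_diff_left bilin_diff_right bilin_add_left bilin_add_right
    by (simp add: euler_right_1 euler_interval_1)
  finally show ?thesis by (simp add: u_def w_def)
qed

section \<open>The multiplication formula, monomial by monomial\<close>

definition delta_elem :: "(nat \<Rightarrow> int) \<Rightarrow> real" where
  "delta_elem = lincomb {1..Suc N} (\<lambda>j. real q powr (- of_int (euler n (\<epsilon> j) (\<epsilon> 1 - \<epsilon> j)))) (\<lambda>j. expo n (\<epsilon> 1) (\<epsilon> j))"

definition layer_coeff :: "nat \<Rightarrow> (nat \<Rightarrow> nat) \<Rightarrow> real" where
  "layer_coeff k e = flag_count N (real (q\<^sup>2)) k e *
     real q powr (- of_int (euler n (int \<circ> e) (layer_dim n k - (int \<circ> e))))"

text \<open>Defined for all \<open>k\<close> by one formula, so that a single recursion in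
  \<open>k\<close> covers the three identities.\<close>

definition layer_elem :: "nat \<Rightarrow> (nat \<Rightarrow> int) \<Rightarrow> real" where
  "layer_elem k = lincomb (box n k) (layer_coeff k) (\<lambda>e. expo n (layer_dim n k) (int \<circ> e))"

text \<open>By \<open>flag_count_bound\<close> the coefficients are supported on entries up to
  \<open>k - 1\<close>, so layers of different index can be summed over the same box.\<close>

lemma layer_elem_box:
  assumes "k \<le> Suc K"
  shows "layer_elem k = lincomb (box n K) (layer_coeff k) (\<lambda>e. expo n (layer_dim n k) (int \<circ> e))"
proof -
  have zero: "layer_coeff k e = 0" if "e \<notin> box n L" "k \<le> Suc L" "e \<in> box n L'" for e L L'
  proof -
    have "\<exists>i. \<not> e i \<le> (if i \<in> S then L else 0)" using that(1) by (simp only: box_def mem_Collect_eq not_all)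
    then obtain i where i: "\<not> e i \<le> (if i \<in> S then L else 0)" by blast
    moreover have "e i \<le> (if i \<in> S then L' else 0)" using that(3) unfolding box_def by blast
    ultimately have iS: "i \<in> S" by (auto split: if_splits)
    then have "\<not> e i \<le> k - 1" using i that(2) by auto
    then have "flag_count N (real (q\<^sup>2)) k e = 0" using flag_count_bound[of N _ k e i] iS by blast
    then show ?thesis by (simp add: layer_coeff_def)
  qed
  have mono: "box n L \<subseteq> box n L'" if "L \<le> L'" for L L'
  proof
    fix e assume "e \<in> box n L"
    then have le: "e i \<le> (if i \<in> S then L else 0)" for i unfolding box_def by blast
    have "e i \<le> (if i \<in> S then L' else 0)" for i using le[of i] that by (auto split: if_splits)
    then show "e \<in> box n L'" unfolding box_def by blast
  qed
  have eq: "lincomb (box n L) (layer_coeff k) f = lincomb (box n L') (layer_coeff k) f"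
    if "L \<le> L'" "k \<le> Suc L" for L L' f
    unfolding lincomb_def fun_eq_iff using mono[OF that(1)] zero[OF _ that(2)] finite_box
    by (intro allI sum.mono_neutral_left) auto
  show ?thesis
  proof (cases "k \<le> K")
    case True
    then show ?thesis unfolding layer_elem_def by (intro eq) auto
  next
    case False
    then show ?thesis unfolding layer_elem_def by (intro eq[symmetric]) (use assms in auto)
  qed
qed

text \<open>Reindexing by adding \<open>\<epsilon> j\<close>. A vector of the larger box that is not
  such a shift either has an entry 0 at or after \<open>j\<close> or shifts back to a vector where
  \<open>F\<close> vanishes. The alternative with \<open>i \<notin> S\<close> in the assumption is
  needed since \<open>flag_count\<close> does not look at entries outside \<open>S\<close>.\<close>

lemma sum_box_shift:
  fixes F :: "(nat \<Rightarrow> nat) \<Rightarrow> real" and v g :: "nat \<Rightarrow> int"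
  assumes j: "1 \<le> j" and F: "\<And>e. F e \<noteq> 0 \<Longrightarrow> e \<in> box n K \<or> (\<exists>i. i \<notin> S \<and> e i \<noteq> 0)"
  shows "(\<Sum>e\<in>box n K. if g = expo n v ((int \<circ> e) + \<epsilon> j) then F e else 0) =
    (\<Sum>e\<in>box n (Suc K). if g = expo n v (int \<circ> e) then
       (if \<forall>i\<in>{j..N}. 1 \<le> e i then F (\<lambda>i. e i - (if i \<in> {j..N} then 1 else 0)) else 0) else 0)"
proof -
  let ?s = "\<lambda>e i. e i + (if i \<in> {j..N} then 1 else 0 :: nat)"
  let ?t = "\<lambda>e i. e i - (if i \<in> {j..N} then 1 else 0 :: nat)"
  let ?h = "\<lambda>e. if g = expo n v (int \<circ> e) then (if \<forall>i\<in>{j..N}. 1 \<le> e i then F (?t e) else 0) else 0"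
  have "(\<Sum>e\<in>box n K. if g = expo n v ((int \<circ> e) + \<epsilon> j) then F e else 0) = (\<Sum>e\<in>box n K. ?h (?s e))"
  proof (intro sum.cong refl)
    fix e
    have a: "int \<circ> ?s e = (int \<circ> e) + \<epsilon> j" by (auto simp: interval_vec_def fun_eq_iff)
    have b: "?t (?s e) = e" by auto
    have c: "\<forall>i\<in>{j..N}. 1 \<le> ?s e i" by auto
    show "(if g = expo n v ((int \<circ> e) + \<epsilon> j) then F e else 0) = ?h (?s e)" by (simp only: a b eqTrueI[OF c] if_True)
  qed
  also have "\<dots> = (\<Sum>e\<in>?s ` box n K. ?h e)"
    by (rule sum.reindex[symmetric, unfolded o_def]) (auto simp: inj_on_def fun_eq_iff)
  also have "\<dots> = (\<Sum>e\<in>box n (Suc K). ?h e)"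
  proof (rule sum.mono_neutral_left)
    show "?s ` box n K \<subseteq> box n (Suc K)"
    proof clarify
      fix e assume e: "e \<in> box n K"
      have "?s e i \<le> (if i \<in> S then Suc K else 0)" for i
      proof -
        have "e i \<le> (if i \<in> S then K else 0)" using e unfolding box_def by blast
        then show ?thesis using j by (auto split: if_splits)
      qed
      then show "?s e \<in> box n (Suc K)" unfolding box_def by blast
    qed
    show "\<forall>e\<in>box n (Suc K) - ?s ` box n K. ?h e = 0"
    proof
      fix e assume e: "e \<in> box n (Suc K) - ?s ` box n K"
      have eb: "e \<in> box n (Suc K)" using e by (rule DiffD1)
      show "?h e = 0"
      proof (rule ccontr)
        assume "?h e \<noteq> 0"
        moreover have "(if P then (if R then x else 0) else 0) \<noteq> 0 \<Longrightarrow> R \<and> x \<noteq> 0" for P R and x :: real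
          by (simp split: if_splits)
        ultimately have "(\<forall>i\<in>{j..N}. 1 \<le> e i) \<and> F (?t e) \<noteq> 0" by blast
        then have p: "\<forall>i\<in>{j..N}. 1 \<le> e i" and Fe: "F (?t e) \<noteq> 0" by (rule conjunct1, rule conjunct2)
        have le: "e i \<le> (if i \<in> S then Suc K else 0)" for i using eb unfolding box_def by blast
        have z: "?t e i = 0" if "i \<notin> S" for i
        proof -
          have "e i = 0" using le[of i] that by (simp only: if_not_P le_zero_eq if_False)
          then show ?thesis by simp
        qed
        from F[OF Fe] have tb: "?t e \<in> box n K"
        proof
          assume "\<exists>i. i \<notin> S \<and> ?t e i \<noteq> 0"
          then obtain i where i: "i \<notin> S" "?t e i \<noteq> 0" by blast
          show ?thesis by (rule notE[OF i(2) z[OF i(1)]])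
        qed
        have se: "?s (?t e) = e"
        proof
          fix i show "?s (?t e) i = e i" using p by auto
        qed
        have "?s (?t e) \<in> ?s ` box n K" by (rule imageI[OF tb])
        then have "e \<in> ?s ` box n K" by (simp only: se)
        then show False using e by blast
      qed
    qed
  qed (rule finite_box)
  finally show ?thesis .
qed

text \<open>After reindexing, the coefficient at \<open>e\<close> is a sum over \<open>j\<close>.
  Relative to the power of \<open>q\<close> in the layer \<open>k + 2\<close>, the summand
  \<open>j\<close> carries \<open>q\<close> to twice an Euler form with \<open>\<epsilon> j\<close>,
  and this is the power of \<open>q\<^sup>2\<close> attached to \<open>j\<close> in
  \<open>flag_count\<close>.\<close>

theorem delta_mult_layer:
  "delta_elem \<otimes>\<^bsub>qtorus q n\<^esub> layer_elem (Suc k) =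
     (\<lambda>g. real q powr (1/2) * layer_elem (Suc (Suc k)) g + real q powr (- 1/2) * layer_elem k g)"
proof
  fix g
  define v where "v = layer_dim n (Suc k)"
  define v' where "v' = layer_dim n (Suc (Suc k))"
  define K where "K = Suc k"
  let ?t = "\<lambda>j e i. e i - (if i \<in> {j..N} then 1 else 0 :: nat)"
  let ?C = "\<lambda>k. flag_count N (real (q\<^sup>2)) k"
  have q0: "real q > 0" using q by simp
  have v1: "v' = v + \<epsilon> 1" "layer_dim n k = v - \<epsilon> 1"
    by (auto simp: v_def v'_def layer_dim_def interval_vec_def fun_eq_iff)
  have dv: "euler n (\<epsilon> 1) v = - 1" using n by (simp add: euler_interval_1 v_def layer_dim_def)
  have exp1: "expo n (\<epsilon> 1) (\<epsilon> j) + expo n v x = expo n v' (x + \<epsilon> j)" for j x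
    unfolding expo_def v1 mat_vec_add by (simp add: fun_eq_iff)
  have exp2: "expo n (layer_dim n k) x = expo n v' (x + \<epsilon> 1)" for x
    unfolding expo_def v1 mat_vec_add mat_vec_diff mat_vec_B_1 by (simp add: fun_eq_iff)
  \<comment> \<open>The total power of \<open>q\<close> in the product of the monomials
    \<open>j\<close> and \<open>x\<close>, arranged around the power that belongs to
    \<open>x + \<epsilon> j\<close> in the layer \<open>k + 2\<close>. The \<open>1/2\<close> stems
    from \<open>dv\<close>, as half of the negated defect of \<open>v\<close>.\<close>
  define T where "T j x = 1/2 - real_of_int (euler n (x + \<epsilon> j) (v' - (x + \<epsilon> j))) + 2 * real_of_int (euler n (\<epsilon> j) (v - x))" for j x
  have T: "- real_of_int (euler n (\<epsilon> j) (\<epsilon> 1 - \<epsilon> j)) + - of_int (euler n x (v - x)) +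
      of_int (bilin S Lam (expo n (\<epsilon> 1) (\<epsilon> j)) (expo n v x)) / 2 = T j x" for j x
    unfolding Lam_expo T_def v1 dv bilin_diff_left bilin_diff_right bilin_add_left bilin_add_right
    by (simp add: euler_right_1 euler_interval_1)
  \<comment> \<open>For \<open>j = 1\<close> the same power also belongs to \<open>x\<close> in the
    layer \<open>k\<close>, up to the factor \<open>q\<close> to the power -1/2.\<close>
  have T1: "- 1/2 - real_of_int (euler n x (layer_dim n k - x)) = T 1 x" for x
    unfolding T_def v1 dv bilin_diff_left bilin_diff_right bilin_add_left bilin_add_right dv
    by (simp add: euler_right_1 euler_interval_1)
  define R where "R e = 1/2 - real_of_int (euler n (int \<circ> e) (v' - (int \<circ> e)))" for e :: "nat \<Rightarrow> nat"
  have supp: "F (e :: nat \<Rightarrow> nat) * ?C m e \<noteq> 0 \<Longrightarrow> m \<le> Suc K \<Longrightarrow> e \<in> box n K \<or> (\<exists>i. i \<notin> S \<and> e i \<noteq> 0)" for F e m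
  proof -
    assume nz: "F e * ?C m e \<noteq> 0" and m: "m \<le> Suc K"
    have "e i \<le> K" if "i \<in> S" for i
      using flag_count_bound[of N "real (q\<^sup>2)" m e i] nz that m by auto
    then show ?thesis unfolding box_def by auto
  qed
  have pos: "(int \<circ> ?t j e) + \<epsilon> j = int \<circ> e" if "\<forall>i\<in>{j..N}. 1 \<le> e i" for j and e :: "nat \<Rightarrow> nat"
    using that by (auto simp: interval_vec_def fun_eq_iff)
  have shift: "T j (int \<circ> ?t j e) = R e + 2 * of_int (euler n (\<epsilon> j) (v - (int \<circ> ?t j e)))"
    if "\<forall>i\<in>{j..N}. 1 \<le> e i" for j and e :: "nat \<Rightarrow> nat"
    unfolding T_def R_def pos[OF that] by simp
  \<comment> \<open>The factor 2 turns powers of \<open>q\<close> into powers of the size of the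
    extension field.\<close>
  have powQ: "real q powr (R e + 2 * of_int z) = real q powr R e * real (q\<^sup>2) powi z" for e z
  proof -
    have "real q powr 2 = real (q\<^sup>2)" using q0 by simp
    then have "real q powr (2 * real_of_int z) = real (q\<^sup>2) powr real_of_int z"
      using powr_powr[of "real q" 2 "real_of_int z"] by (simp only:)
    also have "\<dots> = real (q\<^sup>2) powi z" using q0 by (simp add: powr_real_of_int')
    finally show ?thesis by (simp add: powr_add)
  qed
  define G where "G j e = (if \<forall>i\<in>{j..N}. 1 \<le> e i then real q powr T j (int \<circ> ?t j e) * ?C (Suc k) (?t j e) else 0)" for j e
  have "(delta_elem \<otimes>\<^bsub>qtorus q n\<^esub> layer_elem (Suc k)) g =
      (\<Sum>j\<in>{1..Suc N}. \<Sum>e\<in>box n K. if g = expo n v' ((int \<circ> e) + \<epsilon> j) then real q powr T j (int \<circ> e) * ?C (Suc k) e else 0)"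
  proof -
    have "(delta_elem \<otimes>\<^bsub>qtorus q n\<^esub> layer_elem (Suc k)) g =
      (\<Sum>j\<in>{1..Suc N}. \<Sum>e\<in>box n K. if g = expo n (\<epsilon> 1) (\<epsilon> j) + expo n v (int \<circ> e) then
         real q powr (- of_int (euler n (\<epsilon> j) (\<epsilon> 1 - \<epsilon> j))) * layer_coeff (Suc k) e *
         real q powr (of_int (bilin S Lam (expo n (\<epsilon> 1) (\<epsilon> j)) (expo n v (int \<circ> e))) / 2) else 0)"
      unfolding delta_elem_def layer_elem_def mult_lincomb[OF finite_atLeastAtMost finite_box]
        lincomb_def sum.cartesian_product K_def v_def
      by (rule sum.cong[OF refl]) (auto simp only: split_def)
    also have "\<dots> = (\<Sum>j\<in>{1..Suc N}. \<Sum>e\<in>box n K. if g = expo n v' ((int \<circ> e) + \<epsilon> j) then real q powr T j (int \<circ> e) * ?C (Suc k) e else 0)"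
      unfolding exp1 layer_coeff_def T[symmetric] powr_add v_def[symmetric] by (intro sum.cong refl) (simp add: mult_ac)
    finally show ?thesis .
  qed
  also have "\<dots> = (\<Sum>j\<in>{1..Suc N}. \<Sum>e\<in>box n (Suc K). if g = expo n v' (int \<circ> e) then G j e else 0)"
  proof (rule sum.cong[OF refl])
    fix j assume j: "j \<in> {1..Suc N}"
    show "(\<Sum>e\<in>box n K. if g = expo n v' ((int \<circ> e) + \<epsilon> j) then real q powr T j (int \<circ> e) * ?C (Suc k) e else 0)
      = (\<Sum>e\<in>box n (Suc K). if g = expo n v' (int \<circ> e) then G j e else 0)"
      unfolding G_def
      by (rule sum_box_shift[where F = "\<lambda>e. real q powr T j (int \<circ> e) * ?C (Suc k) e"])
         (use supp[of "\<lambda>e. real q powr T j (int \<circ> e)" _ "Suc k"] j K_def in auto)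
  qed
  also have "\<dots> = (\<Sum>e\<in>box n (Suc K). if g = expo n v' (int \<circ> e) then (\<Sum>j\<in>{1..Suc N}. G j e) else 0)"
    by (subst sum.swap) (auto intro!: sum.cong)
  also have "\<dots> = (\<Sum>e\<in>box n (Suc K). if g = expo n v' (int \<circ> e) then real q powr R e * ?C (Suc (Suc k)) e +
      (if \<forall>i\<in>{1..N}. 1 \<le> e i then real q powr T 1 (int \<circ> ?t 1 e) * ?C k (?t 1 e) else 0) else 0)"
  proof (intro sum.cong refl if_cong)
    fix e :: "nat \<Rightarrow> nat" assume "e \<in> box n (Suc K)"
    have split: "{1..Suc N} = insert 1 (insert (Suc N) {2..N})" using n by auto
    have last: "G (Suc N) e = real q powr R e * ?C (Suc k) e"
    proof -
      have "?t (Suc N) e = e" by auto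
      moreover have "T (Suc N) (int \<circ> ?t (Suc N) e) = R e"
        using shift[of "Suc N" e] by (simp add: euler_interval_last)
      ultimately show ?thesis by (simp add: G_def)
    qed
    have mid: "G j e = real q powr R e * (if \<forall>i\<in>{j..N}. 1 \<le> e i then
        real (q\<^sup>2) powi (int (Suc k) - int (e j)) * ?C (Suc k) (?t j e) else 0)" if j: "j \<in> {2..N}" for j
    proof (cases "\<forall>i\<in>{j..N}. 1 \<le> e i")
      case True
      have "euler n (\<epsilon> j) (v - (int \<circ> ?t j e)) = int (Suc k) - int (e j)"
        using True j by (auto simp: euler_interval v_def layer_dim_def of_nat_diff)
      then have "real q powr T j (int \<circ> ?t j e) = real q powr R e * real (q\<^sup>2) powi (int (Suc k) - int (e j))"
        using shift[OF True] powQ[of e "int (Suc k) - int (e j)"] by simp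
      then show ?thesis using True by (simp add: G_def mult_ac)
    next
      case False
      show ?thesis unfolding G_def if_not_P[OF False] by simp
    qed
    have first: "real q powr T 1 (int \<circ> ?t 1 e) = real q powr R e * real (q\<^sup>2) powi (int (e N) - int (e 1) - 1)"
      if p: "\<forall>i\<in>{1..N}. 1 \<le> e i"
    proof -
      have "1 \<le> e 1" "1 \<le> e N" using p n by auto
      then have "euler n (\<epsilon> 1) (v - (int \<circ> ?t 1 e)) = int (e N) - int (e 1) - 1"
        using n by (simp add: euler_interval_1 v_def layer_dim_def of_nat_diff)
      then show ?thesis
        using shift[of 1 e] p powQ[of e "int (e N) - int (e 1) - 1"] by simp
    qed
    have "(\<Sum>j\<in>{1..Suc N}. G j e) = G 1 e + G (Suc N) e + (\<Sum>j\<in>{2..N}. G j e)"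
      unfolding split using n by simp
    also have "(\<Sum>j\<in>{2..N}. G j e) = real q powr R e * (\<Sum>j\<in>{2..N}. if \<forall>i\<in>{j..N}. 1 \<le> e i then
        real (q\<^sup>2) powi (int (Suc k) - int (e j)) * ?C (Suc k) (?t j e) else 0)"
      unfolding sum_distrib_left by (intro sum.cong refl mid)
    finally have sumG: "(\<Sum>j\<in>{1..Suc N}. G j e) = G 1 e + G (Suc N) e + real q powr R e *
      (\<Sum>j\<in>{2..N}. if \<forall>i\<in>{j..N}. 1 \<le> e i then
        real (q\<^sup>2) powi (int (Suc k) - int (e j)) * ?C (Suc k) (?t j e) else 0)" .
    show "(\<Sum>j\<in>{1..Suc N}. G j e) = real q powr R e * ?C (Suc (Suc k)) e +
      (if \<forall>i\<in>{1..N}. 1 \<le> e i then real q powr T 1 (int \<circ> ?t 1 e) * ?C k (?t 1 e) else 0)"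
    proof (cases "\<forall>i\<in>{1..N}. 1 \<le> e i")
      case True
      \<comment> \<open>The recursion contains a difference for \<open>j = 1\<close>, the product
        only its first term. Adding the second term back gives the contribution of the layer
        \<open>k\<close>.\<close>
      have alg: "r * p * a + r * b + r * s = r * (b + s + p * (a - c)) + r * p * c" for r p a b s c :: real
        by (simp add: algebra_simps)
      have g1: "G 1 e = real q powr R e * real (q\<^sup>2) powi (int (e N) - int (e 1) - 1) * ?C (Suc k) (?t 1 e)"
        unfolding G_def if_P[OF True] first[OF True] ..
      show ?thesis unfolding sumG last g1 flag_count.simps if_P[OF True] first[OF True] by (rule alg)
    next
      case False
      have alg: "0 + r * b + r * s = r * (b + s + 0) + 0" for r b s :: real
        by (simp add: algebra_simps)
      have g1: "G 1 e = 0" unfolding G_def if_not_P[OF False] ..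
      show ?thesis unfolding sumG last g1 flag_count.simps if_not_P[OF False] by (rule alg)
    qed
  qed
  also have "\<dots> = (\<Sum>e\<in>box n (Suc K). if g = expo n v' (int \<circ> e) then real q powr R e * ?C (Suc (Suc k)) e else 0) +
      (\<Sum>e\<in>box n (Suc K). if g = expo n v' (int \<circ> e) then
        (if \<forall>i\<in>{1..N}. 1 \<le> e i then real q powr T 1 (int \<circ> ?t 1 e) * ?C k (?t 1 e) else 0) else 0)"
    by (subst sum.distrib[symmetric]) (auto intro!: sum.cong)
  also have "(\<Sum>e\<in>box n (Suc K). if g = expo n v' (int \<circ> e) then
        (if \<forall>i\<in>{1..N}. 1 \<le> e i then real q powr T 1 (int \<circ> ?t 1 e) * ?C k (?t 1 e) else 0) else 0)
      = (\<Sum>e\<in>box n K. if g = expo n v' ((int \<circ> e) + \<epsilon> 1) then real q powr T 1 (int \<circ> e) * ?C k e else 0)"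
    by (rule sum_box_shift[where F = "\<lambda>e. real q powr T 1 (int \<circ> e) * ?C k e", symmetric])
       (use supp[of "\<lambda>e. real q powr T 1 (int \<circ> e)" _ k] K_def in auto)
  also have "\<dots> = real q powr (- 1/2) * layer_elem k g"
  proof -
    have "real q powr T 1 x = real q powr (- 1/2) * real q powr (- of_int (euler n x (layer_dim n k - x)))" for x
      unfolding T1[symmetric] by (simp flip: powr_add)
    then show ?thesis
      using layer_elem_box[of k K] by (auto simp: K_def lincomb_def exp2 layer_coeff_def sum_distrib_left intro!: sum.cong)
  qed
  also have "(\<Sum>e\<in>box n (Suc K). if g = expo n v' (int \<circ> e) then real q powr R e * ?C (Suc (Suc k)) e else 0)
      = real q powr (1/2) * layer_elem (Suc (Suc k)) g"
  proof -
    have "real q powr R e = real q powr (1/2) * real q powr (- of_int (euler n (int \<circ> e) (v' - (int \<circ> e))))" for e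
      unfolding R_def by (simp flip: powr_add)
    then show ?thesis
      unfolding layer_elem_def K_def v'_def lincomb_def layer_coeff_def sum_distrib_left by (auto simp del: flag_count.simps intro!: sum.cong)
  qed
  finally show "(delta_elem \<otimes>\<^bsub>qtorus q n\<^esub> layer_elem (Suc k)) g =
    real q powr (1/2) * layer_elem (Suc (Suc k)) g + real q powr (- 1/2) * layer_elem k g" .
qed

end

end

section \<open>The affine quiver\<close>

lemma card_degree2_extension:
  fixes \<iota> :: "'f::{field,finite} \<Rightarrow> 'k::field"
  assumes "degree2_extension \<iota>"
  shows "finite (UNIV :: 'k set)" "CARD('k) = CARD('f)\<^sup>2"
proof -
  interpret e: vector_space "\<lambda>a (x::'k). \<iota> a * x"
    using assms by unfold_locales (auto simp: degree2_extension_def algebra_simps)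
  have "e.dim UNIV = 2" using assms by (simp add: degree2_extension_def)
  then obtain B where B: "e.independent B" "UNIV \<subseteq> e.span B" "card B = 2"
    using e.basis_exists[of UNIV] by metis
  then have "finite B" by (metis card.infinite zero_neq_numeral)
  then have "finite (e.span B) \<and> card (e.span B) = CARD('f) ^ card B"
    using e.finite_card_span_independent[of B] B(1) by simp
  moreover have "e.span B = UNIV" using B(2) by auto
  ultimately show "finite (UNIV :: 'k set)" "CARD('k) = CARD('f)\<^sup>2" using B(3) by auto
qed

section \<open>Grassmannians of the preprojective representations\<close>

lemma Qaff_simps [simp]:
  "verts (Qaff n) = {1..2*n}" "arcs (Qaff n) = {1..2*n}"
  "tail (Qaff n) a = (if a = 2*n then 1 else a)" "head (Qaff n) a = (if a = 2*n then 2*n else a + 1)"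
  by (simp_all add: Qaff_def)

text \<open>Passage to \<open>affine_rep\<close>: each action is extended to a map
  \<open>m a\<close> linear on the whole space, and subrepresentations in the sense of
  \<open>subreps\<close> are the extensional families with \<open>subrep\<close>. Complements
  obtained in the locale are restricted to the vertices before indecomposability applies to
  them.\<close>

lemma quiver_grass_preprojective:
  fixes V :: "'k::field rep"
  assumes fin: "finite (UNIV :: 'k set)" and n: "n \<ge> 2" and V: "is_rep (Qaff n) V" "indecomposable (Qaff n) V"
    and dims: "\<And>i. i \<in> {1..2*n} \<Longrightarrow> dimv (Qaff n) V i = (if i = 1 then l else Suc l)"
  shows "real (card (quiver_grass (Qaff n) e V)) = flag_count (2*n) (real CARD('k)) (l + 2) e"
proof -
  let ?S = "{1..2*n}"
  have sub: "pv.subspace (sp V i)" and finV: "finite (sp V i)" if i: "i \<in> ?S" for i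
  proof -
    show "pv.subspace (sp V i)" using V(1) i by (simp add: is_rep_def)
    obtain T where "finite T" "pv.span T = sp V i" using bspec[OF conjunct1[OF V(1)[unfolded is_rep_def Qaff_simps(1)]] i] by blast
    then show "finite (sp V i)" using pv.finite_span[OF fin] by metis
  qed
  have lin: "linear_into (sp V (tail (Qaff n) a)) (sp V (head (Qaff n) a)) (act V a)" if "a \<in> ?S" for a
    using V(1) that unfolding is_rep_def Qaff_simps(2) by blast
  have tl: "tail (Qaff n) a \<in> ?S" if "a \<in> ?S" for a using that n by auto
  have "\<forall>a\<in>?S. \<exists>m. Vector_Spaces.linear pscale pscale m \<and> (\<forall>x\<in>sp V (tail (Qaff n) a). m x = act V a x)"
  proof
    fix a assume a: "a \<in> ?S"
    obtain g where "Vector_Spaces.linear pscale pscale g" "\<And>x. x \<in> sp V (tail (Qaff n) a) \<Longrightarrow> g x = act V a x"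
      by (rule pv.linear_extend_from_subspace[OF sub[OF tl[OF a]], of "act V a"])
         (use lin[OF a] in \<open>auto simp only: linear_into_def\<close>)
    then show "\<exists>m. Vector_Spaces.linear pscale pscale m \<and> (\<forall>x\<in>sp V (tail (Qaff n) a). m x = act V a x)" by blast
  qed
  then obtain m where m: "\<And>a. a \<in> ?S \<Longrightarrow> Vector_Spaces.linear pscale pscale (m a)"
    "\<And>a x. a \<in> ?S \<Longrightarrow> x \<in> sp V (tail (Qaff n) a) \<Longrightarrow> m a x = act V a x" by metis
  have mV: "m a x \<in> sp V (head (Qaff n) a)" if "a \<in> ?S" "x \<in> sp V (tail (Qaff n) a)" for a x
    using lin[OF that(1)] that(2) m(2)[OF that] by (simp only: linear_into_def)
  interpret A: affine_rep pscale "2*n" "sp V" m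
  proof (intro affine_rep.intro affine_rep_axioms.intro)
    show "m a v \<in> sp V (Suc a)" if "a \<in> {1..<2*n}" "v \<in> sp V a" for a v
      using mV[of a v] that by auto
    show "m (2*n) v \<in> sp V (2*n)" if "v \<in> sp V 1" for v
      using mV[of "2*n" v] that n by auto
  qed (use fin n sub finV m(1) pv.vector_space_axioms in auto)
  have subreps: "U \<in> subreps (Qaff n) V \<longleftrightarrow> U \<in> extensional ?S \<and> A.subrep U" for U
  proof -
    have "(\<forall>a\<in>?S. act V a ` U (tail (Qaff n) a) \<subseteq> U (head (Qaff n) a)) \<longleftrightarrow>
        (\<forall>a\<in>{1..<2*n}. \<forall>v\<in>U a. m a v \<in> U (Suc a)) \<and> (\<forall>v\<in>U 1. m (2*n) v \<in> U (2*n))"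
      if U: "\<forall>i\<in>?S. pv.subspace (U i) \<and> U i \<subseteq> sp V i"
    proof -
      have "(\<forall>a\<in>?S. act V a ` U (tail (Qaff n) a) \<subseteq> U (head (Qaff n) a)) \<longleftrightarrow>
        (\<forall>a\<in>?S. \<forall>v\<in>U (tail (Qaff n) a). m a v \<in> U (head (Qaff n) a))"
      proof (rule ball_cong[OF refl])
        fix a assume a: "a \<in> ?S"
        have "m a v = act V a v" if "v \<in> U (tail (Qaff n) a)" for v
          using m(2)[OF a] U tl[OF a] that by blast
        then show "(act V a ` U (tail (Qaff n) a) \<subseteq> U (head (Qaff n) a)) = (\<forall>v\<in>U (tail (Qaff n) a). m a v \<in> U (head (Qaff n) a))"
          by (auto simp only: image_subset_iff)
      qed
      also have "(\<forall>a\<in>?S. \<forall>v\<in>U (tail (Qaff n) a). m a v \<in> U (head (Qaff n) a)) \<longleftrightarrow>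
          (\<forall>v\<in>U 1. m (2*n) v \<in> U (2*n)) \<and> (\<forall>a\<in>{1..<2*n}. \<forall>v\<in>U (tail (Qaff n) a). m a v \<in> U (head (Qaff n) a))"
      proof -
        have "?S = insert (2*n) {1..<2*n}" using n by auto
        then show ?thesis by (simp only: ball_simps Qaff_simps simp_thms if_True)
      qed
      also have "(\<forall>a\<in>{1..<2*n}. \<forall>v\<in>U (tail (Qaff n) a). m a v \<in> U (head (Qaff n) a)) \<longleftrightarrow>
          (\<forall>a\<in>{1..<2*n}. \<forall>v\<in>U a. m a v \<in> U (Suc a))"
        by (rule ball_cong[OF refl]) simp
      finally show ?thesis by (simp only: conj_commute)
    qed
    then show ?thesis unfolding subreps_def A.subrep_def mem_Collect_eq Qaff_simps(1,2) by blast
  qed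
  have subrep_restrict: "restrict C ?S \<in> subreps (Qaff n) V" if C: "A.subrep C" for C
  proof -
    have "A.subrep (restrict C ?S)" using C n unfolding A.subrep_def by auto
    then show ?thesis unfolding subreps by simp
  qed
  have d: "pv.dim (sp V i) = (if i = 1 then l else Suc l)" if "i \<in> ?S" for i
    using dims[OF that] that by (simp add: dimv_def)
  have neg: "A.defect U < 0" if U: "A.subrep U" "j \<in> ?S" "U j \<noteq> {0}" for U j
  proof (rule A.negative_defect[OF _ _ U])
    have "1 \<in> ?S" "2*n \<in> ?S" "2*n \<noteq> 1" using n by auto
    then show "A.defect (sp V) < 0" using d[of 1] d[of "2*n"] by (simp add: A.defect_def)
  next
    fix C X assume C: "A.subrep C" and X: "A.subrep X"
      and int: "\<And>i. i \<in> ?S \<Longrightarrow> C i \<inter> X i = {0}" and sum: "\<And>i v. i \<in> ?S \<Longrightarrow> v \<in> sp V i \<Longrightarrow> \<exists>x\<in>X i. v - x \<in> C i"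
    have "restrict C ?S i \<inter> restrict X ?S i = {0} \<and> {x + y |x y. x \<in> restrict C ?S i \<and> y \<in> restrict X ?S i} = sp V i"
      if i: "i \<in> ?S" for i
    proof
      show "restrict C ?S i \<inter> restrict X ?S i = {0}" using int[OF i] i by simp
      have "{x + y |x y. x \<in> C i \<and> y \<in> X i} = sp V i"
      proof (intro equalityI subsetI)
        fix v assume "v \<in> {x + y |x y. x \<in> C i \<and> y \<in> X i}"
        then show "v \<in> sp V i"
          using A.subrepD(2)[OF C i] A.subrepD(2)[OF X i] pv.subspace_add[OF sub[OF i]] by blast
      next
        fix v assume "v \<in> sp V i"
        then obtain x where x: "x \<in> X i" "v - x \<in> C i" using sum[OF i] by blast
        have "v = (v - x) + x" by simp
        then show "v \<in> {x + y |x y. x \<in> C i \<and> y \<in> X i}" using x by blast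
      qed
      then show "{x + y |x y. x \<in> restrict C ?S i \<and> y \<in> restrict X ?S i} = sp V i" using i by simp
    qed
    note all = this
    have "\<not> ((\<exists>i\<in>?S. restrict C ?S i \<noteq> {0}) \<and> (\<exists>i\<in>?S. restrict X ?S i \<noteq> {0}))"
    proof
      assume h: "(\<exists>i\<in>?S. restrict C ?S i \<noteq> {0}) \<and> (\<exists>i\<in>?S. restrict X ?S i \<noteq> {0})"
      define Dec where "Dec U W \<longleftrightarrow> (\<exists>i\<in>?S. U i \<noteq> {0}) \<and> (\<exists>i\<in>?S. W i \<noteq> {0}) \<and>
          (\<forall>i\<in>?S. U i \<inter> W i = {0} \<and> {x + y |x y. x \<in> U i \<and> y \<in> W i} = sp V i)" for U W
      have "Dec (restrict C ?S) (restrict X ?S)"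
        unfolding Dec_def by (rule conjI[OF conjunct1[OF h] conjI[OF conjunct2[OF h] ballI]]) (rule all)
      moreover have "\<not> (\<exists>U\<in>subreps (Qaff n) V. \<exists>W\<in>subreps (Qaff n) V. Dec U W)"
        using V(2) by (simp only: indecomposable_def Qaff_simps(1) Dec_def simp_thms)
      ultimately show False using subrep_restrict[OF C] subrep_restrict[OF X] by blast
    qed
    moreover have "restrict C ?S i = C i" "restrict X ?S i = X i" if "i \<in> ?S" for i
      using that by simp_all
    ultimately have "\<not> ((\<exists>i\<in>?S. C i \<noteq> {0}) \<and> (\<exists>i\<in>?S. X i \<noteq> {0}))"
      by (simp only: simp_thms cong: bex_cong)
    then show "(\<forall>i\<in>?S. C i = {0}) \<or> (\<forall>i\<in>?S. X i = {0})" by blast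
  qed
  have d2: "\<And>i. i \<in> {2..2*n} \<Longrightarrow> pv.dim (sp V i) = Suc l" and d1: "pv.dim (sp V 1) = l"
    using d n by auto
  show ?thesis
  proof (rule A.subreps_as_nested_flags)
    show "A.defect U < 0" if "A.subrep U" "j \<in> ?S" "U j \<noteq> {0}" for U j by (rule neg[OF that])
    show "pv.dim (sp V 1) = l" by (rule d1)
    show "pv.dim (sp V i) = Suc l" if "i \<in> {2..2*n}" for i by (rule d2[OF that])
  next
    fix W b
    assume W: "pv.subspace W" "W \<subseteq> sp V (2*n)" "pv.dim W = l" "Vector_Spaces.linear pscale pscale b"
      "\<And>v. v \<in> W \<Longrightarrow> b v \<in> sp V (2*n)" "\<And>T. pv.subspace T \<Longrightarrow> T \<subseteq> W \<Longrightarrow> b ` T \<subseteq> T \<Longrightarrow> T = {0}"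
      "\<And>e. card {U \<in> extensional ?S. A.subrep U \<and> (\<forall>i\<in>?S. pv.dim (U i) = e i)} = card (pv.nested_flags (2*n) W (sp V (2*n)) b e)"
    have c: "2*n \<in> ?S" "2*n \<noteq> 1" "2*n \<ge> 3" using n by auto
    have "quiver_grass (Qaff n) e V = {U \<in> extensional ?S. A.subrep U \<and> (\<forall>i\<in>?S. pv.dim (U i) = e i)}"
      unfolding quiver_grass_def subreps Qaff_simps(1) by blast
    then have "card (quiver_grass (Qaff n) e V) = card (pv.nested_flags (2*n) W (sp V (2*n)) b e)"
      using W(7) by simp
    moreover have "real (card (pv.nested_flags (2*n) W (sp V (2*n)) b e)) = flag_count (2*n) (real CARD('k)) (l + 2) e"
      by (rule pv.card_nested_flags[OF fin c(3) W(4) W(1,2) finV[OF c(1)] sub[OF c(1)] W(5,6)])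
         (use d[OF c(1)] c W(3) in auto)
    ultimately show ?thesis by simp
  qed
qed

section \<open>Paths, projective representations and their tops\<close>

definition unit_vec :: "nat list \<Rightarrow> 'k::field pvec" where "unit_vec p = (\<lambda>r. if r = p then 1 else 0)"

lemma subspace_supported: "pv.subspace {v :: 'k::field pvec. \<forall>p. v p \<noteq> 0 \<longrightarrow> P p}"
  by (rule pv.subspaceI) (auto simp: pscale_def, metis add.right_neutral)

lemma supported_on_single: "{v :: 'k::field pvec. \<forall>p. v p \<noteq> 0 \<longrightarrow> p = r} = range (\<lambda>c. pscale c (unit_vec r))"
proof (intro equalityI subsetI)
  fix v :: "'k pvec" assume "v \<in> {v. \<forall>p. v p \<noteq> 0 \<longrightarrow> p = r}"
  then have "v = pscale (v r) (unit_vec r)" by (auto simp: fun_eq_iff pscale_def unit_vec_def)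
  then show "v \<in> range (\<lambda>c. pscale c (unit_vec r))" by (rule range_eqI)
qed (auto simp: pscale_def unit_vec_def split: if_splits)

lemma dim_supported_on_single: "pv.dim {v :: 'k::field pvec. \<forall>p. v p \<noteq> 0 \<longrightarrow> p = r} = 1"
proof -
  have "unit_vec r \<noteq> (0 :: 'k pvec)" by (auto simp: unit_vec_def fun_eq_iff)
  then have "pv.independent {unit_vec r :: 'k pvec}" by simp
  then have "pv.dim (pv.span {unit_vec r :: 'k pvec}) = card {unit_vec r :: 'k pvec}"
    by (rule pv.dim_span_eq_card_independent)
  also have "\<dots> = 1" by simp
  finally show ?thesis by (simp only: pv.span_singleton supported_on_single)
qed

lemma subspace_of_single:
  assumes "pv.subspace U" "U \<subseteq> {v :: 'k::field pvec. \<forall>p. v p \<noteq> 0 \<longrightarrow> p = r}"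
  shows "U = {0} \<or> U = {v. \<forall>p. v p \<noteq> 0 \<longrightarrow> p = r}"
proof (cases "U = {0}")
  case False
  then obtain v where v: "v \<in> U" "v \<noteq> 0" using pv.subspace_0[OF assms(1)] by blast
  then have eq: "v = pscale (v r) (unit_vec r)" using assms(2) by (auto simp: fun_eq_iff pscale_def unit_vec_def)
  have "v r \<noteq> 0"
  proof
    assume "v r = 0"
    then have "v = 0" using eq by (metis pv.scale_zero_left)
    then show False using v by simp
  qed
  then have "unit_vec r = pscale (inverse (v r)) v" using eq by (metis pv.scale_one pv.scale_scale left_inverse)
  then have "unit_vec r \<in> U" using pv.subspace_scale[OF assms(1) v(1)] by metis
  then have "{v. \<forall>p. v p \<noteq> 0 \<longrightarrow> p = r} \<subseteq> U"
    unfolding supported_on_single using pv.subspace_scale[OF assms(1)] by blast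
  then show ?thesis using assms(2) by blast
qed simp

text \<open>The chord starts at the source \<open>1\<close> and ends at the sink, where no arc
  begins, so it cannot be combined with other arcs.\<close>

lemma cas_Qaff:
  assumes "n \<ge> 2" "pre_digraph.cas (Qaff n) i p j" "set p \<subseteq> {1..2*n}" "i \<in> {1..2*n}"
  shows "i \<le> j \<and> p = [i..<j] \<or> i = 1 \<and> j = 2*n \<and> p = [2*n]"
  using assms(2-)
proof (induction p arbitrary: i)
  case Nil
  then show ?case by (simp add: pre_digraph.cas.simps)
next
  case (Cons a p)
  then have a: "tail (Qaff n) a = i" "pre_digraph.cas (Qaff n) (head (Qaff n) a) p j" "a \<in> {1..2*n}"
    by (simp_all add: pre_digraph.cas.simps del: Qaff_simps)
  show ?case
  proof (cases "a = 2*n")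
    case True
    have "p = []"
    proof (cases p)
      case (Cons b r)
      then have "tail (Qaff n) b = 2*n" using a True by (simp add: pre_digraph.cas.simps)
      then show ?thesis using assms(1) by (auto split: if_splits)
    qed
    then show ?thesis using a True by (simp add: pre_digraph.cas.simps)
  next
    case False
    then have "a = i" "pre_digraph.cas (Qaff n) (i + 1) p j" "i + 1 \<in> {1..2*n}" using a Cons.prems(3) by auto
    then have "i + 1 \<le> j \<and> p = [i + 1..<j]" using Cons.IH[of "i + 1"] Cons.prems by auto
    then show ?thesis using \<open>a = i\<close> by (simp add: upt_conv_Cons)
  qed
qed

lemma awalk_Qaff:
  assumes "n \<ge> 2" "pre_digraph.awalk (Qaff n) i p j"
  shows "i \<in> {1..2*n}" "i \<le> j" "p = [i..<j] \<or> i = 1 \<and> j = 2*n \<and> p = [2*n]"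
  using cas_Qaff[OF assms(1), of i p j] assms(2) by (auto simp: pre_digraph.awalk_def)

lemma awalk_Qaff_self:
  assumes "n \<ge> 2" "i \<in> {1..2*n}"
  shows "pre_digraph.awalk (Qaff n) i p i \<longleftrightarrow> p = []"
  using awalk_Qaff[OF assms(1), of i p i] assms by (auto simp: pre_digraph.awalk_def pre_digraph.cas.simps)

lemma cas_snoc: "pre_digraph.cas G u (p @ [a]) v \<longleftrightarrow> pre_digraph.cas G u p (tail G a) \<and> head G a = v"
  by (induction p arbitrary: u) (auto simp: pre_digraph.cas.simps)

lemma awalk_snoc: "pre_digraph.awalk G u (p @ [a]) v \<longleftrightarrow> pre_digraph.awalk G u p (tail G a) \<and> a \<in> arcs G \<and> head G a = v"
  by (auto simp: pre_digraph.awalk_def cas_snoc)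

lemma awalk_Qaff_upt:
  assumes "i \<in> {1..2*n}" "i \<le> j" "j \<le> 2*n"
  shows "pre_digraph.awalk (Qaff n) i [i..<j] j"
  using assms(2,3)
proof (induction j rule: dec_induct)
  case base
  then show ?case using assms by (simp add: pre_digraph.awalk_def pre_digraph.cas.simps)
next
  case (step k)
  then show ?case using assms(1) awalk_snoc[of "Qaff n" i "[i..<k]" k "Suc k"] by auto
qed

lemma dimv_proj_2:
  assumes n: "n \<ge> 2" and i: "i \<in> {1..2*n}"
  shows "dimv (Qaff n) (proj (Qaff n) 2 :: 'k::field rep) i = (if i = 1 then 0 else 1)"
proof (cases "i = 1")
  case True
  have "\<not> pre_digraph.awalk (Qaff n) 2 p 1" for p using awalk_Qaff(2)[OF n, of 2 p 1] by auto
  then have "sp (proj (Qaff n) 2 :: 'k rep) 1 = {0}" by (auto simp: proj_def fun_eq_iff)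
  then show ?thesis using True i by (simp add: dimv_def)
next
  case False
  have "pre_digraph.awalk (Qaff n) 2 p i \<longleftrightarrow> p = [2..<i]" for p
    using awalk_Qaff(3)[OF n, of 2 p i] awalk_Qaff_upt[of 2 n i] False i n by auto
  then have "sp (proj (Qaff n) 2 :: 'k rep) i = {v. \<forall>p. v p \<noteq> 0 \<longrightarrow> p = [2..<i]}" by (simp add: proj_def)
  then show ?thesis using False i by (simp add: dimv_def dim_supported_on_single)
qed

text \<open>The empty path spans the space at \<open>i\<close> and generates the projective. A
  proper subrepresentation therefore vanishes at \<open>i\<close>, and the family \<open>R\<close>,
  spanned by the nonempty paths, is the only maximal one.\<close>

lemma top_dimv_proj:
  assumes n: "n \<ge> 2" and i: "i \<in> {1..2*n}"
  shows "top_dimv (Qaff n) (proj (Qaff n) i :: 'k::field rep) = (\<lambda>j. if j = i then 1 else 0)"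
proof -
  let ?S = "{1..2*n}"
  define P where "P = (proj (Qaff n) i :: 'k rep)"
  have spP: "sp P j = {v. \<forall>p. v p \<noteq> 0 \<longrightarrow> pre_digraph.awalk (Qaff n) i p j}" for j by (simp add: P_def proj_def)
  have actP: "act P a v p = (if p \<noteq> [] \<and> last p = a then v (butlast p) else 0)" for a v p by (simp add: P_def proj_def)
  have sub: "pv.subspace (sp P j)" for j unfolding spP by (rule subspace_supported)
  have spi: "sp P i = {v. \<forall>p. v p \<noteq> 0 \<longrightarrow> p = []}" unfolding spP awalk_Qaff_self[OF n i] ..
  have di: "pv.dim (sp P i) = 1" unfolding spi by (rule dim_supported_on_single)
  then have spi0: "sp P i \<noteq> {0}" by auto
  have act_sp: "act P a v \<in> sp P (head (Qaff n) a)" if a: "a \<in> ?S" and v: "v \<in> sp P (tail (Qaff n) a)" for a v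
    unfolding spP
  proof (intro CollectI allI impI)
    fix p assume "act P a v p \<noteq> 0"
    then have p: "p \<noteq> []" "last p = a" "v (butlast p) \<noteq> 0" by (auto simp: actP split: if_splits)
    then have "pre_digraph.awalk (Qaff n) i (butlast p) (tail (Qaff n) a)" using v unfolding spP by blast
    moreover have "p = butlast p @ [a]" using p by auto
    ultimately show "pre_digraph.awalk (Qaff n) i p (head (Qaff n) a)"
      using a awalk_snoc[of "Qaff n" i "butlast p" a] by (metis Qaff_simps(2))
  qed
  define R where "R = restrict (\<lambda>j. if j = i then {0} else sp P j) ?S"
  have R: "R \<in> subreps (Qaff n) P" unfolding subreps_def Qaff_simps(1,2)
  proof (intro CollectI conjI ballI)
    show "R \<in> extensional ?S" by (simp add: R_def)
    show "pv.subspace (R j)" "R j \<subseteq> sp P j" if "j \<in> ?S" for j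
      using that sub pv.subspace_0[OF sub] by (auto simp: R_def)
    fix a assume a: "a \<in> ?S"
    have ht: "head (Qaff n) a \<in> ?S" "tail (Qaff n) a \<in> ?S" "tail (Qaff n) a < head (Qaff n) a" using a n by auto
    show "act P a ` R (tail (Qaff n) a) \<subseteq> R (head (Qaff n) a)"
    proof (cases "head (Qaff n) a = i")
      case True
      have "sp P (tail (Qaff n) a) = {0}"
      proof -
        have "\<not> pre_digraph.awalk (Qaff n) i p (tail (Qaff n) a)" for p
          using awalk_Qaff(2)[OF n, of i p "tail (Qaff n) a"] ht(3) True by linarith
        then show ?thesis unfolding spP by (auto simp: fun_eq_iff)
      qed
      moreover have "act P a 0 = 0" by (simp add: fun_eq_iff actP)
      ultimately show ?thesis using True ht by (auto simp: R_def simp del: Qaff_simps)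
    next
      case False
      have "R (tail (Qaff n) a) \<subseteq> sp P (tail (Qaff n) a)"
        using ht pv.subspace_0[OF sub] by (auto simp: R_def simp del: Qaff_simps)
      moreover have "R (head (Qaff n) a) = sp P (head (Qaff n) a)" using False ht(1) by (simp add: R_def del: Qaff_simps)
      ultimately show ?thesis using act_sp[OF a] by blast
    qed
  qed
  have Ri: "R i = {0}" and Rj: "\<And>j. j \<in> ?S \<Longrightarrow> j \<noteq> i \<Longrightarrow> R j = sp P j" using i by (auto simp: R_def)
  \<comment> \<open>Applying the arcs of a path one after the other to the empty path yields the
    basis vector of that path.\<close>
  have gen: "U j = sp P j" if U: "U \<in> subreps (Qaff n) P" "U i = sp P i" and j: "j \<in> ?S" for U j
  proof
    have Us: "pv.subspace (U k)" "U k \<subseteq> sp P k" if "k \<in> ?S" for k using U(1) that unfolding subreps_def Qaff_simps(1) by blast+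
    have Ua: "act P a ` U (tail (Qaff n) a) \<subseteq> U (head (Qaff n) a)" if "a \<in> ?S" for a
      using U(1) that unfolding subreps_def Qaff_simps(2) by blast
    show "U j \<subseteq> sp P j" by (rule Us(2)[OF j])
    have unit: "unit_vec p \<in> U k" if "pre_digraph.awalk (Qaff n) i p k" for p k
      using that
    proof (induction p arbitrary: k rule: rev_induct)
      case Nil
      then have "k = i" by (simp add: pre_digraph.awalk_def pre_digraph.cas.simps)
      then show ?case unfolding \<open>k = i\<close> U(2) spi by (simp add: unit_vec_def)
    next
      case (snoc a p)
      then have w: "pre_digraph.awalk (Qaff n) i p (tail (Qaff n) a)" "a \<in> ?S" "head (Qaff n) a = k"
        unfolding awalk_snoc Qaff_simps(2) by blast+
      have "act P a (unit_vec p) = unit_vec (p @ [a])"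
      proof
        fix r
        show "act P a (unit_vec p) r = unit_vec (p @ [a]) r"
          by (cases r rule: rev_cases) (auto simp: actP unit_vec_def)
      qed
      moreover have "act P a (unit_vec p) \<in> U (head (Qaff n) a)" using Ua[OF w(2)] snoc.IH[OF w(1)] by blast
      ultimately show ?case using w(3) by simp
    qed
    show "sp P j \<subseteq> U j"
    proof
      fix v assume v: "v \<in> sp P j"
      define F where "F = {p. pre_digraph.awalk (Qaff n) i p j}"
      have finF: "finite F"
      proof (rule finite_subset)
        show "F \<subseteq> {[i..<j], [2*n]}" using awalk_Qaff(3)[OF n] by (auto simp: F_def)
      qed simp
      have "(\<Sum>p\<in>F. pscale (v p) (unit_vec p)) \<in> U j"
        using Us(1)[OF j] unit by (intro pv.subspace_sum pv.subspace_scale) (auto simp: F_def)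
      moreover have "(\<Sum>p\<in>F. pscale (v p) (unit_vec p)) = v"
      proof
        fix r
        have "(\<Sum>p\<in>F. pscale (v p) (unit_vec p)) r = (\<Sum>p\<in>F. if p = r then v r else 0)"
          unfolding sum_apply by (intro sum.cong) (auto simp: pscale_def unit_vec_def)
        also have "\<dots> = v r" using finF v by (auto simp: spP F_def)
        finally show "(\<Sum>p\<in>F. pscale (v p) (unit_vec p)) r = v r" .
      qed
      ultimately show "v \<in> U j" by simp
    qed
  qed
  have line: "U i = {0} \<or> U i = sp P i" if "U \<in> subreps (Qaff n) P" for U
  proof -
    have "pv.subspace (U i)" "U i \<subseteq> sp P i" using that i unfolding subreps_def Qaff_simps(1) by blast+
    then show ?thesis using subspace_of_single unfolding spi by blast
  qed
  have maxR: "R \<in> maximal_subreps (Qaff n) P" unfolding maximal_subreps_def Qaff_simps(1)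
  proof (intro CollectI conjI ballI impI)
    show "\<exists>j\<in>?S. R j \<noteq> sp P j" using Ri spi0 i by metis
    fix W assume W: "W \<in> subreps (Qaff n) P" "\<forall>j\<in>?S. R j \<subseteq> W j"
    show "(\<forall>j\<in>?S. W j = R j) \<or> (\<forall>j\<in>?S. W j = sp P j)"
    proof (cases "W i = sp P i")
      case True
      then show ?thesis using gen[OF W(1)] by blast
    next
      case False
      have "W j = R j" if j: "j \<in> ?S" for j
      proof (cases "j = i")
        case True
        then show ?thesis using line[OF W(1)] False Ri by simp
      next
        case False
        have "W j \<subseteq> sp P j" using W(1) j unfolding subreps_def Qaff_simps(1) by blast
        then show ?thesis using W(2) j Rj[OF j False] by blast
      qed
      then show ?thesis by blast
    qed
  qed (rule R)
  have uniq: "U j = R j" if U: "U \<in> maximal_subreps (Qaff n) P" and j: "j \<in> ?S" for U j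
  proof -
    have Us: "U \<in> subreps (Qaff n) P" and ne: "\<exists>j\<in>?S. U j \<noteq> sp P j"
      and mx: "\<And>W. W \<in> subreps (Qaff n) P \<Longrightarrow> \<forall>j\<in>?S. U j \<subseteq> W j \<Longrightarrow> (\<forall>j\<in>?S. W j = U j) \<or> (\<forall>j\<in>?S. W j = sp P j)"
      using U unfolding maximal_subreps_def Qaff_simps(1) by blast+
    have "U i \<noteq> sp P i" using gen[OF Us] ne by blast
    then have Ui: "U i = {0}" using line[OF Us] by blast
    have "U j \<subseteq> R j" if j: "j \<in> ?S" for j
    proof (cases "j = i")
      case True
      then show ?thesis using Ui Ri by simp
    next
      case False
      then show ?thesis using Us j Rj[OF j False] unfolding subreps_def Qaff_simps(1) by blast
    qed
    then have "(\<forall>j\<in>?S. R j = U j) \<or> (\<forall>j\<in>?S. R j = sp P j)" using mx[OF R] by blast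
    moreover have "R i \<noteq> sp P i" using Ri spi0 by simp
    ultimately show ?thesis using i j by auto
  qed
  have rad: "rad (Qaff n) P j = R j" if j: "j \<in> ?S" for j
  proof -
    have "(\<Inter>U\<in>maximal_subreps (Qaff n) P. U j) = R j" using maxR uniq[OF _ j] by blast
    moreover have "R j \<subseteq> sp P j" using R j unfolding subreps_def Qaff_simps(1) by blast
    ultimately show ?thesis unfolding rad_def by blast
  qed
  show ?thesis
  proof
    fix j
    show "top_dimv (Qaff n) (proj (Qaff n) i :: 'k rep) j = (if j = i then 1 else 0)"
    proof (cases "j \<in> ?S")
      case True
      then show ?thesis
        using rad[OF True] di Ri Rj[OF True] unfolding top_dimv_def P_def[symmetric] by (auto simp del: atLeastAtMost_iff)
    next
      case False
      then show ?thesis using i by (auto simp: top_dimv_def)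
    qed
  qed
qed

text \<open>Maximal subrepresentations do not exist here, so the intersection in \<open>rad\<close>
  is over the empty family; the intersection with \<open>sp\<close> reduces it to zero.\<close>

lemma top_dimv_zero_rep: "top_dimv Q (zero_rep :: 'k::field rep) = 0"
proof
  fix i
  have "rad Q (zero_rep :: 'k rep) i = {0}" if i: "i \<in> verts Q"
  proof -
    have "maximal_subreps Q (zero_rep :: 'k rep) = {}"
    proof (rule equals0I)
      fix U assume "U \<in> maximal_subreps Q (zero_rep :: 'k rep)"
      then obtain j where "j \<in> verts Q" "U j \<noteq> {0}" "pv.subspace (U j)" "U j \<subseteq> {0}"
        by (auto simp: maximal_subreps_def subreps_def zero_rep_def)
      then show False using pv.subspace_0[of "U j"] by blast
    qed
    then show ?thesis by (simp add: rad_def zero_rep_def)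
  qed
  then show "top_dimv Q (zero_rep :: 'k rep) i = 0 i" by (simp add: top_dimv_def zero_rep_def)
qed

section \<open>Quantum cluster characters of the objects in the theorem\<close>

context affine_torus begin

text \<open>The factor 2 of \<open>euler_form\<close> cancels the 1/2 in the exponent, leaving minus
  \<open>euler\<close>.\<close>

lemma qchar_lincomb:
  fixes V P :: "'k::field rep"
  shows "qchar q n (V, P) = lincomb {e. \<forall>i. e i \<le> dimv (Qaff n) V i}
     (\<lambda>e. real (card (quiver_grass (Qaff n) e V)) *
        real q powr (- of_int (euler n (int \<circ> e) ((\<lambda>i. int (dimv (Qaff n) V i)) - (int \<circ> e)))))
     (\<lambda>e. expo n (\<lambda>i. int (dimv (Qaff n) V i)) (int \<circ> e) + top_dimv (Qaff n) P)"
proof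
  fix g
  have "real q powr (- 1/2 * of_int (euler_form (Qaff n) x y)) = real q powr (- of_int (euler n x y))" for x y
    by (simp add: euler_form_def)
  then show "qchar q n (V, P) g = lincomb {e. \<forall>i. e i \<le> dimv (Qaff n) V i}
     (\<lambda>e. real (card (quiver_grass (Qaff n) e V)) *
        real q powr (- of_int (euler n (int \<circ> e) ((\<lambda>i. int (dimv (Qaff n) V i)) - (int \<circ> e)))))
     (\<lambda>e. expo n (\<lambda>i. int (dimv (Qaff n) V i)) (int \<circ> e) + top_dimv (Qaff n) P) g"
    unfolding qchar_def Let_def prod.case sum_apply lincomb_def expo_def Qaff_simps(1)
    by (intro sum.cong refl) (simp add: qtorus_def monom_def)
qed

lemma card_grass_bound:
  fixes V :: "'k::field rep"
  assumes "finite (UNIV :: 'k set)" "is_rep (Qaff n) V" "card (quiver_grass (Qaff n) e V) \<noteq> 0" "i \<in> {1..2*n}"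
  shows "e i \<le> dimv (Qaff n) V i"
proof -
  obtain U where U: "U \<in> quiver_grass (Qaff n) e V" using assms(3) by (metis all_not_in_conv card.empty)
  obtain T where T: "finite T" "pv.span T = sp V i" using assms(2,4) unfolding is_rep_def Qaff_simps(1) by blast
  have "finite (sp V i)" using pv.finite_span[OF assms(1) T(1)] T(2) by simp
  moreover have "pv.subspace (U i)" "U i \<subseteq> sp V i" "pv.dim (U i) = e i" "pv.subspace (sp V i)"
    using U assms(2,4) unfolding quiver_grass_def subreps_def is_rep_def Qaff_simps(1) by blast+
  ultimately have "e i \<le> pv.dim (sp V i)" using pv.dim_mono_finite[OF assms(1), of "sp V i" "U i"] by simp
  then show ?thesis using assms(4) by (simp add: dimv_def)
qed

text \<open>The Grassmannian counts are the values of \<open>flag_count\<close>. Vectors of the box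
  that exceed the dimension vector have empty Grassmannians and contribute 0.\<close>

lemma qchar_preprojective:
  fixes V :: "'k::field rep"
  assumes fin: "finite (UNIV :: 'k set)" "CARD('k) = q\<^sup>2" and V: "is_rep (Qaff n) V" "indecomposable (Qaff n) V"
    and dims: "\<And>i. i \<in> {1..2*n} \<Longrightarrow> dimv (Qaff n) V i = (if i = 1 then l else Suc l)"
  shows "qchar q n (rep_object V) = layer_elem (l + 2)"
proof
  fix g
  have v: "(\<lambda>i. int (dimv (Qaff n) V i)) = layer_dim n (l + 2)"
  proof
    fix i show "int (dimv (Qaff n) V i) = layer_dim n (l + 2) i"
    proof (cases "i \<in> {1..2*n}")
      case True
      then show ?thesis using dims[OF True] by (simp add: layer_dim_def)
    next
      case False
      then show ?thesis by (auto simp: layer_dim_def dimv_def)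
    qed
  qed
  let ?D = "{e. \<forall>i. e i \<le> dimv (Qaff n) V i}"
  have count: "real (card (quiver_grass (Qaff n) e V)) = flag_count (2*n) (real (q\<^sup>2)) (l + 2) e" for e
    using quiver_grass_preprojective[OF fin(1) n V dims] fin(2) by simp
  have "qchar q n (rep_object V) g = (\<Sum>e\<in>?D. if g = expo n (layer_dim n (l + 2)) (int \<circ> e) then layer_coeff (l + 2) e else 0)"
    unfolding rep_object_def qchar_lincomb v top_dimv_zero_rep lincomb_def count layer_coeff_def by simp
  also have "\<dots> = (\<Sum>e\<in>box n (l + 2). if g = expo n (layer_dim n (l + 2)) (int \<circ> e) then layer_coeff (l + 2) e else 0)"
  proof (rule sum.mono_neutral_left)
    show "?D \<subseteq> box n (l + 2)"
    proof
      fix e assume e: "e \<in> ?D"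
      have "e i \<le> (if i \<in> {1..2*n} then l + 2 else 0)" for i
      proof (cases "i \<in> {1..2*n}")
        case True
        have "e i \<le> dimv (Qaff n) V i" using e by blast
        then show ?thesis using dims[OF True] True by (auto split: if_splits)
      next
        case False
        have "e i \<le> dimv (Qaff n) V i" using e by blast
        then show ?thesis using False by (auto simp: dimv_def)
      qed
      then show "e \<in> box n (l + 2)" unfolding box_def by blast
    qed
    show "\<forall>e\<in>box n (l + 2) - ?D. (if g = expo n (layer_dim n (l + 2)) (int \<circ> e) then layer_coeff (l + 2) e else 0) = 0"
    proof
      fix e assume e: "e \<in> box n (l + 2) - ?D"
      then obtain i where i: "\<not> e i \<le> dimv (Qaff n) V i" by blast
      have "e \<in> box n (l + 2)" using e by (rule DiffD1)
      then have "e i \<le> (if i \<in> {1..2*n} then l + 2 else 0)" unfolding box_def by blast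
      then have "i \<in> {1..2*n}" using i by (auto split: if_splits)
      then have "card (quiver_grass (Qaff n) e V) = 0" using card_grass_bound[OF fin(1) V(1), of e i] i by blast
      then have "layer_coeff (l + 2) e = 0" using count[of e] by (simp add: layer_coeff_def)
      then show "(if g = expo n (layer_dim n (l + 2)) (int \<circ> e) then layer_coeff (l + 2) e else 0) = 0" by simp
    qed
  qed (rule finite_box)
  finally show "qchar q n (rep_object V) g = layer_elem (l + 2) g" by (simp only: layer_elem_def lincomb_def)
qed

text \<open>The zero representation has one subrepresentation, so a single monomial remains, whose
  exponent is the top of the projective.\<close>

lemma qchar_inj_unshift:
  assumes i: "i \<in> {1..2*n}"
  shows "qchar q n (inj_unshift (Qaff n) i :: 'k::field cluster_object) = monom (\<lambda>j. if j = i then 1 else 0)"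
proof
  fix g
  have d0: "dimv (Qaff n) (zero_rep :: 'k rep) = (\<lambda>_. 0)" by (auto simp: dimv_def zero_rep_def fun_eq_iff)
  have z: "(\<lambda>i. int 0) = 0" "int \<circ> (\<lambda>_. 0) = 0" by (auto simp: fun_eq_iff)
  have S: "{e :: nat \<Rightarrow> nat. \<forall>i. e i \<le> 0} = {\<lambda>_. 0}" by auto
  have "quiver_grass (Qaff n) (\<lambda>_. 0) (zero_rep :: 'k rep) = {restrict (\<lambda>_. {0}) {1..2*n}}"
  proof (intro equalityI subsetI)
    fix U assume U: "U \<in> quiver_grass (Qaff n) (\<lambda>_. 0) (zero_rep :: 'k rep)"
    have "U = restrict (\<lambda>_. {0}) {1..2*n}"
    proof (rule extensionalityI[of _ "{1..2*n}"])
      show "U \<in> extensional {1..2*n}" using U by (simp add: quiver_grass_def subreps_def)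
      fix j assume j: "j \<in> {1..2*n}"
      then have "pv.subspace (U j)" "U j \<subseteq> {0}" using U by (auto simp: quiver_grass_def subreps_def zero_rep_def)
      then show "U j = restrict (\<lambda>_. {0}) {1..2*n} j" using pv.subspace_0 j by auto
    qed auto
    then show "U \<in> {restrict (\<lambda>_. {0}) {1..2*n}}" by simp
  next
    fix U :: "nat \<Rightarrow> 'k pvec set" assume "U \<in> {restrict (\<lambda>_. {0}) {1..2*n}}"
    then show "U \<in> quiver_grass (Qaff n) (\<lambda>_. 0) (zero_rep :: 'k rep)"
      using n by (auto simp: quiver_grass_def subreps_def zero_rep_def)
  qed
  then have "card (quiver_grass (Qaff n) (\<lambda>_. 0) (zero_rep :: 'k rep)) = 1" by simp
  moreover have "euler n 0 x = 0" for x by (simp add: bilin_def)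
  moreover have "expo n 0 0 = 0" by (auto simp: expo_def mat_vec_def fun_eq_iff)
  ultimately show "qchar q n (inj_unshift (Qaff n) i :: 'k cluster_object) g = monom (\<lambda>j. if j = i then 1 else 0) g"
    unfolding inj_unshift_def qchar_lincomb d0 S lincomb_def z top_dimv_proj[OF n i] using q
    by (simp add: z monom_def)
qed

text \<open>Here \<open>layer_dim n 1\<close> and \<open>layer_dim n 0\<close> are minus the
  dimension vectors (1, 0, ..., 0) and (2, 1, ..., 1) of the injectives at \<open>1\<close> and
  \<open>2 * n\<close>. This is why the two shifted injectives continue the sequence of the M_1(l)
  downwards.\<close>

lemma layer_elem_small:
  assumes "k \<le> 1"
  shows "layer_elem k = monom (- mat_vec {1..2*n} (id_minus_Rtr (Qaff n)) (layer_dim n k))"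
proof
  fix g
  have b: "box n 0 = {\<lambda>_. 0}" by (auto simp: box_def)
  have z: "int \<circ> (\<lambda>_. 0) = 0" by (auto simp: fun_eq_iff)
  have "flag_count (2*n) (real (q\<^sup>2)) k (\<lambda>_. 0) = 1"
    using assms by (cases k) auto
  moreover have "euler n 0 x = 0" for x by (simp add: bilin_def)
  ultimately have c: "layer_coeff k (\<lambda>_. 0) = 1" unfolding layer_coeff_def z using q by simp
  have e: "expo n v 0 = - mat_vec {1..2*n} (id_minus_Rtr (Qaff n)) v" for v
    by (auto simp: expo_def mat_vec_def fun_eq_iff)
  show "layer_elem k g = monom (- mat_vec {1..2*n} (id_minus_Rtr (Qaff n)) (layer_dim n k)) g"
    using layer_elem_box[of k 0] assms by (simp add: b lincomb_def c z e monom_def)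
qed

lemma layer_elem_0: "layer_elem 0 = monom (\<lambda>j. if j = 2*n then 1 else 0)"
proof -
  have "- mat_vec {1..2*n} (id_minus_Rtr (Qaff n)) (layer_dim n 0) = (\<lambda>j. if j = 2*n then 1 else 0)"
  proof
    fix i show "(- mat_vec {1..2*n} (id_minus_Rtr (Qaff n)) (layer_dim n 0)) i = (if i = 2*n then 1 else 0)"
    proof (cases "i \<in> {1..2*n}")
      case True
      show ?thesis unfolding fun_Compl_def mat_vec_A[OF True] using n True by (auto simp: layer_dim_def)
    next
      case False
      then show ?thesis using n by (auto simp: mat_vec_def)
    qed
  qed
  then show ?thesis using layer_elem_small[of 0] by simp
qed

lemma layer_elem_1: "layer_elem 1 = monom (\<lambda>j. if j = 1 then 1 else 0)"
proof -
  have "- mat_vec {1..2*n} (id_minus_Rtr (Qaff n)) (layer_dim n 1) = (\<lambda>j. if j = 1 then 1 else 0)"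
  proof
    fix i show "(- mat_vec {1..2*n} (id_minus_Rtr (Qaff n)) (layer_dim n 1)) i = (if i = 1 then 1 else 0)"
    proof (cases "i \<in> {1..2*n}")
      case True
      show ?thesis unfolding fun_Compl_def mat_vec_A[OF True] using n True by (auto simp: layer_dim_def)
    next
      case False
      then show ?thesis using n by (auto simp: mat_vec_def)
    qed
  qed
  then show ?thesis using layer_elem_small[of 1] by simp
qed

text \<open>All spaces are lines, so a subrepresentation is given by the vertices at which it is
  nonzero. The identity arrows make them a final segment, and on a final segment the chord imposes
  no further condition, whatever the scalar \<open>c\<close> is.\<close>

lemma qchar_Erep:
  fixes c :: "'k::field"
  shows "qchar q n (rep_object (Erep n c)) = delta_elem"
proof
  fix g
  let ?S = "{1..2*n}" and ?E = "Erep n c"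
  define L where "L = {v :: 'k pvec. \<forall>p. v p \<noteq> 0 \<longrightarrow> p = []}"
  have spE: "sp ?E i = L" for i by (auto simp: Erep_def L_def)
  have actE: "act ?E a v = (if a = 2*n then pscale c v else v)" for a v by (simp add: Erep_def)
  have dL: "pv.dim L = 1" unfolding L_def by (rule dim_supported_on_single)
  have sL: "pv.subspace L" unfolding L_def by (rule subspace_supported)
  have L0: "L \<noteq> {0}" using dL by auto
  have dimE: "dimv (Qaff n) ?E i = (if i \<in> ?S then 1 else 0)" for i by (simp add: dimv_def spE dL)
  have v: "(\<lambda>i. int (dimv (Qaff n) ?E i)) = \<epsilon> 1" by (auto simp: dimE interval_vec_def fun_eq_iff)
  define \<eta> where "\<eta> j i = (if i \<in> {j..2*n} then 1 else 0 :: nat)" for j i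
  have int\<eta>: "int \<circ> \<eta> j = \<epsilon> j" for j by (auto simp: \<eta>_def interval_vec_def fun_eq_iff)
  have grD: "U \<in> extensional ?S" "\<And>i. i \<in> ?S \<Longrightarrow> pv.subspace (U i) \<and> U i \<subseteq> L \<and> pv.dim (U i) = e i"
    "\<And>i. i \<in> {1..<2*n} \<Longrightarrow> U i \<subseteq> U (Suc i)" if U: "U \<in> quiver_grass (Qaff n) e ?E" for U e
  proof -
    show "U \<in> extensional ?S" using U by (simp add: quiver_grass_def subreps_def)
    show "pv.subspace (U i) \<and> U i \<subseteq> L \<and> pv.dim (U i) = e i" if "i \<in> ?S" for i
      using U that unfolding quiver_grass_def subreps_def spE Qaff_simps(1) by blast
    show "U i \<subseteq> U (Suc i)" if i: "i \<in> {1..<2*n}" for i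
    proof -
      have "i \<in> ?S" "i \<noteq> 2*n" using i by auto
      then have "act ?E i ` U (tail (Qaff n) i) \<subseteq> U (head (Qaff n) i)"
        using U unfolding quiver_grass_def subreps_def Qaff_simps(2) by blast
      then show ?thesis using \<open>i \<noteq> 2*n\<close> by (simp add: actE)
    qed
  qed
  have line: "U = {0} \<or> U = L" if "pv.subspace U" "U \<subseteq> L" for U
    using subspace_of_single[of U "[]"] that unfolding L_def by blast
  have shape: "\<exists>j\<in>{1..Suc (2*n)}. e = \<eta> j" if U: "U \<in> quiver_grass (Qaff n) e ?E" and e: "\<forall>i. e i \<le> dimv (Qaff n) ?E i" for U e
  proof -
    have out: "e i = 0" if "i \<notin> ?S" for i
    proof -
      have "e i \<le> dimv (Qaff n) ?E i" using e by blast
      then show ?thesis using that by (simp add: dimE del: atLeastAtMost_iff)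
    qed
    have val: "e i = (if U i = L then 1 else 0)" if i: "i \<in> ?S" for i
    proof -
      have u: "U i = {0} \<or> U i = L" and d: "pv.dim (U i) = e i"
        using grD(2)[OF U i] line[of "U i"] by blast+
      show ?thesis
      proof (cases "U i = L")
        case True
        then show ?thesis using d dL by simp
      next
        case False
        then have "U i = {0}" using u by blast
        then show ?thesis using d False by simp
      qed
    qed
    show ?thesis
    proof (cases "\<exists>i\<in>?S. U i = L")
      case False
      have "e = \<eta> (Suc (2*n))"
      proof
        fix i show "e i = \<eta> (Suc (2*n)) i" using val[of i] out[of i] False by (cases "i \<in> ?S") (auto simp: \<eta>_def)
      qed
      then show ?thesis by auto
    next
      case True
      define j where "j = (LEAST i. i \<in> ?S \<and> U i = L)"
      have j: "j \<in> ?S \<and> U j = L" unfolding j_def by (rule LeastI_ex) (use True in blast)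
      have less: "\<not> (i \<in> ?S \<and> U i = L)" if "i < j" for i
        using not_less_Least[of i "\<lambda>i. i \<in> ?S \<and> U i = L"] that unfolding j_def by blast
      have ge: "U i = L" if "j \<le> i" "i \<le> 2*n" for i
        using that
      proof (induction i rule: dec_induct)
        case base
        then show ?case using j by blast
      next
        case (step i)
        then have "i \<in> {1..<2*n}" "Suc i \<in> ?S" using j by auto
        then have "U i \<subseteq> U (Suc i)" "U (Suc i) \<subseteq> L" using grD(2,3)[OF U] by blast+
        then show ?case using step by auto
      qed
      have "e = \<eta> j"
      proof
        fix i
        show "e i = \<eta> j i"
        proof (cases "i \<in> ?S")
          case True
          then show ?thesis using val[OF True] less[of i] ge[of i] by (cases "i < j") (auto simp: \<eta>_def)
        next
          case False
          then show ?thesis using out[OF False] j by (auto simp: \<eta>_def)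
        qed
      qed
      then show ?thesis using j by auto
    qed
  qed
  have one: "card (quiver_grass (Qaff n) (\<eta> j) ?E) = 1" if j: "j \<in> {1..Suc (2*n)}" for j
  proof -
    define U0 where "U0 = restrict (\<lambda>i. if j \<le> i then L else {0}) ?S"
    have "U0 \<in> quiver_grass (Qaff n) (\<eta> j) ?E"
      unfolding quiver_grass_def subreps_def spE Qaff_simps(1,2)
    proof (intro CollectI conjI ballI)
      show "U0 \<in> extensional ?S" by (simp add: U0_def)
      show "pv.subspace (U0 i)" "U0 i \<subseteq> L" if "i \<in> ?S" for i
        using that sL pv.subspace_0[OF sL] by (auto simp: U0_def)
      show "pv.dim (U0 i) = \<eta> j i" if "i \<in> ?S" for i using that dL by (auto simp: U0_def \<eta>_def)
      show "act ?E a ` U0 (tail (Qaff n) a) \<subseteq> U0 (head (Qaff n) a)" if a: "a \<in> ?S" for a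
        using a n pv.subspace_scale[OF sL] pv.subspace_0[OF sL] by (auto simp: U0_def actE split: if_splits)
    qed
    moreover have "U = U0" if U: "U \<in> quiver_grass (Qaff n) (\<eta> j) ?E" for U
    proof (rule extensionalityI[of _ ?S])
      show "U \<in> extensional ?S" by (rule grD(1)[OF U])
      fix i assume i: "i \<in> ?S"
      have u: "U i = {0} \<or> U i = L" and d: "pv.dim (U i) = \<eta> j i"
        using grD(2)[OF U i] line[of "U i"] by blast+
      show "U i = U0 i"
      proof (cases "j \<le> i")
        case True
        then have "pv.dim (U i) = 1" using d i by (simp add: \<eta>_def)
        then have "U i \<noteq> {0}" by auto
        then show ?thesis using u True i by (simp add: U0_def)
      next
        case False
        then have "pv.dim (U i) \<noteq> 1" using d by (simp add: \<eta>_def)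
        then have "U i \<noteq> L" using dL by blast
        then show ?thesis using u False i by (simp add: U0_def)
      qed
    qed (simp add: U0_def)
    ultimately have "quiver_grass (Qaff n) (\<eta> j) ?E = {U0}" by blast
    then show ?thesis by simp
  qed
  have inj: "inj_on \<eta> {1..Suc (2*n)}"
  proof -
    have *: "\<eta> j \<noteq> \<eta> k" if "j \<in> {1..Suc (2*n)}" "k \<in> {1..Suc (2*n)}" "j < k" for j k
    proof -
      have "\<eta> j j = 1" "\<eta> k j = 0" using that by (auto simp: \<eta>_def)
      then show ?thesis by auto
    qed
    show ?thesis
    proof (rule inj_onI)
      fix j k assume jk: "j \<in> {1..Suc (2*n)}" "k \<in> {1..Suc (2*n)}" "\<eta> j = \<eta> k"
      then show "j = k" using *[OF jk(1,2)] *[OF jk(2,1)] by (cases j k rule: linorder_cases) auto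
    qed
  qed
  let ?D = "{e. \<forall>i. e i \<le> dimv (Qaff n) ?E i}"
  let ?h = "\<lambda>e. if g = expo n (\<epsilon> 1) (int \<circ> e) then real (card (quiver_grass (Qaff n) e ?E)) *
      real q powr (- of_int (euler n (int \<circ> e) (\<epsilon> 1 - (int \<circ> e)))) else 0"
  have "qchar q n (rep_object ?E) g = (\<Sum>e\<in>?D. ?h e)"
    unfolding rep_object_def qchar_lincomb v top_dimv_zero_rep lincomb_def by simp
  also have "\<dots> = (\<Sum>e\<in>\<eta> ` {1..Suc (2*n)}. ?h e)"
  proof (rule sum.mono_neutral_right)
    show "finite ?D"
    proof (rule finite_subset)
      show "?D \<subseteq> box n 1"
      proof
        fix e assume "e \<in> ?D"
        then have "e i \<le> (if i \<in> ?S then 1 else 0)" for i unfolding dimE by blast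
        then show "e \<in> box n 1" unfolding box_def by blast
      qed
    qed (rule finite_box)
    show "\<eta> ` {1..Suc (2*n)} \<subseteq> ?D" by (auto simp: \<eta>_def dimE)
    show "\<forall>e\<in>?D - \<eta> ` {1..Suc (2*n)}. ?h e = 0"
    proof
      fix e assume e: "e \<in> ?D - \<eta> ` {1..Suc (2*n)}"
      then have "quiver_grass (Qaff n) e ?E = {}" using shape[of _ e] by blast
      then have "card (quiver_grass (Qaff n) e ?E) = 0" by (simp only: card.empty)
      then show "?h e = 0" by simp
    qed
  qed
  also have "\<dots> = (\<Sum>j\<in>{1..Suc (2*n)}. ?h (\<eta> j))" by (rule sum.reindex[OF inj, unfolded o_def])
  also have "\<dots> = delta_elem g"
    unfolding delta_elem_def lincomb_def int\<eta> by (intro sum.cong refl) (simp add: one)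
  finally show "qchar q n (rep_object ?E) g = delta_elem g" .
qed

end

section \<open>The identities as instances of the layer recursion\<close>

theorem lemma3p6:
  fixes n q :: nat and \<iota> :: "'f::{field,finite} \<Rightarrow> 'k::field" and c :: 'k
    and M\<^sub>1 :: "nat \<Rightarrow> 'k rep"
  assumes "n \<ge> 2"
    and "degree2_extension \<iota>"
    and "q = CARD('f)"
    and "\<And>l. is_rep (Qaff n) (M\<^sub>1 l)"
    and "\<And>l. indecomposable (Qaff n) (M\<^sub>1 l)"
    and "\<And>l. indec_preprojective (Qaff n) (M\<^sub>1 l)"
    and "\<And>l i. i \<in> {1..2*n} \<Longrightarrow>
           dimv (Qaff n) (M\<^sub>1 l) i = dimv (Qaff n) (proj (Qaff n) 2 :: 'k rep) i + l"
  shows "let T = qtorus q n;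
             X\<^sub>\<delta> = qchar q n (rep_object (Erep n c));
             X\<^sub>M = (\<lambda>l. qchar q n (rep_object (M\<^sub>1 l)));
             X\<^sub>I = (\<lambda>i. qchar q n (inj_unshift (Qaff n) i :: 'k cluster_object))
         in X\<^sub>\<delta> \<otimes>\<^bsub>T\<^esub> X\<^sub>I 1 =
              (real q powr (1/2)) \<odot>\<^bsub>T\<^esub> X\<^sub>M 0 \<oplus>\<^bsub>T\<^esub> (real q powr (- 1/2)) \<odot>\<^bsub>T\<^esub> X\<^sub>I (2*n) \<and>
            X\<^sub>\<delta> \<otimes>\<^bsub>T\<^esub> X\<^sub>M 0 =
              (real q powr (1/2)) \<odot>\<^bsub>T\<^esub> X\<^sub>M 1 \<oplus>\<^bsub>T\<^esub> (real q powr (- 1/2)) \<odot>\<^bsub>T\<^esub> X\<^sub>I 1 \<and>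
            (\<forall>l\<ge>1. X\<^sub>\<delta> \<otimes>\<^bsub>T\<^esub> X\<^sub>M l =
              (real q powr (1/2)) \<odot>\<^bsub>T\<^esub> X\<^sub>M (l + 1) \<oplus>\<^bsub>T\<^esub> (real q powr (- 1/2)) \<odot>\<^bsub>T\<^esub> X\<^sub>M (l - 1))"
proof -
  have "card {0 :: 'f, 1} \<le> CARD('f)" by (rule card_mono) auto
  then have q: "q \<ge> 2" using assms(3) by simp
  interpret affine_torus n q using assms(1) q by unfold_locales
  note k = card_degree2_extension[OF assms(2), folded assms(3)]
  have dims: "dimv (Qaff n) (M\<^sub>1 l) i = (if i = 1 then l else Suc l)" if "i \<in> {1..2*n}" for l i
    using assms(7)[OF that, of l] dimv_proj_2[OF assms(1) that, where 'k = 'k] by simp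
  have XM: "qchar q n (rep_object (M\<^sub>1 l)) = layer_elem (l + 2)" for l
    by (rule qchar_preprojective[OF k assms(4,5) dims])
  have XI: "qchar q n (inj_unshift (Qaff n) 1 :: 'k cluster_object) = layer_elem 1"
    "qchar q n (inj_unshift (Qaff n) (2*n) :: 'k cluster_object) = layer_elem 0"
    unfolding layer_elem_0 layer_elem_1 using assms(1) by (intro qchar_inj_unshift; simp)+
  have T: "a \<odot>\<^bsub>qtorus q n\<^esub> x \<oplus>\<^bsub>qtorus q n\<^esub> b \<odot>\<^bsub>qtorus q n\<^esub> y = (\<lambda>g. a * x g + b * y g)" for a b x y
    by (simp add: qtorus_def fun_eq_iff)
  \<comment> \<open>The first two identities are \<open>k = 0\<close> and \<open>k = 1\<close>,
    where the layers \<open>0\<close> and \<open>1\<close> are the cluster variables at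
    \<open>2 * n\<close> and \<open>1\<close>; the third is \<open>k = l + 1\<close>.\<close>
  have step: "delta_elem \<otimes>\<^bsub>qtorus q n\<^esub> layer_elem (k + 1) =
      (real q powr (1/2)) \<odot>\<^bsub>qtorus q n\<^esub> layer_elem (k + 2) \<oplus>\<^bsub>qtorus q n\<^esub> (real q powr (- 1/2)) \<odot>\<^bsub>qtorus q n\<^esub> layer_elem k" for k
    unfolding T using delta_mult_layer[of k] by simp
  show ?thesis
    unfolding Let_def XM XI qchar_Erep
  proof (intro conjI allI impI)
    show "delta_elem \<otimes>\<^bsub>qtorus q n\<^esub> layer_elem 1 =
      (real q powr (1/2)) \<odot>\<^bsub>qtorus q n\<^esub> layer_elem (0 + 2) \<oplus>\<^bsub>qtorus q n\<^esub> (real q powr (- 1/2)) \<odot>\<^bsub>qtorus q n\<^esub> layer_elem 0"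
      using step[of 0] by simp
    show "delta_elem \<otimes>\<^bsub>qtorus q n\<^esub> layer_elem (0 + 2) =
      (real q powr (1/2)) \<odot>\<^bsub>qtorus q n\<^esub> layer_elem (1 + 2) \<oplus>\<^bsub>qtorus q n\<^esub> (real q powr (- 1/2)) \<odot>\<^bsub>qtorus q n\<^esub> layer_elem 1"
      using step[of 1] by (simp add: numeral_2_eq_2 numeral_3_eq_3)
    fix l :: nat assume "l \<ge> 1"
    then obtain l' where "l = l' + 1" by (metis add.commute le_Suc_ex)
    then show "delta_elem \<otimes>\<^bsub>qtorus q n\<^esub> layer_elem (l + 2) =
      (real q powr (1/2)) \<odot>\<^bsub>qtorus q n\<^esub> layer_elem (l + 1 + 2) \<oplus>\<^bsub>qtorus q n\<^esub> (real q powr (- 1/2)) \<odot>\<^bsub>qtorus q n\<^esub> layer_elem (l - 1 + 2)"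
      using step[of "l' + 2"] by (simp add: ac_simps)
  qed
qed

end
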